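(* The space $\mathbb{R}^8\otimes\mathfrak{m}$ splits into six irreducible $\mathrm{PSU}(3)$-modules: $$\mathbb{R}^8\otimes\mathfrak{m}=\mathcal{W}_1\oplus\mathcal{W}_2\oplus\mathcal{W}_3\oplus\mathcal{W}_4\oplus\mathcal{W}_5\oplus\mathcal{W}_6 .$$
   Context: Algebraic setting. $\mathbb{R}^8$ is oriented Euclidean space, identified with its dual via the scalar product; $(e_1,\dots,e_8)$ is an oriented orthonormal basis, $e_{i_1\dots i_j}=e_{i_1}\wedge\dots\wedge e_{i_j}$, and $\Lambda^k$ is the space of $k$-forms. For $\alpha\in\Lambda^k,\beta\in\Lambda^l$ put $\sigma_0(\alpha,\beta)=\alpha\wedge\beta$ and $\sigma_j(\alpha,\beta)=\sum_{i_1<\dots<i_j}(e_{i_1}\lrcorner\cdots\lrcorner e_{i_j}\lrcorner\alpha)\wedge(e_{i_1}\lrcorner\cdots\lrcorner e_{i_j}\lrcorner\beta)\in\Lambda^{k+l-2j}$. For $\alpha\in\Lambda^k$, $\beta\in\Lambda^l$, $k\le l$, the contraction is $\alpha\lrcorner\beta=\sigma_k(\alpha,\beta)$; $\ast$ is the Hodge operator. Let $$\rho=e_{246}-e_{235}-e_{145}-e_{136}+(e_{12}+e_{34}-2e_{56})\wedge e_7+\sqrt3\,(e_{12}-e_{34})\wedge e_8 .$$ $\mathrm{PSU}(3)\subset\mathrm{SO}(8)$ is the isotropy group of $\rho$. Put $\sigma_+(\alpha)=\sigma_1(\rho,\alpha)$ and $\sigma_-(\alpha)=\sigma_2(\rho,\alpha)$.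 Modules: $\Lambda^2_8=\{\sigma_+(\xi)\mid\xi\in\Lambda^1\}$, $\Lambda^2_{20}=\{\omega\in\Lambda^2\mid\omega\wedge\ast\rho=0\}$, $\Lambda^3_1=\mathbb{R}\rho$, $\Lambda^3_8=\{\ast(\omega\wedge\rho)\mid\omega\in\Lambda^2_8\}$, $\Lambda^3_{20}=\{\sigma_+(\omega)\mid\omega\in\Lambda^2_{20}\}$, $\Lambda^3_{27}=\{T\in\Lambda^3\mid T\wedge\rho=0,\ T\wedge\ast\rho=0\}$, $\Lambda^4_8=\sigma_+(\Lambda^3_8)$, $\Lambda^4_{27}=\sigma_+(\Lambda^3_{27})$. Identify $\mathfrak{so}(8)=\Lambda^2$; then $\mathfrak{psu}(3)=\Lambda^2_8$ and $\mathfrak{m}=\Lambda^2_{20}$ is its orthogonal complement, with orthogonal projection $\mathrm{pr}_{\mathfrak m}$. Maps: $\Phi_1:\mathbb{R}^8\otimes\mathfrak m\to\Lambda^3$, $\Phi_1(X\otimes\omega)=X\wedge\omega$; $\Phi_2:\mathbb{R}^8\otimes\mathfrak m\to\Lambda^4$, $\Phi_2(X\otimes\omega)=(X\lrcorner\rho)\wedge\omega$; $\Theta_1:\Lambda^3\to\mathbb{R}^8\otimes\mathfrak m$, $\Theta_1(T)=-\frac12\sum_i e_i\otimes\mathrm{pr}_{\mathfrak m}(e_i\lrcorner T)$; $\Theta_2:\Lambda^4\to\mathbb{R}^8\otimes\mathfrak m$, $\Theta_2(F)=-\sum_i e_i\otimes\mathrm{pr}_{\mathfrak m}((e_i\lrcorner\rho)\lrcorner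 F)$. Subspaces of $\mathbb{R}^8\otimes\mathfrak m$: $\mathcal{W}_1=\Theta_1(\Lambda^3_8)$, $\mathcal{W}_2=\Theta_1(\Lambda^3_{20})$, $\mathcal{W}_3=\Theta_1(\Lambda^3_{27})$, $\mathcal{W}_4=\Theta_2(\ast\Lambda^4_8)$, $\mathcal{W}_5=\Theta_2(\ast\Lambda^4_{27})$, $\mathcal{W}_6=\mathrm{Ker}(\Phi_1)\cap\mathrm{Ker}(\Phi_2)$. *)

theory Defs
  imports "HOL-Analysis.Analysis"
begin

section \<open>Forms on \<open>\<real>\<^sup>8\<close>\<close>

text \<open>
  An element of the exterior algebra of \<^typ>\<open>real^8\<close> is the family of its coefficients with
  respect to the basis \<open>e\<^sub>I = e\<^bsub>i1\<^esub> \<and> \<dots> \<and> e\<^bsub>ik\<^esub>\<close>, \<open>I = {i1 < \<dots> < ik}\<close>, so that this basis is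
  orthonormal for the inner product of \<open>real ^ (8 set)\<close>.  The elements of type \<open>8\<close> are ordered as
  \<open>0 < 1 < \<dots> < 7\<close>; the vector \<open>e\<^sub>n\<close> (\<open>1 \<le> n \<le> 8\<close>) is the one with index \<open>n - 1\<close>, and the
  orientation is the one given by this order.
\<close>

type_synonym form = "real ^ (8 set)"

definition Lam :: "nat \<Rightarrow> form set" where
  "Lam k = {\<alpha>. \<forall>I. card I \<noteq> k \<longrightarrow> \<alpha> $ I = 0}"

text \<open>The sign of the permutation sorting the concatenation of two increasing sequences.\<close>

definition shuffle_sign :: "8 set \<Rightarrow> 8 set \<Rightarrow> real" where
  "shuffle_sign I J = (-1) ^ card {(i, j). i \<in> I \<and> j \<in> J \<and> j < i}"

definition wedge :: "form \<Rightarrow> form \<Rightarrow> form"  (infixr "\<^bold>\<and>" 70) where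
  "\<alpha> \<^bold>\<and> \<beta> = (\<chi> K. \<Sum>I\<in>Pow K. shuffle_sign I (K - I) * \<alpha> $ I * \<beta> $ (K - I))"

definition wedge_list :: "form list \<Rightarrow> form" where
  "wedge_list \<alpha>s = foldr wedge \<alpha>s (axis {} 1)"

text \<open>The identification of \<open>\<real>\<^sup>8\<close> with \<open>\<Lambda>\<^sup>1\<close>.\<close>

definition form1 :: "real^8 \<Rightarrow> form" where
  "form1 X = (\<Sum>i\<in>UNIV. X $ i *\<^sub>R axis {i} 1)"

definition eb :: "nat list \<Rightarrow> form" where
  "eb ns = wedge_list (map (\<lambda>n. form1 (axis (of_nat (n - 1)) 1)) ns)"

text \<open>Insertion of a basis vector into the first argument of a form.\<close>

definition int_e :: "8 \<Rightarrow> form \<Rightarrow> form" where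
  "int_e i \<alpha> = (\<chi> K. if i \<in> K then 0 else shuffle_sign {i} K * \<alpha> $ insert i K)"

definition sigma :: "nat \<Rightarrow> form \<Rightarrow> form \<Rightarrow> form" where
  "sigma j \<alpha> \<beta> = (\<Sum>I | card I = j.
     foldr int_e (sorted_list_of_set I) \<alpha> \<^bold>\<and> foldr int_e (sorted_list_of_set I) \<beta>)"

text \<open>The contraction of a \<open>k\<close>-form with a form of degree at least \<open>k\<close>.\<close>

definition contr :: "nat \<Rightarrow> form \<Rightarrow> form \<Rightarrow> form" where
  "contr k \<alpha> \<beta> = sigma k \<alpha> \<beta>"

definition hodge :: "form \<Rightarrow> form" where
  "hodge \<alpha> = (\<chi> K. shuffle_sign (- K) K * \<alpha> $ (- K))"

definition rho :: form where
  "rho = eb [2,4,6] - eb [2,3,5] - eb [1,4,5] - eb [1,3,6]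
       + (eb [1,2] + eb [3,4] - 2 *\<^sub>R eb [5,6]) \<^bold>\<and> eb [7]
       + sqrt 3 *\<^sub>R ((eb [1,2] - eb [3,4]) \<^bold>\<and> eb [8])"

definition sigma_plus :: "form \<Rightarrow> form" where
  "sigma_plus \<alpha> = sigma 1 rho \<alpha>"


section \<open>The group and its action\<close>

text \<open>The action of a matrix on forms is the linear extension of
  \<open>e\<^sub>I \<mapsto> A e\<^bsub>i1\<^esub> \<and> \<dots> \<and> A e\<^bsub>ik\<^esub>\<close>.\<close>

definition act_form :: "real^8^8 \<Rightarrow> form \<Rightarrow> form" where
  "act_form A \<alpha> = (\<Sum>I\<in>UNIV. \<alpha> $ I *\<^sub>R
     wedge_list (map (\<lambda>i. form1 (A *v axis i 1)) (sorted_list_of_set I)))"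

definition SO8 :: "(real^8^8) set" where
  "SO8 = {A. orthogonal_matrix A \<and> det A = 1}"

definition PSU3 :: "(real^8^8) set" where
  "PSU3 = {A \<in> SO8. act_form A rho = rho}"


section \<open>Modules of forms\<close>

definition Lam2_8 :: "form set" where
  "Lam2_8 = sigma_plus ` Lam 1"

definition Lam2_20 :: "form set" where
  "Lam2_20 = {\<omega> \<in> Lam 2. \<omega> \<^bold>\<and> hodge rho = 0}"

definition Lam3_8 :: "form set" where
  "Lam3_8 = {hodge (\<omega> \<^bold>\<and> rho) | \<omega>. \<omega> \<in> Lam2_8}"

definition Lam3_20 :: "form set" where
  "Lam3_20 = sigma_plus ` Lam2_20"

definition Lam3_27 :: "form set" where
  "Lam3_27 = {T \<in> Lam 3. T \<^bold>\<and> rho = 0 \<and> T \<^bold>\<and> hodge rho = 0}"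

definition Lam4_8 :: "form set" where
  "Lam4_8 = sigma_plus ` Lam3_8"

definition Lam4_27 :: "form set" where
  "Lam4_27 = sigma_plus ` Lam3_27"

abbreviation \<mm> :: "form set" where
  "\<mm> \<equiv> Lam2_20"

definition orth_proj :: "'a::euclidean_space set \<Rightarrow> 'a \<Rightarrow> 'a" where
  "orth_proj S x = (THE y. y \<in> S \<and> (\<forall>z\<in>S. orthogonal (x - y) z))"


section \<open>The tensor product \<open>\<real>\<^sup>8 \<otimes> \<mm>\<close>\<close>

text \<open>An element of \<open>\<real>\<^sup>8 \<otimes> \<Lambda>\<close> is written uniquely as \<open>\<Sum>i. e\<^sub>i \<otimes> t\<^sub>i\<close> and is represented
  by the family of the \<open>t\<^sub>i\<close>.\<close>

type_synonym tens = "form ^ 8"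

definition tensor :: "real^8 \<Rightarrow> form \<Rightarrow> tens"  (infixr "\<otimes>\<^sub>t" 75) where
  "X \<otimes>\<^sub>t \<omega> = (\<chi> i. X $ i *\<^sub>R \<omega>)"

definition R8_m :: "tens set" where
  "R8_m = span {X \<otimes>\<^sub>t \<omega> | X \<omega>. \<omega> \<in> \<mm>}"

definition act_tens :: "real^8^8 \<Rightarrow> tens \<Rightarrow> tens" where
  "act_tens A t = (\<Sum>i\<in>UNIV. (A *v axis i 1) \<otimes>\<^sub>t act_form A (t $ i))"

definition Phi1 :: "tens \<Rightarrow> form" where
  "Phi1 t = (\<Sum>i\<in>UNIV. form1 (axis i 1) \<^bold>\<and> t $ i)"

definition Phi2 :: "tens \<Rightarrow> form" where
  "Phi2 t = (\<Sum>i\<in>UNIV. contr 1 (form1 (axis i 1)) rho \<^bold>\<and> t $ i)"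

definition Theta1 :: "form \<Rightarrow> tens" where
  "Theta1 T = - (1 / 2) *\<^sub>R
     (\<Sum>i\<in>UNIV. axis i 1 \<otimes>\<^sub>t orth_proj \<mm> (contr 1 (form1 (axis i 1)) T))"

definition Theta2 :: "form \<Rightarrow> tens" where
  "Theta2 F =
     - (\<Sum>i\<in>UNIV. axis i 1 \<otimes>\<^sub>t orth_proj \<mm> (contr 2 (contr 1 (form1 (axis i 1)) rho) F))"

definition W1 :: "tens set" where "W1 = Theta1 ` Lam3_8"
definition W2 :: "tens set" where "W2 = Theta1 ` Lam3_20"
definition W3 :: "tens set" where "W3 = Theta1 ` Lam3_27"
definition W4 :: "tens set" where "W4 = Theta2 ` hodge ` Lam4_8"
definition W5 :: "tens set" where "W5 = Theta2 ` hodge ` Lam4_27"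
definition W6 :: "tens set" where "W6 = {t \<in> R8_m. Phi1 t = 0 \<and> Phi2 t = 0}"


section \<open>Irreducible modules and direct sums\<close>

definition invariant_subspace ::
    "'g set \<Rightarrow> ('g \<Rightarrow> 'v \<Rightarrow> 'v) \<Rightarrow> 'v::real_vector set \<Rightarrow> bool" where
  "invariant_subspace G act U \<longleftrightarrow> subspace U \<and> (\<forall>g\<in>G. \<forall>u\<in>U. act g u \<in> U)"

definition irreducible_module ::
    "'g set \<Rightarrow> ('g \<Rightarrow> 'v \<Rightarrow> 'v) \<Rightarrow> 'v::real_vector set \<Rightarrow> bool" where
  "irreducible_module G act V \<longleftrightarrow> invariant_subspace G act V \<and> V \<noteq> {0} \<and>
     (\<forall>U. U \<subseteq> V \<and> invariant_subspace G act U \<longrightarrow> U = {0} \<or> U = V)"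

definition is_direct_sum :: "'v::real_vector set \<Rightarrow> 'v set list \<Rightarrow> bool" where
  "is_direct_sum V Us \<longleftrightarrow> subspace V \<and> (\<forall>U\<in>set Us. subspace U \<and> U \<subseteq> V) \<and>
     (\<forall>v\<in>V. \<exists>!us. list_all2 (\<in>) us Us \<and> v = sum_list us)"


section \<open>The coordinate definitions agree with the invariant ones\<close>

lemma linear_form1: "linear form1"
  by (rule linearI) (simp_all add: form1_def scaleR_left_distrib sum.distrib scaleR_right.sum)

lemma form1_axis: "form1 (axis i 1) = axis {i} 1"
proof -
  have "form1 (axis i 1) = (\<Sum>j\<in>UNIV. if j = i then axis {i} 1 else 0)"
    unfolding form1_def by (rule sum.cong) (auto simp: axis_def)
  thus ?thesis by simp
qed

lemma form1_expand: "form1 X = (\<Sum>i\<in>UNIV. X $ i *\<^sub>R form1 (axis i 1))"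
  by (simp add: form1_def[of X] form1_axis)

lemma bilinear_wedge: "bilinear wedge"
  unfolding bilinear_def
  by (intro conjI allI linearI)
     (simp_all add: wedge_def vec_eq_iff algebra_simps sum.distrib sum_distrib_left)

lemma wedge_axis:
  "axis I 1 \<^bold>\<and> axis J 1 = (if I \<inter> J = {} then shuffle_sign I J *\<^sub>R axis (I \<union> J) 1 else 0)"
proof -
  have "(axis I 1 \<^bold>\<and> axis J 1) $ K =
      (\<Sum>I'\<in>Pow K. if I' = I then (if K - I = J then shuffle_sign I J else 0) else 0)" for K
    unfolding wedge_def vec_lambda_beta by (intro sum.cong refl) (auto simp: axis_def)
  hence *: "(axis I 1 \<^bold>\<and> axis J 1) $ K =
      (if I \<subseteq> K \<and> K - I = J then shuffle_sign I J else 0)" for K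
    by (simp add: sum.delta)
  have "I \<subseteq> K \<and> K - I = J \<longleftrightarrow> I \<inter> J = {} \<and> K = I \<union> J" for K
    by auto
  thus ?thesis unfolding vec_eq_iff * by (simp add: axis_def)
qed

lemma wedge_list_sorted:
  "wedge_list (map (\<lambda>i. form1 (axis i 1)) (sorted_list_of_set I)) = axis I 1"
proof -
  have "sorted is \<Longrightarrow> distinct is \<Longrightarrow>
      wedge_list (map (\<lambda>i. form1 (axis i 1)) is) = axis (set is) 1" for "is" :: "8 list"
  proof (induction "is")
    case (Cons i "is")
    have "{(a, b). a \<in> {i} \<and> b \<in> set is \<and> b < a} = {}"
      using Cons.prems by auto
    hence "shuffle_sign {i} (set is) = 1" by (simp only: shuffle_sign_def) simp
    thus ?case using Cons by (simp add: wedge_list_def form1_axis wedge_axis)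
  qed (simp add: wedge_list_def)
  from this[of "sorted_list_of_set I"] show ?thesis by simp
qed

lemma of_nat_8_less: "m < n \<Longrightarrow> n < 8 \<Longrightarrow> (of_nat m :: 8) < of_nat n"
  by (simp add: less_bit0_def bit0.of_nat_eq bit0.Rep_Abs_mod Abs_bit0_inverse)

lemma contr_1: "contr 1 \<alpha> \<beta> = (\<Sum>j\<in>UNIV. int_e j \<alpha> \<^bold>\<and> int_e j \<beta>)"
proof -
  have "{I :: 8 set. card I = 1} = (\<lambda>j. {j}) ` UNIV"
    by (auto simp: card_1_singleton_iff)
  thus ?thesis
    unfolding contr_def sigma_def by (simp only:) (simp add: sum.reindex)
qed

lemma int_e_eq_contr: "contr 1 (form1 (axis i 1)) \<alpha> = int_e i \<alpha>"
proof -
  have a: "int_e j (axis {i} 1) = (if j = i then axis {} 1 else 0)" for j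
    by (auto simp: int_e_def vec_eq_iff axis_def shuffle_sign_def)
  have b: "axis {} 1 \<^bold>\<and> \<beta> = \<beta>" for \<beta>
  proof -
    have "(axis {} 1 \<^bold>\<and> \<beta>) $ K = (\<Sum>I\<in>Pow K. if I = {} then \<beta> $ K else 0)" for K
      unfolding wedge_def vec_lambda_beta by (intro sum.cong refl) (auto simp: axis_def shuffle_sign_def)
    thus ?thesis by (simp add: vec_eq_iff)
  qed
  have "contr 1 (form1 (axis i 1)) \<alpha> = (\<Sum>j\<in>UNIV. int_e j (axis {i} 1) \<^bold>\<and> int_e j \<alpha>)"
    by (simp only: contr_1 form1_axis)
  also have "\<dots> = (\<Sum>j\<in>UNIV. if j = i then int_e i \<alpha> else 0)"
    using bilinear_lzero[OF bilinear_wedge] by (intro sum.cong) (auto simp: a b)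
  finally show ?thesis by simp
qed

lemma wedge_hodge:
  assumes "\<alpha> \<in> Lam k" "\<beta> \<in> Lam k"
  shows "\<alpha> \<^bold>\<and> hodge \<beta> = (\<alpha> \<bullet> \<beta>) *\<^sub>R axis UNIV 1"
proof -
  have sq: "shuffle_sign I J * shuffle_sign I J = 1" for I J
    by (simp add: shuffle_sign_def flip: power_add)
  have "(\<alpha> \<^bold>\<and> hodge \<beta>) $ K = (if K = UNIV then \<alpha> \<bullet> \<beta> else 0)" for K
  proof (cases "K = UNIV")
    case True
    thus ?thesis
      by (auto simp: wedge_def hodge_def inner_vec_def Compl_eq_Diff_UNIV[symmetric]
          double_complement sq mult.assoc mult.left_commute intro!: sum.cong)
  next
    case False
    have "\<alpha> $ I = 0 \<or> \<beta> $ (- (K - I)) = 0" if "I \<subseteq> K" for I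
    proof -
      have "I \<subset> - (K - I)" using that False by auto
      hence "card I < card (- (K - I))" by (intro psubset_card_mono) auto
      hence "card I \<noteq> k \<or> card (- (K - I)) \<noteq> k" by linarith
      thus ?thesis using assms unfolding Lam_def by blast
    qed
    hence "shuffle_sign I (K - I) * \<alpha> $ I * hodge \<beta> $ (K - I) = 0" if "I \<in> Pow K" for I
      unfolding hodge_def vec_lambda_beta mult_eq_0_iff using that by blast
    thus ?thesis using False by (simp add: wedge_def sum.neutral)
  qed
  thus ?thesis by (auto simp: vec_eq_iff axis_def)
qed

lemma orth_proj:
  fixes S :: "'a::euclidean_space set"
  assumes "subspace S"
  shows "orth_proj S x \<in> S" "z \<in> S \<Longrightarrow> orthogonal (x - orth_proj S x) z"
proof -
  obtain y w where y: "y \<in> span S" and w: "\<And>z. z \<in> span S \<Longrightarrow> orthogonal w z" and x: "x = y + w"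
    using orthogonal_subspace_decomp_exists[of S x] by metis
  have "\<exists>!y. y \<in> S \<and> (\<forall>z\<in>S. orthogonal (x - y) z)"
  proof (rule ex1I[of _ y])
    show "y \<in> S \<and> (\<forall>z\<in>S. orthogonal (x - y) z)"
      using y w x assms by (simp add: span_eq_iff[THEN iffD2])
    fix y' assume *: "y' \<in> S \<and> (\<forall>z\<in>S. orthogonal (x - y') z)"
    have S: "y \<in> S" using y assms by (simp add: span_eq_iff[THEN iffD2])
    hence "y' - y \<in> S" using * assms by (simp add: subspace_diff)
    hence "orthogonal (x - y') (y' - y)" "orthogonal (x - y) (y' - y)"
      using * w x assms by (auto simp: span_eq_iff[THEN iffD2])
    hence "(y' - y) \<bullet> (y' - y) = 0" by (simp add: orthogonal_def inner_diff_left)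
    thus "y' = y" by simp
  qed
  from theI'[OF this]
  show "orth_proj S x \<in> S" "z \<in> S \<Longrightarrow> orthogonal (x - orth_proj S x) z"
    unfolding orth_proj_def by auto
qed

lemma subspace_Lam2_20: "subspace Lam2_20"
  using bilinear_ladd[OF bilinear_wedge] bilinear_lmul[OF bilinear_wedge]
    bilinear_lzero[OF bilinear_wedge]
  by (auto simp: subspace_def Lam2_20_def Lam_def)

lemma tens_expand: "t = (\<Sum>i\<in>UNIV. axis i 1 \<otimes>\<^sub>t t $ i)"
proof -
  have "(\<Sum>i\<in>UNIV. axis i 1 \<otimes>\<^sub>t t $ i) $ j = (\<Sum>i\<in>UNIV. if i = j then t $ j else 0)" for j
    unfolding sum_component tensor_def vec_lambda_beta
    by (intro sum.cong refl) (auto simp: axis_def)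
  thus ?thesis by (simp add: vec_eq_iff)
qed

lemma R8_m_eq: "R8_m = {t. \<forall>i. t $ i \<in> \<mm>}"
proof
  have "subspace {t :: tens. \<forall>i. t $ i \<in> \<mm>}"
    using subspace_Lam2_20 by (auto simp: subspace_def)
  thus "R8_m \<subseteq> {t. \<forall>i. t $ i \<in> \<mm>}"
    unfolding R8_m_def using subspace_Lam2_20
    by (intro span_minimal) (auto simp: tensor_def subspace_scale)
  show "{t. \<forall>i. t $ i \<in> \<mm>} \<subseteq> R8_m"
  proof
    fix t :: tens assume "t \<in> {t. \<forall>i. t $ i \<in> \<mm>}"
    hence "(\<Sum>i\<in>UNIV. axis i 1 \<otimes>\<^sub>t t $ i) \<in> R8_m"
      unfolding R8_m_def by (intro span_sum span_base) auto
    thus "t \<in> R8_m" by (simp flip: tens_expand)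
  qed
qed

lemma linear_Phi1: "linear Phi1" and linear_Phi2: "linear Phi2"
  by (rule linearI; simp add: Phi1_def Phi2_def bilinear_radd[OF bilinear_wedge]
      bilinear_rmul[OF bilinear_wedge] sum.distrib scaleR_right.sum)+

lemma linear_act_form: "linear (act_form A)"
  by (rule linearI) (simp_all add: act_form_def scaleR_left_distrib sum.distrib scaleR_right.sum)

lemma linear_act_tens: "linear (act_tens A)"
proof -
  have "X \<otimes>\<^sub>t (\<alpha> + \<beta>) = X \<otimes>\<^sub>t \<alpha> + X \<otimes>\<^sub>t \<beta>" "X \<otimes>\<^sub>t (c *\<^sub>R \<alpha>) = c *\<^sub>R (X \<otimes>\<^sub>t \<alpha>)" for X \<alpha> \<beta> c
    by (simp_all add: tensor_def vec_eq_iff algebra_simps)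
  thus ?thesis
    by (intro linearI) (simp_all add: act_tens_def linear_add[OF linear_act_form]
        linear_scale[OF linear_act_form] sum.distrib scaleR_right.sum)
qed

lemma Phi1_tensor: "Phi1 (X \<otimes>\<^sub>t \<omega>) = form1 X \<^bold>\<and> \<omega>"
  by (subst form1_expand) (simp add: Phi1_def tensor_def bilinear_rmul[OF bilinear_wedge]
      bilinear_lmul[OF bilinear_wedge] linear_sum[OF bilinear_wedge[unfolded bilinear_def,
        THEN conjunct2, rule_format, of \<omega>]])

lemma Phi2_tensor: "Phi2 (X \<otimes>\<^sub>t \<omega>) = contr 1 (form1 X) rho \<^bold>\<and> \<omega>"
proof -
  have int_e: "linear (int_e i)" for i
    by (rule linearI) (auto simp: int_e_def vec_eq_iff algebra_simps)
  have lin: "linear (\<lambda>\<alpha>. contr 1 \<alpha> rho)"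
    unfolding contr_1
    by (rule linearI) (simp_all add: linear_add[OF int_e] linear_scale[OF int_e]
        bilinear_ladd[OF bilinear_wedge] bilinear_lmul[OF bilinear_wedge]
        sum.distrib scaleR_right.sum)
  have w: "linear (\<lambda>\<alpha>. \<alpha> \<^bold>\<and> \<omega>)"
    using bilinear_wedge by (simp add: bilinear_def)
  have "contr 1 (form1 X) rho = (\<Sum>i\<in>UNIV. X $ i *\<^sub>R contr 1 (form1 (axis i 1)) rho)"
    by (subst form1_expand) (simp only: linear_sum[OF lin] linear_scale[OF lin])
  thus ?thesis
    by (simp only: linear_sum[OF w] linear_scale[OF w] Phi2_def tensor_def vec_lambda_beta
        bilinear_rmul[OF bilinear_wedge])
qed

lemma act_tens_tensor: "act_tens A (X \<otimes>\<^sub>t \<omega>) = (A *v X) \<otimes>\<^sub>t act_form A \<omega>"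
proof -
  have "A *v X = (\<Sum>i\<in>UNIV. X $ i *\<^sub>R (A *v axis i 1))"
    unfolding matrix_vector_mult_basis by (simp add: matrix_mult_sum scalar_mult_eq_scaleR)
  thus ?thesis
    by (simp add: act_tens_def tensor_def vec_eq_iff linear_scale[OF linear_act_form]
        scaleR_left.sum sum_distrib_right mult_ac)
qed

end

theory Submission
  imports Defs
begin

text \<open>
  The maps \<open>\<Theta>\<^sub>1\<close>, \<open>\<Theta>\<^sub>2\<close> are, up to constants, the adjoints of \<open>\<Phi>\<^sub>1\<close>, \<open>\<Phi>\<^sub>2\<close>, so \<open>\<W>\<^sub>6\<close> is
  the orthogonal complement of the sum of their images.  The spaces \<open>\<W>\<^sub>1, \<dots>, \<W>\<^sub>5\<close> are equivariant
  images of \<open>\<Lambda>\<^sup>1\<close>, \<open>\<mm>\<close> and \<open>\<Lambda>\<^sup>3\<^sub>2\<^sub>7\<close>, of dimensions 8, 20 and 27.  Irreducible modules of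
  different dimensions are orthogonal, so it remains to see that \<open>\<W>\<^sub>1 \<noteq> \<W>\<^sub>4\<close> and
  \<open>\<W>\<^sub>3 \<noteq> \<W>\<^sub>5\<close>, to prove the irreducibility of \<open>\<Lambda>\<^sup>1\<close>, \<open>\<mm>\<close>, \<open>\<Lambda>\<^sup>3\<^sub>2\<^sub>7\<close> and \<open>\<W>\<^sub>6\<close>, and to count
  dimensions.  An invariant subspace is invariant under the Lie algebra, since the one-parameter
  groups generated by the forms \<open>e\<^sub>i \<lrcorner> \<rho>\<close> lie in the isotropy group; irreducibility then follows
  as in highest weight theory, by generating each module from the plane of its highest weight.
\<close>

section \<open>Exterior algebra\<close>

text \<open>Complexified, the modules are those of su(3) with highest weights (1,1), (3,0)+(0,3),
  (2,2) and (4,1)+(1,4), of dimensions 8, 20, 27 and 70, and 160 = 2*8 + 20 + 2*27 + 70. Dimensions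
  8 and 27 occur twice, so orthogonality for dimension reasons cannot separate those pairs. Working
  over the reals is possible because the Cartan element H takes the values 3, 1, 2 up to sign on the
  three root planes: on each module the largest absolute value of a weight (3, 5, 6, 8) is then
  attained on a single real plane, an eigenspace of H^2. Explicit tables of weight vectors bound the
  dimensions from below; orthogonal complements bound them from above, starting from the binomial
  coefficients 8 over k and from 8*20. The root of three in \<open>rho\<close> would spoil exact
  evaluation, so e_8 is rescaled; the bracket, \<open>rho\<close> and all table entries become
  integral and the remaining checks are evaluations on integer lists.\<close>

lemma shuffle_sign_Un:
  assumes "I \<inter> I' = {}"
  shows "shuffle_sign (I \<union> I') J = shuffle_sign I J * shuffle_sign I' J"
    and "shuffle_sign J (I \<union> I') = shuffle_sign J I * shuffle_sign J I'"
proof -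
  have "{(i, j). i \<in> I \<union> I' \<and> j \<in> J \<and> j < i} =
      {(i, j). i \<in> I \<and> j \<in> J \<and> j < i} \<union> {(i, j). i \<in> I' \<and> j \<in> J \<and> j < i}"
    by auto
  moreover have "card \<dots> = card {(i, j). i \<in> I \<and> j \<in> J \<and> j < i} + card {(i, j). i \<in> I' \<and> j \<in> J \<and> j < i}"
    using assms by (intro card_Un_disjoint) auto
  ultimately show "shuffle_sign (I \<union> I') J = shuffle_sign I J * shuffle_sign I' J"
    by (simp add: shuffle_sign_def power_add)
  have "{(j, i). j \<in> J \<and> i \<in> I \<union> I' \<and> i < j} =
      {(j, i). j \<in> J \<and> i \<in> I \<and> i < j} \<union> {(j, i). j \<in> J \<and> i \<in> I' \<and> i < j}"
    by auto
  moreover have "card \<dots> = card {(j, i). j \<in> J \<and> i \<in> I \<and> i < j} + card {(j, i). j \<in> J \<and> i \<in> I' \<and> i < j}"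
    using assms by (intro card_Un_disjoint) auto
  ultimately show "shuffle_sign J (I \<union> I') = shuffle_sign J I * shuffle_sign J I'"
    by (simp add: shuffle_sign_def power_add)
qed

lemma shuffle_sign_square: "shuffle_sign I J * shuffle_sign I J = 1"
  by (simp add: shuffle_sign_def flip: power_add)

lemma shuffle_sign_empty [simp]: "shuffle_sign {} J = 1" "shuffle_sign J {} = 1"
  by (simp_all add: shuffle_sign_def)

lemma shuffle_sign_singletons: "shuffle_sign {i} {j} = (if j < i then -1 else 1)"
proof -
  have "{(a, b). a \<in> {i} \<and> b \<in> {j} \<and> b < a} = (if j < i then {(i, j)} else {})"
    by auto
  thus ?thesis unfolding shuffle_sign_def by simp
qed

lemma form_expand: "(\<alpha> :: form) = (\<Sum>I\<in>UNIV. \<alpha> $ I *\<^sub>R axis I 1)"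
  by (simp add: vec_eq_iff axis_def if_distrib cong: if_cong)

lemma inner_axis_one: "axis I (1::real) \<bullet> axis J 1 = (if I = J then 1 else 0)"
  by (simp add: inner_axis_axis)

lemma linear_eq_axis:
  assumes "linear f" "linear g" "\<And>I. f (axis I 1) = g (axis I 1)"
  shows "f (\<alpha> :: real^'n) = g \<alpha>"
proof (rule linear_eq_on_span[OF assms(1,2), of "range (\<lambda>i. axis i 1)"])
  have "\<alpha> = (\<Sum>i\<in>UNIV. \<alpha> $ i *\<^sub>R axis i 1)"
    by (simp add: vec_eq_iff axis_def if_distrib cong: if_cong)
  thus "\<alpha> \<in> span (range (\<lambda>i. axis i 1))"
    by (rule ssubst) (intro span_sum span_scale span_base rangeI)
qed (use assms(3) in auto)

lemmas form1_lin = linear_add[OF linear_form1] linear_scale[OF linear_form1]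
lemmas act_form_lin = linear_add[OF linear_act_form] linear_scale[OF linear_act_form]
lemmas act_tens_lin = linear_add[OF linear_act_tens] linear_scale[OF linear_act_tens]

lemmas wedge_add_left = bilinear_ladd[OF bilinear_wedge]
lemmas wedge_add_right = bilinear_radd[OF bilinear_wedge]
lemmas wedge_scale_left = bilinear_lmul[OF bilinear_wedge]
lemmas wedge_scale_right = bilinear_rmul[OF bilinear_wedge]
lemmas wedge_lin = wedge_add_left wedge_add_right wedge_scale_left wedge_scale_right
lemmas wedge_zero_left [simp] = bilinear_lzero[OF bilinear_wedge]
lemmas wedge_zero_right [simp] = bilinear_rzero[OF bilinear_wedge]
lemmas wedge_diff_left = bilinear_lsub[OF bilinear_wedge]
lemmas wedge_diff_right = bilinear_rsub[OF bilinear_wedge]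
lemmas wedge_minus_left = bilinear_lneg[OF bilinear_wedge]
lemmas wedge_minus_right = bilinear_rneg[OF bilinear_wedge]

lemma linear_wedge_left: "linear (\<lambda>\<alpha>. \<alpha> \<^bold>\<and> \<beta>)" and linear_wedge_right: "linear (\<lambda>\<beta>. \<alpha> \<^bold>\<and> \<beta>)"
  using bilinear_wedge by (simp_all add: bilinear_def)

lemmas wedge_sum_left = linear_sum[OF linear_wedge_left]
lemmas wedge_sum_right = linear_sum[OF linear_wedge_right]

lemma wedge_assoc_axis:
  "(axis I 1 \<^bold>\<and> axis J 1) \<^bold>\<and> axis K 1 = axis I 1 \<^bold>\<and> axis J 1 \<^bold>\<and> axis K 1"
proof (cases "I \<inter> J = {} \<and> I \<inter> K = {} \<and> J \<inter> K = {}")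
  case True
  hence "(I \<union> J) \<inter> K = {}" "I \<inter> (J \<union> K) = {}" by auto
  thus ?thesis using True
    by (simp add: wedge_axis wedge_scale_left wedge_scale_right shuffle_sign_Un Un_assoc mult_ac)
next
  case False
  hence "I \<inter> J \<noteq> {} \<or> (I \<union> J) \<inter> K \<noteq> {}" "J \<inter> K \<noteq> {} \<or> I \<inter> (J \<union> K) \<noteq> {}" by auto
  thus ?thesis by (auto simp: wedge_axis wedge_scale_left wedge_scale_right)
qed

text \<open>By trilinearity, basis forms are replaced by arbitrary ones, one slot at a time from the
  right. The same climb proves most multilinear identities below.\<close>

lemma wedge_assoc: "(\<alpha> \<^bold>\<and> \<beta>) \<^bold>\<and> \<gamma> = \<alpha> \<^bold>\<and> \<beta> \<^bold>\<and> \<gamma>"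
proof -
  have 1: "(axis I 1 \<^bold>\<and> axis J 1) \<^bold>\<and> \<gamma> = axis I 1 \<^bold>\<and> axis J 1 \<^bold>\<and> \<gamma>" for I J
    by (rule linear_eq_axis[of "\<lambda>\<gamma>. (axis I 1 \<^bold>\<and> axis J 1) \<^bold>\<and> \<gamma>" "\<lambda>\<gamma>. axis I 1 \<^bold>\<and> axis J 1 \<^bold>\<and> \<gamma>"])
       (auto intro!: linearI simp: wedge_lin wedge_assoc_axis)
  have 2: "(axis I 1 \<^bold>\<and> \<beta>) \<^bold>\<and> \<gamma> = axis I 1 \<^bold>\<and> \<beta> \<^bold>\<and> \<gamma>" for I
    by (rule linear_eq_axis[of "\<lambda>\<beta>. (axis I 1 \<^bold>\<and> \<beta>) \<^bold>\<and> \<gamma>" "\<lambda>\<beta>. axis I 1 \<^bold>\<and> \<beta> \<^bold>\<and> \<gamma>"])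
       (auto intro!: linearI simp: wedge_lin 1)
  show ?thesis
    by (rule linear_eq_axis[of "\<lambda>\<alpha>. (\<alpha> \<^bold>\<and> \<beta>) \<^bold>\<and> \<gamma>" "\<lambda>\<alpha>. \<alpha> \<^bold>\<and> \<beta> \<^bold>\<and> \<gamma>"])
       (auto intro!: linearI simp: wedge_lin 2)
qed

lemma wedge_one_left [simp]: "axis {} 1 \<^bold>\<and> \<alpha> = \<alpha>"
  by (rule linear_eq_axis[OF linear_wedge_right linear_ident]) (simp add: wedge_axis)

lemma wedge_one_right [simp]: "\<alpha> \<^bold>\<and> axis {} 1 = \<alpha>"
  by (rule linear_eq_axis[OF linear_wedge_left linear_ident]) (simp add: wedge_axis)

lemma form1_wedge_form1: "form1 v \<^bold>\<and> form1 w = - (form1 w \<^bold>\<and> form1 v)"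
proof -
  have *: "axis {i} 1 \<^bold>\<and> axis {j} 1 = - (axis {j} 1 \<^bold>\<and> axis {i} 1)" for i j :: 8
    by (cases i j rule: linorder_cases) (auto simp: wedge_axis shuffle_sign_singletons insert_commute)
  have 2: "axis {i} 1 \<^bold>\<and> form1 w = - (form1 w \<^bold>\<and> axis {i} 1)" for i
    by (rule linear_eq_axis[of "\<lambda>w. axis {i} 1 \<^bold>\<and> form1 w" "\<lambda>w. - (form1 w \<^bold>\<and> axis {i} 1)"])
       (auto simp: form1_axis *[of i] form1_lin
         wedge_lin intro!: linearI)
  show ?thesis
    by (rule linear_eq_axis[of "\<lambda>v. form1 v \<^bold>\<and> form1 w" "\<lambda>v. - (form1 w \<^bold>\<and> form1 v)"])
       (auto simp: form1_axis 2 form1_lin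
         wedge_lin intro!: linearI)
qed

lemma form1_swap: "form1 v \<^bold>\<and> form1 w \<^bold>\<and> \<alpha> = - (form1 w \<^bold>\<and> form1 v \<^bold>\<and> \<alpha>)"
  by (metis form1_wedge_form1 wedge_assoc wedge_minus_left)

lemma form1_twice [simp]: "form1 v \<^bold>\<and> form1 v \<^bold>\<and> \<alpha> = 0"
proof -
  have "form1 v \<^bold>\<and> form1 v \<^bold>\<and> \<alpha> = - (form1 v \<^bold>\<and> form1 v \<^bold>\<and> \<alpha>)" by (rule form1_swap)
  thus ?thesis unfolding vec_eq_iff by simp
qed

text \<open>Products of basis one-forms span everything, so a linear property only has to survive a
  one-form factor on the left. This replaces coefficient computations wherever a matrix
  acts.\<close>

lemma form_induct:
  assumes "subspace {\<alpha>. P \<alpha>}" and one: "P (axis {} 1)"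
    and step: "\<And>v \<alpha>. P \<alpha> \<Longrightarrow> P (form1 v \<^bold>\<and> \<alpha>)"
  shows "P \<alpha>"
proof -
  have "P (wedge_list (map (\<lambda>i. form1 (axis i 1)) is))" for "is"
    by (induction "is") (auto simp: wedge_list_def one step)
  hence "P (axis I 1)" for I
    by (metis wedge_list_sorted)
  hence "(\<Sum>I\<in>UNIV. \<alpha> $ I *\<^sub>R axis I 1) \<in> {\<alpha>. P \<alpha>}"
    using assms(1) by (intro subspace_sum subspace_scale) auto
  thus ?thesis by (simp flip: form_expand)
qed

lemma linear_eq_form1_wedge:
  assumes "linear f" "linear g" "f (axis {} 1) = g (axis {} 1)"
    "\<And>v \<alpha>. f \<alpha> = g \<alpha> \<Longrightarrow> f (form1 v \<^bold>\<and> \<alpha>) = g (form1 v \<^bold>\<and> \<alpha>)"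
  shows "f \<alpha> = g \<alpha>"
proof (rule form_induct[where P = "\<lambda>\<alpha>. f \<alpha> = g \<alpha>"])
  show "subspace {\<alpha>. f \<alpha> = g \<alpha>}"
    by (auto simp: subspace_def linear_0 linear_add linear_scale assms(1,2))
qed (use assms in auto)

section \<open>Contraction with arbitrary vectors\<close>

text \<open>A matrix moves a basis vector to a general one, so equivariance statements need
  contraction by all vectors.\<close>

definition int_v :: "real^8 \<Rightarrow> form \<Rightarrow> form" where
  "int_v X \<alpha> = (\<Sum>i\<in>UNIV. X $ i *\<^sub>R int_e i \<alpha>)"

lemma linear_int_e: "linear (int_e i)"
  by (rule linearI) (auto simp: int_e_def vec_eq_iff algebra_simps)

lemmas int_e_lin = linear_add[OF linear_int_e] linear_scale[OF linear_int_e]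

lemma linear_int_v: "linear (int_v X)"
  by (rule linearI) (simp_all add: int_v_def int_e_lin
      sum.distrib scaleR_right_distrib scaleR_right.sum mult.commute)

lemmas int_v_lin = linear_add[OF linear_int_v] linear_scale[OF linear_int_v]

lemma linear_int_v_left: "linear (\<lambda>X. int_v X \<alpha>)"
  by (rule linearI) (simp_all add: int_v_def scaleR_left_distrib sum.distrib scaleR_right.sum)

lemmas int_v_left_lin = linear_add[OF linear_int_v_left] linear_scale[OF linear_int_v_left]

lemma int_v_axis [simp]: "int_v (axis i 1) \<alpha> = int_e i \<alpha>"
proof -
  have "int_v (axis i 1) \<alpha> = (\<Sum>j\<in>UNIV. if j = i then int_e i \<alpha> else 0)"
    unfolding int_v_def by (rule sum.cong) (auto simp: axis_def)
  thus ?thesis by simp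
qed

lemma int_e_axis:
  "int_e i (axis J 1) = (if i \<in> J then shuffle_sign {i} (J - {i}) *\<^sub>R axis (J - {i}) 1 else 0)"
  unfolding int_e_def vec_eq_iff by (auto simp: axis_def insert_absorb)

lemma form1_wedge_axis:
  "form1 (axis i 1) \<^bold>\<and> axis J 1 = (if i \<in> J then 0 else shuffle_sign {i} J *\<^sub>R axis (insert i J) 1)"
  by (simp add: form1_axis wedge_axis)

lemma int_e_wedge_axis:
  "int_e i (form1 (axis j 1) \<^bold>\<and> axis J 1) =
    (if i = j then axis J 1 else 0) - form1 (axis j 1) \<^bold>\<and> int_e i (axis J 1)"
proof (cases "i = j")
  case True
  thus ?thesis
    by (auto simp: form1_wedge_axis int_e_axis linear_0[OF linear_int_e] linear_scale[OF linear_int_e]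
        wedge_scale_right shuffle_sign_square insert_absorb)
next
  case ij: False
  show ?thesis
  proof (cases "i \<in> J \<and> j \<notin> J")
    case True
    have 1: "shuffle_sign {j} J = shuffle_sign {j} {i} * shuffle_sign {j} (J - {i})"
      using shuffle_sign_Un(2)[of "{i}" "J - {i}" "{j}"] True by (simp add: insert_absorb)
    have 2: "shuffle_sign {i} (insert j J - {i}) = shuffle_sign {i} {j} * shuffle_sign {i} (J - {i})"
      using shuffle_sign_Un(2)[of "{j}" "J - {i}" "{i}"] True ij by (simp add: insert_Diff_if)
    \<comment> \<open>Exactly one of the two orders of \<open>i\<close> and \<open>j\<close> is an
      inversion; this is the minus sign of the antiderivation rule.\<close>
    have 3: "shuffle_sign {j} {i} * shuffle_sign {i} {j} = -1"
      using ij by (auto simp: shuffle_sign_singletons)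
    have "shuffle_sign {j} J * shuffle_sign {i} (insert j J - {i}) =
        (shuffle_sign {j} {i} * shuffle_sign {i} {j}) * (shuffle_sign {i} (J - {i}) * shuffle_sign {j} (J - {i}))"
      unfolding 1 2 by (simp only: mult_ac)
    hence "shuffle_sign {j} J * shuffle_sign {i} (insert j J - {i}) =
        - (shuffle_sign {i} (J - {i}) * shuffle_sign {j} (J - {i}))"
      unfolding 3 by simp
    thus ?thesis using True ij
      by (simp add: form1_wedge_axis int_e_axis linear_scale[OF linear_int_e] wedge_scale_right)
         (simp add: insert_Diff_if)
  next
    case False
    thus ?thesis using ij
      by (auto simp: form1_wedge_axis int_e_axis linear_0[OF linear_int_e] linear_scale[OF linear_int_e]
        wedge_scale_right)
  qed
qed

text \<open>The antiderivation rule. Together with \<open>int_v_one\<close> it determines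
  contraction on all products of one-forms, which is how \<open>act_form_int_v\<close> is
  proved.\<close>

lemma int_v_wedge: "int_v X (form1 v \<^bold>\<and> \<alpha>) = (X \<bullet> v) *\<^sub>R \<alpha> - form1 v \<^bold>\<and> int_v X \<alpha>"
proof -
  have 1: "int_e i (form1 (axis j 1) \<^bold>\<and> \<alpha>) = (axis i (1::real) \<bullet> axis j 1) *\<^sub>R \<alpha> - form1 (axis j 1) \<^bold>\<and> int_e i \<alpha>" for i j
    by (rule linear_eq_axis[of "\<lambda>\<alpha>. int_e i (form1 (axis j 1) \<^bold>\<and> \<alpha>)"
          "\<lambda>\<alpha>. (axis i (1::real) \<bullet> axis j 1) *\<^sub>R \<alpha> - form1 (axis j 1) \<^bold>\<and> int_e i \<alpha>"])
       (auto simp: int_e_wedge_axis inner_axis_one intro!: linearI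
         simp: wedge_add_right wedge_scale_right int_e_lin algebra_simps)
  have 2: "int_e i (form1 v \<^bold>\<and> \<alpha>) = (axis i 1 \<bullet> v) *\<^sub>R \<alpha> - form1 v \<^bold>\<and> int_e i \<alpha>" for i
    by (rule linear_eq_axis[of "\<lambda>v. int_e i (form1 v \<^bold>\<and> \<alpha>)"
          "\<lambda>v. (axis i 1 \<bullet> v) *\<^sub>R \<alpha> - form1 v \<^bold>\<and> int_e i \<alpha>"])
       (auto simp: 1 intro!: linearI
         simp: wedge_add_left wedge_scale_left int_e_lin
          form1_lin inner_add_right algebra_simps)
  show ?thesis
    by (rule linear_eq_axis[of "\<lambda>X. int_v X (form1 v \<^bold>\<and> \<alpha>)"
          "\<lambda>X. (X \<bullet> v) *\<^sub>R \<alpha> - form1 v \<^bold>\<and> int_v X \<alpha>"])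
       (auto simp: 2 linear_int_v_left intro!: linearI
         simp: int_v_left_lin
         wedge_add_right wedge_scale_right algebra_simps)
qed

lemma int_v_one [simp]: "int_v X (axis {} 1) = 0"
  by (simp add: int_v_def int_e_axis)

lemma contr_1_form1: "contr 1 (form1 X) \<alpha> = int_v X \<alpha>"
proof -
  have "int_e j (form1 X) = X $ j *\<^sub>R axis {} 1" for j
    using int_v_wedge[of "axis j 1" X "axis {} 1"] by (simp add: inner_axis')
  thus ?thesis unfolding contr_1 int_v_def by (simp add: wedge_scale_left)
qed

text \<open>This adjointness is inherited by the pairs \<open>Theta1\<close>, \<open>Phi1\<close>
  and \<open>Theta2\<close>, \<open>Phi2\<close>.\<close>

lemma int_v_adjoint: "int_v X \<alpha> \<bullet> \<beta> = \<alpha> \<bullet> (form1 X \<^bold>\<and> \<beta>)"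
proof -
  have 1: "int_e i (axis I 1) \<bullet> axis J 1 = axis I 1 \<bullet> (form1 (axis i 1) \<^bold>\<and> axis J 1)" for i I J
    by (auto simp: int_e_axis form1_wedge_axis inner_axis_one)
  have 2: "int_e i (axis I 1) \<bullet> \<beta> = axis I 1 \<bullet> (form1 (axis i 1) \<^bold>\<and> \<beta>)" for i I
    by (rule linear_eq_axis[of "\<lambda>\<beta>. int_e i (axis I 1) \<bullet> \<beta>" "\<lambda>\<beta>. axis I 1 \<bullet> (form1 (axis i 1) \<^bold>\<and> \<beta>)"])
       (auto simp: 1 wedge_add_right wedge_scale_right inner_add_right intro!: linearI)
  have 3: "int_e i \<alpha> \<bullet> \<beta> = \<alpha> \<bullet> (form1 (axis i 1) \<^bold>\<and> \<beta>)" for i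
    by (rule linear_eq_axis[of "\<lambda>\<alpha>. int_e i \<alpha> \<bullet> \<beta>" "\<lambda>\<alpha>. \<alpha> \<bullet> (form1 (axis i 1) \<^bold>\<and> \<beta>)"])
       (auto simp: 2 int_e_lin inner_add_left intro!: linearI)
  show ?thesis
    by (rule linear_eq_axis[of "\<lambda>X. int_v X \<alpha> \<bullet> \<beta>" "\<lambda>X. \<alpha> \<bullet> (form1 X \<^bold>\<and> \<beta>)"])
       (auto simp: 3 int_v_left_lin inner_add_left
         inner_add_right form1_lin wedge_add_left wedge_scale_left
         intro!: linearI)
qed

section \<open>The action of matrices on forms\<close>

lemma wedge_list_Nil [simp]: "wedge_list [] = axis {} 1"
  and wedge_list_Cons [simp]: "wedge_list (\<alpha> # \<alpha>s) = \<alpha> \<^bold>\<and> wedge_list \<alpha>s"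
  by (simp_all add: wedge_list_def)

lemma subspace_Lam: "subspace (Lam k)"
  by (auto simp: subspace_def Lam_def)

lemma axis_Lam: "axis I c \<in> Lam (card I)"
  by (auto simp: Lam_def axis_def)

lemma wedge_Lam:
  assumes "\<alpha> \<in> Lam j" "\<beta> \<in> Lam k"
  shows "\<alpha> \<^bold>\<and> \<beta> \<in> Lam (j + k)"
proof -
  have "shuffle_sign I (K - I) * \<alpha> $ I * \<beta> $ (K - I) = 0" if "card K \<noteq> j + k" "I \<in> Pow K" for I K
  proof -
    have "card K = card I + card (K - I)"
      using that(2) by (simp add: card_Diff_subset card_mono)
    hence "card I \<noteq> j \<or> card (K - I) \<noteq> k" using that(1) by auto
    thus ?thesis using assms by (auto simp: Lam_def)
  qed
  thus ?thesis by (simp add: Lam_def wedge_def sum.neutral)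
qed

lemma form1_Lam: "form1 v \<in> Lam 1"
  unfolding form1_def
  by (intro subspace_sum[OF subspace_Lam] subspace_scale[OF subspace_Lam])
     (use axis_Lam[of "{_}"] in simp)

lemma wedge_list_Lam: "(\<And>\<alpha>. \<alpha> \<in> set \<alpha>s \<Longrightarrow> \<alpha> \<in> Lam 1) \<Longrightarrow> wedge_list \<alpha>s \<in> Lam (length \<alpha>s)"
proof (induction \<alpha>s)
  case Nil
  thus ?case using axis_Lam[of "{}"] by simp
next
  case (Cons \<alpha> \<alpha>s)
  thus ?case using wedge_Lam[of \<alpha> 1 "wedge_list \<alpha>s" "length \<alpha>s"] by simp
qed

lemma act_form_axis:
  "act_form A (axis I 1) = wedge_list (map (\<lambda>i. form1 (A *v axis i 1)) (sorted_list_of_set I))"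
proof -
  have "act_form A (axis I 1) = (\<Sum>J\<in>UNIV. if J = I then
      wedge_list (map (\<lambda>i. form1 (A *v axis i 1)) (sorted_list_of_set I)) else 0)"
    unfolding act_form_def by (rule sum.cong) (auto simp: axis_def)
  thus ?thesis by simp
qed

lemma act_form_one [simp]: "act_form A (axis {} 1) = axis {} 1"
  by (simp add: act_form_axis)

text \<open>Insertion sort of one factor: every factor it passes costs a sign, and these are the
  inversions counted by \<open>shuffle_sign\<close>. The vectors \<open>w i\<close> are arbitrary
  because they will be the images of basis vectors under a matrix.\<close>

lemma form1_wedge_insort:
  fixes w :: "8 \<Rightarrow> real^8"
  assumes "sorted is" "distinct is"
  shows "form1 (w i) \<^bold>\<and> wedge_list (map (\<lambda>i. form1 (w i)) is) =
    (if i \<in> set is then 0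
     else shuffle_sign {i} (set is) *\<^sub>R wedge_list (map (\<lambda>i. form1 (w i)) (insort i is)))"
  using assms
proof (induction "is")
  case (Cons h "is")
  let ?w = "\<lambda>is. wedge_list (map (\<lambda>i. form1 (w i)) is)"
  consider "i = h" | "i < h" | "h < i" by fastforce
  thus ?case
  proof cases
    case 1
    thus ?thesis by simp
  next
    case 2
    have "i \<notin> set (h # is)" using 2 Cons.prems by auto
    moreover have "{(a, b). a \<in> {i} \<and> b \<in> set (h # is) \<and> b < a} = {}"
      using 2 Cons.prems by auto
    hence "shuffle_sign {i} (set (h # is)) = 1"
      by (simp only: shuffle_sign_def card.empty power_0)
    ultimately show ?thesis using 2 by (simp add: less_imp_le)
  next
    case 3
    have "shuffle_sign {i} ({h} \<union> set is) = shuffle_sign {i} {h} * shuffle_sign {i} (set is)"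
      using Cons.prems by (intro shuffle_sign_Un) auto
    hence s: "shuffle_sign {i} (insert h (set is)) = - shuffle_sign {i} (set is)"
      using 3 by (simp add: shuffle_sign_singletons)
    have "form1 (w i) \<^bold>\<and> ?w (h # is) = - (form1 (w h) \<^bold>\<and> form1 (w i) \<^bold>\<and> ?w is)"
      using form1_swap[of "w i" "w h" "?w is"] by simp
    also have "form1 (w i) \<^bold>\<and> ?w is = (if i \<in> set is then 0
        else shuffle_sign {i} (set is) *\<^sub>R ?w (insort i is))"
      using Cons by simp
    finally show ?thesis using 3 s by (auto simp: wedge_scale_right)
  qed
qed simp

lemma act_form_form1_wedge: "act_form A (form1 v \<^bold>\<and> \<alpha>) = form1 (A *v v) \<^bold>\<and> act_form A \<alpha>"
proof -
  have 1: "act_form A (form1 (axis i 1) \<^bold>\<and> axis J 1) = form1 (A *v axis i 1) \<^bold>\<and> act_form A (axis J 1)" for i J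
    using form1_wedge_insort[of "sorted_list_of_set J" "\<lambda>i. A *v axis i 1" i]
    by (simp add: form1_wedge_axis act_form_axis linear_0[OF linear_act_form] linear_scale[OF linear_act_form]
        sorted_list_of_set_insert)
  have 2: "act_form A (form1 (axis i 1) \<^bold>\<and> \<alpha>) = form1 (A *v axis i 1) \<^bold>\<and> act_form A \<alpha>" for i
    by (rule linear_eq_axis[of "\<lambda>\<alpha>. act_form A (form1 (axis i 1) \<^bold>\<and> \<alpha>)"
          "\<lambda>\<alpha>. form1 (A *v axis i 1) \<^bold>\<and> act_form A \<alpha>"])
       (auto simp: 1 wedge_lin act_form_lin intro!: linearI)
  show ?thesis
    by (rule linear_eq_axis[of "\<lambda>v. act_form A (form1 v \<^bold>\<and> \<alpha>)" "\<lambda>v. form1 (A *v v) \<^bold>\<and> act_form A \<alpha>"])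
       (auto simp: 2 wedge_lin act_form_lin
        form1_lin matrix_vector_right_distrib
        matrix_vector_mult_scaleR intro!: linearI)
qed

lemma act_form_wedge: "act_form A (\<alpha> \<^bold>\<and> \<beta>) = act_form A \<alpha> \<^bold>\<and> act_form A \<beta>"
  by (rule linear_eq_form1_wedge[of "\<lambda>\<alpha>. act_form A (\<alpha> \<^bold>\<and> \<beta>)" "\<lambda>\<alpha>. act_form A \<alpha> \<^bold>\<and> act_form A \<beta>"])
     (auto simp: wedge_lin act_form_lin
       wedge_assoc act_form_form1_wedge intro!: linearI)

lemma act_form_compose: "act_form A (act_form B \<alpha>) = act_form (A ** B) \<alpha>"
  by (rule linear_eq_form1_wedge[of "\<lambda>\<alpha>. act_form A (act_form B \<alpha>)" "\<lambda>\<alpha>. act_form (A ** B) \<alpha>"])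
     (auto simp: act_form_lin
       act_form_form1_wedge matrix_vector_mul_assoc intro!: linearI)

lemma act_form_id [simp]: "act_form (mat 1) \<alpha> = \<alpha>"
  by (rule linear_eq_form1_wedge[of "\<lambda>\<alpha>. act_form (mat 1) \<alpha>" "\<lambda>\<alpha>. \<alpha>"])
     (auto simp: act_form_lin
       act_form_form1_wedge intro!: linearI)

lemma act_form_Lam: "\<alpha> \<in> Lam k \<Longrightarrow> act_form A \<alpha> \<in> Lam k"
proof -
  assume \<alpha>: "\<alpha> \<in> Lam k"
  have "\<alpha> $ I *\<^sub>R wedge_list (map (\<lambda>i. form1 (A *v axis i 1)) (sorted_list_of_set I)) \<in> Lam k" for I
  proof (cases "card I = k")
    case True
    have "wedge_list (map (\<lambda>i. form1 (A *v axis i 1)) (sorted_list_of_set I)) \<in>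
        Lam (length (map (\<lambda>i. form1 (A *v axis i 1)) (sorted_list_of_set I)))"
      by (rule wedge_list_Lam) (use form1_Lam in auto)
    thus ?thesis using True by (simp add: subspace_scale[OF subspace_Lam])
  next
    case False
    thus ?thesis using \<alpha> subspace_0[OF subspace_Lam] by (auto simp: Lam_def)
  qed
  thus ?thesis unfolding act_form_def by (intro subspace_sum[OF subspace_Lam])
qed

lemma orthogonal_matrix_inner:
  fixes A :: "real^'n^'n"
  shows "orthogonal_matrix A \<Longrightarrow> (A *v x) \<bullet> (A *v y) = x \<bullet> y"
  using orthogonal_transformation_matrix[of "(*v) A"]
  by (simp add: orthogonal_transformation_def)

lemma act_form_int_v:
  assumes "orthogonal_matrix A"
  shows "int_v (A *v X) (act_form A \<alpha>) = act_form A (int_v X \<alpha>)"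
  by (rule linear_eq_form1_wedge[of "\<lambda>\<alpha>. int_v (A *v X) (act_form A \<alpha>)" "\<lambda>\<alpha>. act_form A (int_v X \<alpha>)"])
     (auto simp: act_form_lin
       linear_diff[OF linear_act_form] linear_0[OF linear_act_form] int_v_lin
       act_form_form1_wedge int_v_wedge orthogonal_matrix_inner[OF assms] intro!: linearI)

lemma form1_wedge_adjoint: "(form1 X \<^bold>\<and> \<alpha>) \<bullet> \<beta> = \<alpha> \<bullet> int_v X \<beta>"
  by (metis int_v_adjoint inner_commute)

lemma form1_wedge_empty [simp]: "(form1 v \<^bold>\<and> \<alpha>) $ {} = 0"
  by (simp add: wedge_def form1_def axis_def)

lemma act_form_inner:
  assumes "orthogonal_matrix A"
  shows "act_form A \<alpha> \<bullet> act_form A \<beta> = \<alpha> \<bullet> \<beta>"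
proof -
  have [simp]: "axis {} 1 \<bullet> \<gamma> = \<gamma> $ {}" for \<gamma> :: form
    by (simp add: inner_axis')
  have one: "(act_form A \<beta>) $ {} = \<beta> $ {}" for \<beta>
    by (rule linear_eq_form1_wedge[of "\<lambda>\<beta>. (act_form A \<beta>) $ {}" "\<lambda>\<beta>. \<beta> $ {}"])
     (auto simp: act_form_lin
       act_form_form1_wedge intro!: linearI)
  have "\<forall>\<beta>. act_form A \<alpha> \<bullet> act_form A \<beta> = \<alpha> \<bullet> \<beta>"
  proof (rule form_induct[where P = "\<lambda>\<alpha>. \<forall>\<beta>. act_form A \<alpha> \<bullet> act_form A \<beta> = \<alpha> \<bullet> \<beta>"])
    show "subspace {\<alpha>. \<forall>\<beta>. act_form A \<alpha> \<bullet> act_form A \<beta> = \<alpha> \<bullet> \<beta>}"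
      by (auto simp: subspace_def act_form_lin
         linear_0[OF linear_act_form] inner_add_left)
    fix v \<alpha> assume IH: "\<forall>\<beta>. act_form A \<alpha> \<bullet> act_form A \<beta> = \<alpha> \<bullet> \<beta>"
    show "\<forall>\<beta>. act_form A (form1 v \<^bold>\<and> \<alpha>) \<bullet> act_form A \<beta> = (form1 v \<^bold>\<and> \<alpha>) \<bullet> \<beta>"
    proof
      fix \<beta>
      show "act_form A (form1 v \<^bold>\<and> \<alpha>) \<bullet> act_form A \<beta> = (form1 v \<^bold>\<and> \<alpha>) \<bullet> \<beta>"
        using IH by (simp only: act_form_form1_wedge form1_wedge_adjoint act_form_int_v[OF assms])
    qed
  qed (simp add: one)
  thus ?thesis by blast
qed

lemma orthogonal_matrix_transpose_mult:
  "orthogonal_matrix A \<Longrightarrow> transpose A ** A = mat 1" "orthogonal_matrix A \<Longrightarrow> A ** transpose A = mat 1"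
  by (simp_all add: orthogonal_matrix_def)

lemma act_form_transpose:
  assumes "orthogonal_matrix A"
  shows "act_form A (act_form (transpose A) \<alpha>) = \<alpha>" "act_form (transpose A) (act_form A \<alpha>) = \<alpha>"
  by (simp_all add: act_form_compose orthogonal_matrix_transpose_mult[OF assms])

section \<open>The Hodge operator and \<open>sigma\<close> under orthogonal matrices\<close>

lemma linear_hodge: "linear hodge"
  by (rule linearI) (simp_all add: hodge_def vec_eq_iff algebra_simps)

lemma wedge_UNIV: "(\<alpha> \<^bold>\<and> \<beta>) $ UNIV = (\<Sum>I\<in>UNIV. shuffle_sign I (- I) * \<alpha> $ I * \<beta> $ (- I))"
  by (simp add: wedge_def Compl_eq_Diff_UNIV)

lemma wedge_hodge_UNIV: "(\<alpha> \<^bold>\<and> hodge \<beta>) $ UNIV = \<alpha> \<bullet> \<beta>"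
  unfolding wedge_UNIV hodge_def inner_vec_def
  by (intro sum.cong refl) (simp add: shuffle_sign_square mult.assoc mult.left_commute)

lemma hodge_inner: "hodge \<alpha> \<bullet> \<beta> = (\<alpha> \<^bold>\<and> \<beta>) $ UNIV"
proof -
  have "hodge \<alpha> \<bullet> \<beta> = (\<Sum>K\<in>UNIV. shuffle_sign (- K) K * \<alpha> $ (- K) * \<beta> $ K)"
    by (simp add: hodge_def inner_vec_def mult.assoc)
  also have "\<dots> = (\<alpha> \<^bold>\<and> \<beta>) $ UNIV"
    unfolding wedge_UNIV by (rule sum.reindex_bij_witness[of _ uminus uminus]) auto
  finally show ?thesis .
qed

text \<open>The pairing into the top degree is nondegenerate: each basis form pairs to a sign with
  its complement and to zero with the others.\<close>

lemma wedge_UNIV_eqI: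
  assumes "\<And>\<gamma>. (\<gamma> \<^bold>\<and> \<alpha>) $ UNIV = (\<gamma> \<^bold>\<and> \<beta>) $ UNIV"
  shows "\<alpha> = \<beta>"
proof -
  have *: "(axis (- K) 1 \<^bold>\<and> \<alpha>) $ UNIV = shuffle_sign (- K) K * \<alpha> $ K" for K \<alpha>
  proof -
    have "(axis (- K) 1 \<^bold>\<and> \<alpha>) $ UNIV = (\<Sum>I\<in>UNIV. if I = - K then shuffle_sign (- K) K * \<alpha> $ K else 0)"
      unfolding wedge_UNIV by (rule sum.cong) (auto simp: axis_def)
    thus ?thesis by simp
  qed
  have "shuffle_sign (- K) K \<noteq> 0" for K
    using shuffle_sign_square[of "- K" K] by auto
  thus ?thesis using assms[of "axis (- _) 1"] by (simp add: * vec_eq_iff)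
qed

text \<open>The constant is the scalar by which \<open>A\<close> acts on the volume form, that is,
  its determinant. The Hodge operator is determined by the top-degree pairing through
  \<open>wedge_hodge_UNIV\<close>, and \<open>A\<close> respects wedge and inner product, so only
  this scalar can intervene.\<close>

lemma act_form_hodge:
  assumes "orthogonal_matrix A"
  obtains c where "c * c = 1" "\<And>\<alpha>. act_form A (hodge \<alpha>) = c *\<^sub>R hodge (act_form A \<alpha>)"
proof
  let ?v = "axis UNIV 1 :: form"
  define c where "c = act_form A ?v $ UNIV"
  have ne: "card I \<noteq> card (UNIV :: 8 set)" if "I \<noteq> UNIV" for I :: "8 set"
    using that card_subset_eq[of UNIV I] finite[of "UNIV :: 8 set"] by blast
  have top: "act_form A \<beta> $ UNIV = c * \<beta> $ UNIV" for \<beta>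
  proof (rule linear_eq_axis[of "\<lambda>\<beta>. act_form A \<beta> $ UNIV" "\<lambda>\<beta>. c * \<beta> $ UNIV"])
    show "act_form A (axis I 1) $ UNIV = c * axis I 1 $ UNIV" for I
    proof (cases "I = UNIV")
      case False
      hence "card I \<noteq> card (UNIV :: 8 set)" by (rule ne)
      moreover have "act_form A (axis I 1) \<in> Lam (card I)" by (intro act_form_Lam axis_Lam)
      ultimately have "act_form A (axis I 1) $ UNIV = 0" unfolding Lam_def by fastforce
      thus ?thesis using False by (simp add: axis_def)
    qed (simp add: c_def axis_def)
  qed (auto simp: act_form_lin algebra_simps intro!: linearI)
  have "act_form A ?v \<in> Lam (card (UNIV :: 8 set))"
    by (intro act_form_Lam axis_Lam)
  hence "act_form A ?v $ I = 0" if "I \<noteq> UNIV" for I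
    using ne[OF that] unfolding Lam_def by blast
  hence "act_form A ?v = c *\<^sub>R ?v"
    by (auto simp: vec_eq_iff axis_def c_def)
  thus "c * c = 1"
    using act_form_inner[OF assms, of ?v ?v] by (simp add: inner_axis_one)
  show "act_form A (hodge \<alpha>) = c *\<^sub>R hodge (act_form A \<alpha>)" for \<alpha>
  proof (rule wedge_UNIV_eqI)
    fix \<gamma>
    define \<gamma>' where "\<gamma>' = act_form (transpose A) \<gamma>"
    have \<gamma>: "\<gamma> = act_form A \<gamma>'" by (simp add: \<gamma>'_def act_form_transpose[OF assms])
    have "(\<gamma> \<^bold>\<and> act_form A (hodge \<alpha>)) $ UNIV = c * (\<gamma>' \<bullet> \<alpha>)"
      unfolding \<gamma> by (simp add: top wedge_hodge_UNIV flip: act_form_wedge)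
    also have "\<gamma>' \<bullet> \<alpha> = \<gamma> \<bullet> act_form A \<alpha>"
      unfolding \<gamma> by (simp add: act_form_inner[OF assms])
    finally show "(\<gamma> \<^bold>\<and> act_form A (hodge \<alpha>)) $ UNIV = (\<gamma> \<^bold>\<and> c *\<^sub>R hodge (act_form A \<alpha>)) $ UNIV"
      by (simp add: wedge_scale_right wedge_hodge_UNIV)
  qed
qed

lemma sigma_1_int_v: "sigma 1 \<alpha> \<beta> = (\<Sum>i\<in>UNIV. int_e i \<alpha> \<^bold>\<and> int_e i \<beta>)"
  using contr_1[of \<alpha> \<beta>] by (simp only: contr_def)

text \<open>\<open>sigma 1\<close> contracts with the tensor summing e_i (x) e_i over an orthonormal
  basis, which an orthogonal matrix fixes. After the sums are exchanged this is the identity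
  \<open>A ** transpose A = mat 1\<close>.\<close>

lemma act_form_sigma_1:
  assumes "orthogonal_matrix A"
  shows "act_form A (sigma 1 \<alpha> \<beta>) = sigma 1 (act_form A \<alpha>) (act_form A \<beta>)"
proof -
  let ?B = "\<lambda>k l. int_e k (act_form A \<alpha>) \<^bold>\<and> int_e l (act_form A \<beta>)"
  have "act_form A (sigma 1 \<alpha> \<beta>) =
      (\<Sum>i\<in>UNIV. int_v (A *v axis i 1) (act_form A \<alpha>) \<^bold>\<and> int_v (A *v axis i 1) (act_form A \<beta>))"
    by (simp add: sigma_1_int_v[unfolded One_nat_def] linear_sum[OF linear_act_form] act_form_wedge act_form_int_v[OF assms])
  also have "\<dots> = (\<Sum>i\<in>UNIV. \<Sum>l\<in>UNIV. \<Sum>k\<in>UNIV. (A $ k $ i * A $ l $ i) *\<^sub>R ?B k l)"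
    by (simp add: int_v_def wedge_sum_left wedge_sum_right wedge_scale_left wedge_scale_right
        matrix_vector_mult_basis column_def scaleR_right.sum mult.commute)
  also have "\<dots> = (\<Sum>l\<in>UNIV. \<Sum>k\<in>UNIV. \<Sum>i\<in>UNIV. (A $ k $ i * A $ l $ i) *\<^sub>R ?B k l)"
    by (subst sum.swap, rule sum.cong[OF refl], subst sum.swap, rule refl)
  also have "\<dots> = (\<Sum>l\<in>UNIV. \<Sum>k\<in>UNIV. (A ** transpose A) $ k $ l *\<^sub>R ?B k l)"
    by (simp add: matrix_matrix_mult_def transpose_def scaleR_left.sum)
  also have "\<dots> = (\<Sum>l\<in>UNIV. \<Sum>k\<in>UNIV. if k = l then ?B l l else 0)"
    unfolding orthogonal_matrix_transpose_mult[OF assms]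
    by (intro sum.cong refl) (simp add: mat_def)
  also have "\<dots> = sigma 1 (act_form A \<alpha>) (act_form A \<beta>)"
    by (simp add: sigma_1_int_v[unfolded One_nat_def])
  finally show ?thesis .
qed

lemma int_e_Lam: "\<alpha> \<in> Lam (Suc k) \<Longrightarrow> int_e i \<alpha> \<in> Lam k"
  by (auto simp: Lam_def int_e_def)

lemma Lam_0: "\<alpha> \<in> Lam 0 \<Longrightarrow> \<alpha> = (\<alpha> \<bullet> axis {} 1) *\<^sub>R axis {} 1"
proof -
  assume "\<alpha> \<in> Lam 0"
  moreover have "\<alpha> \<bullet> axis {} 1 = \<alpha> $ {}" by (simp add: inner_axis)
  ultimately show ?thesis unfolding vec_eq_iff by (auto simp: Lam_def axis_def)
qed

lemma foldr_int_e_inner: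
  "foldr int_e is \<alpha> \<bullet> \<beta> = \<alpha> \<bullet> (wedge_list (map (\<lambda>i. form1 (axis i 1)) (rev is)) \<^bold>\<and> \<beta>)"
proof (induction "is" arbitrary: \<beta>)
  case (Cons i "is")
  have "wedge_list (\<alpha>s @ [\<gamma>]) = wedge_list \<alpha>s \<^bold>\<and> \<gamma>" for \<alpha>s \<gamma>
    by (induction \<alpha>s) (simp_all add: wedge_assoc)
  thus ?case using int_v_adjoint[of "axis i 1"] Cons by (simp add: wedge_assoc)
qed simp

text \<open>Contracting by e_j and then e_i reverses the order of the two factors and produces a
  minus sign. It occurs once for \<open>\<omega>\<close> and once for \<open>\<beta>\<close>, so the
  signs cancel.\<close>

lemma contr_2_inner:
  assumes "\<omega> \<in> Lam 2"
  shows "contr 2 \<omega> \<beta> \<bullet> \<eta> = \<beta> \<bullet> (\<omega> \<^bold>\<and> \<eta>)"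
proof -
  let ?f = "\<lambda>I. foldr int_e (sorted_list_of_set I)"
  have *: "(?f I \<omega> \<^bold>\<and> ?f I \<beta>) \<bullet> \<eta> = \<omega> $ I * (\<beta> \<bullet> (axis I 1 \<^bold>\<and> \<eta>))" if I: "card I = 2" for I
  proof -
    have "\<exists>i j. i < j \<and> I = {i, j}"
      using I by (metis card_2_iff insert_commute linorder_neqE)
    then obtain i j where ij: "i < j" "I = {i, j}" by blast
    have s: "sorted_list_of_set I = [i, j]"
      using ij by (simp add: sorted_list_of_set_insert_remove less_imp_le)
    have e: "wedge_list (map (\<lambda>i. form1 (axis i 1)) (rev (sorted_list_of_set I))) = - axis I 1"
      using wedge_list_sorted[of I] by (simp add: s form1_wedge_form1[of "axis j 1" "axis i 1"])
    have "int_e i (int_e j \<omega>) \<in> Lam 0"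
      using assms by (intro int_e_Lam) (simp add: numeral_2_eq_2)
    hence "?f I \<omega> = (?f I \<omega> \<bullet> axis {} 1) *\<^sub>R axis {} 1"
      unfolding s by (simp only: foldr.simps o_apply id_apply Lam_0[symmetric])
    moreover have "?f I \<omega> \<bullet> axis {} 1 = - (\<omega> $ I)"
      unfolding foldr_int_e_inner e by (simp add: inner_axis wedge_minus_left)
    ultimately have "?f I \<omega> = (- (\<omega> $ I)) *\<^sub>R axis {} 1" by simp
    hence "(?f I \<omega> \<^bold>\<and> ?f I \<beta>) \<bullet> \<eta> = - \<omega> $ I * (?f I \<beta> \<bullet> \<eta>)"
      by (simp only: wedge_scale_left wedge_one_left inner_scaleR_left)
    thus ?thesis
      unfolding foldr_int_e_inner[of _ \<beta>] e by (simp add: wedge_minus_left)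
  qed
  have "\<omega> = (\<Sum>I | card I = 2. \<omega> $ I *\<^sub>R axis I 1)"
    unfolding vec_eq_iff sum_component
    using assms by (auto simp: Lam_def axis_def if_distrib cong: if_cong)
  hence h: "\<beta> \<bullet> (\<omega> \<^bold>\<and> \<eta>) = (\<Sum>I | card I = 2. \<omega> $ I * (\<beta> \<bullet> (axis I 1 \<^bold>\<and> \<eta>)))"
    by (rule ssubst) (simp only: wedge_sum_left wedge_scale_left inner_sum_right inner_scaleR_right)
  show ?thesis
    unfolding contr_def sigma_def inner_sum_left h by (intro sum.cong refl) (simp add: *)
qed

section \<open>The tensor product and the maps \<open>\<Phi>\<close> and \<open>\<Theta>\<close>\<close>

lemma rho_Lam: "rho \<in> Lam 3"
proof -
  have eb: "eb ns \<in> Lam (length ns)" for ns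
    unfolding eb_def using wedge_list_Lam[of "map (\<lambda>n. form1 (axis (of_nat (n - 1)) 1)) ns"] form1_Lam by auto
  have 3: "eb [a, b, c] \<in> Lam 3" for a b c
    using eb[of "[a, b, c]"] by (simp add: numeral_3_eq_3)
  have 2: "eb [a, b] \<in> Lam 2" for a b
    using eb[of "[a, b]"] by (simp add: numeral_2_eq_2)
  have w: "\<alpha> \<^bold>\<and> eb [a] \<in> Lam 3" if "\<alpha> \<in> Lam 2" for \<alpha> a
    using wedge_Lam[OF that, of "eb [a]" 1] eb[of "[a]"] by simp
  show ?thesis
    unfolding rho_def
    by (intro subspace_add[OF subspace_Lam] subspace_diff[OF subspace_Lam] subspace_scale[OF subspace_Lam] w 2 3)
qed

lemma R8_m_iff: "t \<in> R8_m \<longleftrightarrow> (\<forall>i. t $ i \<in> \<mm>)"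
  by (simp add: R8_m_eq)

lemma subspace_R8_m: "subspace R8_m"
  unfolding R8_m_def by simp

lemma R8_m_eqI:
  assumes "s \<in> R8_m" "t \<in> R8_m" "\<And>u. u \<in> R8_m \<Longrightarrow> s \<bullet> u = t \<bullet> u"
  shows "s = t"
proof -
  have "s - t \<in> R8_m" using assms by (simp add: subspace_diff[OF subspace_R8_m])
  hence "(s - t) \<bullet> (s - t) = 0" using assms(3)[of "s - t"] by (simp add: inner_diff_left)
  thus ?thesis by simp
qed

lemma sum_tensor_component: "(\<Sum>i\<in>UNIV. axis i 1 \<otimes>\<^sub>t f i) $ j = f j"
proof -
  have "(\<Sum>i\<in>UNIV. axis i 1 \<otimes>\<^sub>t f i) $ j = (\<Sum>i\<in>UNIV. if i = j then f j else 0)"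
    unfolding sum_component tensor_def vec_lambda_beta
    by (intro sum.cong refl) (auto simp: axis_def)
  thus ?thesis by simp
qed

lemma Phi1_component: "Phi1 t = (\<Sum>i\<in>UNIV. form1 (axis i 1) \<^bold>\<and> t $ i)"
  by (simp add: Phi1_def)

lemma Phi2_component: "Phi2 t = (\<Sum>i\<in>UNIV. int_e i rho \<^bold>\<and> t $ i)"
  by (simp only: Phi2_def int_e_eq_contr)

lemma Theta1_component: "Theta1 T $ i = - (1 / 2) *\<^sub>R orth_proj \<mm> (int_e i T)"
  unfolding Theta1_def by (simp only: vector_scaleR_component sum_tensor_component int_e_eq_contr)

lemma Theta2_component: "Theta2 F $ i = - orth_proj \<mm> (contr 2 (int_e i rho) F)"
  unfolding Theta2_def by (simp only: vector_uminus_component sum_tensor_component int_e_eq_contr)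

lemma orth_proj_m_inner: "\<omega> \<in> \<mm> \<Longrightarrow> orth_proj \<mm> x \<bullet> \<omega> = x \<bullet> \<omega>"
  using orth_proj(2)[OF subspace_Lam2_20, of \<omega> x] by (simp add: orthogonal_def inner_diff_left)

lemma Theta1_R8_m: "Theta1 T \<in> R8_m" and Theta2_R8_m: "Theta2 F \<in> R8_m"
  by (simp_all add: R8_m_iff Theta1_component Theta2_component orth_proj(1) subspace_Lam2_20
      subspace_scale subspace_neg)

text \<open>The projection disappears because the components of \<open>t\<close> already lie in
  \<open>\<mm>\<close>; what is left is the adjointness of contraction and wedge product.\<close>

lemma Theta1_adjoint: "t \<in> R8_m \<Longrightarrow> Theta1 T \<bullet> t = - (1 / 2) * (T \<bullet> Phi1 t)"
  using int_v_adjoint[of "axis _ 1" T]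
  by (simp add: inner_vec_def[of "Theta1 T"] Theta1_component orth_proj_m_inner R8_m_iff Phi1_component
      inner_sum_right sum_negf sum_divide_distrib)

lemma Theta2_adjoint: "t \<in> R8_m \<Longrightarrow> Theta2 F \<bullet> t = - (F \<bullet> Phi2 t)"
proof -
  have "int_e i rho \<in> Lam 2" for i
    using rho_Lam by (intro int_e_Lam) (simp add: numeral_3_eq_3 numeral_2_eq_2)
  thus "t \<in> R8_m \<Longrightarrow> Theta2 F \<bullet> t = - (F \<bullet> Phi2 t)"
    by (simp add: inner_vec_def[of "Theta2 F"] Theta2_component orth_proj_m_inner R8_m_iff Phi2_component
        inner_sum_right sum_negf contr_2_inner)
qed

text \<open>Read off from the adjoint formula by testing against all of \<open>R8_m\<close>, so that
  the definite description inside \<open>orth_proj\<close> stays folded.\<close>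

lemma linear_Theta1: "linear Theta1"
proof (rule linearI)
  show "Theta1 (a + b) = Theta1 a + Theta1 b" for a b
    by (rule R8_m_eqI) (simp_all add: Theta1_R8_m subspace_add[OF subspace_R8_m] Theta1_adjoint inner_add_left
      algebra_simps add_divide_distrib)
  show "Theta1 (c *\<^sub>R a) = c *\<^sub>R Theta1 a" for c a
    by (rule R8_m_eqI) (simp_all add: Theta1_R8_m subspace_scale[OF subspace_R8_m] Theta1_adjoint)
qed

lemma linear_Theta2: "linear Theta2"
proof (rule linearI)
  show "Theta2 (a + b) = Theta2 a + Theta2 b" for a b
    by (rule R8_m_eqI) (simp_all add: Theta2_R8_m subspace_add[OF subspace_R8_m] Theta2_adjoint inner_add_left)
  show "Theta2 (c *\<^sub>R a) = c *\<^sub>R Theta2 a" for c a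
    by (rule R8_m_eqI) (simp_all add: Theta2_R8_m subspace_scale[OF subspace_R8_m] Theta2_adjoint)
qed

lemma tensor_inner: "(X \<otimes>\<^sub>t \<alpha>) \<bullet> (Y \<otimes>\<^sub>t \<beta>) = (X \<bullet> Y) * (\<alpha> \<bullet> \<beta>)"
  unfolding inner_vec_def[of "X \<otimes>\<^sub>t \<alpha>"] inner_vec_def[of X]
  by (simp add: tensor_def sum_distrib_left mult_ac)

lemma tensor_add_left: "(X + Y) \<otimes>\<^sub>t \<alpha> = X \<otimes>\<^sub>t \<alpha> + Y \<otimes>\<^sub>t \<alpha>"
  and tensor_scale_left: "(c *\<^sub>R X) \<otimes>\<^sub>t \<alpha> = c *\<^sub>R (X \<otimes>\<^sub>t \<alpha>)"
  and tensor_add_right: "X \<otimes>\<^sub>t (\<alpha> + \<beta>) = X \<otimes>\<^sub>t \<alpha> + X \<otimes>\<^sub>t \<beta>"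
  and tensor_scale_right: "X \<otimes>\<^sub>t (c *\<^sub>R \<alpha>) = c *\<^sub>R (X \<otimes>\<^sub>t \<alpha>)"
  by (simp_all add: tensor_def vec_eq_iff algebra_simps)

lemma linear_eq_tensor:
  assumes "linear f" "linear g" "\<And>X \<alpha>. f (X \<otimes>\<^sub>t \<alpha>) = g (X \<otimes>\<^sub>t \<alpha>)"
  shows "f t = g t"
  using assms(3) by (subst (1 2) tens_expand) (simp only: linear_sum[OF assms(1)] linear_sum[OF assms(2)])

section \<open>Equivariance under the isotropy group\<close>

lemma act_tens_compose: "act_tens A (act_tens B t) = act_tens (A ** B) t"
  by (rule linear_eq_tensor[of "\<lambda>t. act_tens A (act_tens B t)" "act_tens (A ** B)"])
     (auto simp: linear_act_tens act_tens_lin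
       act_tens_tensor act_form_compose matrix_vector_mul_assoc intro!: linearI)

lemma act_tens_id [simp]: "act_tens (mat 1) t = t"
  by (rule linear_eq_tensor[of "\<lambda>t. act_tens (mat 1) t" "\<lambda>t. t"])
     (auto simp: linear_act_tens act_tens_tensor linear_ident)

lemma act_tens_inner:
  assumes "orthogonal_matrix A"
  shows "act_tens A s \<bullet> act_tens A t = s \<bullet> t"
proof -
  have 1: "act_tens A s \<bullet> act_tens A (X \<otimes>\<^sub>t \<alpha>) = s \<bullet> (X \<otimes>\<^sub>t \<alpha>)" for X \<alpha>
    by (rule linear_eq_tensor[of "\<lambda>s. act_tens A s \<bullet> act_tens A (X \<otimes>\<^sub>t \<alpha>)" "\<lambda>s. s \<bullet> (X \<otimes>\<^sub>t \<alpha>)"])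
       (auto simp: act_tens_lin inner_add_left
         act_tens_tensor tensor_inner orthogonal_matrix_inner[OF assms] act_form_inner[OF assms] intro!: linearI)
  show ?thesis
    by (rule linear_eq_tensor[of "\<lambda>t. act_tens A s \<bullet> act_tens A t" "\<lambda>t. s \<bullet> t"])
       (auto simp: act_tens_lin inner_add_right 1 intro!: linearI)
qed

lemma PSU3_D:
  assumes "A \<in> PSU3"
  shows "orthogonal_matrix A" "act_form A rho = rho"
  using assms by (auto simp: PSU3_def SO8_def)

lemma PSU3_transpose: "A \<in> PSU3 \<Longrightarrow> transpose A \<in> PSU3"
  using act_form_transpose(2)[of A rho]
  by (auto simp: PSU3_def SO8_def orthogonal_matrix_transpose det_transpose)

lemma act_Phi1: "act_form A (Phi1 t) = Phi1 (act_tens A t)"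
  by (rule linear_eq_tensor[of "\<lambda>t. act_form A (Phi1 t)" "\<lambda>t. Phi1 (act_tens A t)"])
     (auto simp: act_tens_lin
       act_form_lin
       linear_add[OF linear_Phi1] linear_scale[OF linear_Phi1]
       act_tens_tensor Phi1_tensor act_form_form1_wedge intro!: linearI)

lemma Phi2_tensor': "Phi2 (X \<otimes>\<^sub>t \<omega>) = int_v X rho \<^bold>\<and> \<omega>"
  using Phi2_tensor[of X \<omega>] by (simp only: contr_1_form1)

lemma act_Phi2:
  assumes "A \<in> PSU3"
  shows "act_form A (Phi2 t) = Phi2 (act_tens A t)"
proof -
  have int_v_rho: "act_form A (int_v X rho) = int_v (A *v X) rho" for X
    using act_form_int_v[OF PSU3_D(1)[OF assms], of X rho] by (simp add: PSU3_D(2)[OF assms])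
  show ?thesis
  by (rule linear_eq_tensor[of "\<lambda>t. act_form A (Phi2 t)" "\<lambda>t. Phi2 (act_tens A t)"])
     (auto simp: act_tens_lin
       act_form_lin
       linear_add[OF linear_Phi2] linear_scale[OF linear_Phi2] PSU3_D(2)[OF assms]
       act_tens_tensor Phi2_tensor' act_form_wedge int_v_rho intro!: linearI)
qed

lemma act_sigma_plus: "A \<in> PSU3 \<Longrightarrow> act_form A (sigma_plus \<alpha>) = sigma_plus (act_form A \<alpha>)"
  unfolding sigma_plus_def using act_form_sigma_1[of A rho \<alpha>] by (simp add: PSU3_D)

lemma linear_sigma_plus: "linear sigma_plus"
  unfolding sigma_plus_def sigma_1_int_v
  by (rule linearI) (simp_all add: int_e_lin wedge_lin
      sum.distrib scaleR_right.sum)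

lemma sigma_plus_form1: "sigma_plus (form1 X) = int_v X rho"
proof -
  have "int_e i (form1 X) = X $ i *\<^sub>R axis {} 1" for i
    using int_v_wedge[of "axis i 1" X "axis {} 1"] by (simp add: inner_axis')
  thus ?thesis
    unfolding sigma_plus_def sigma_1_int_v int_v_def by (simp add: wedge_scale_right)
qed

lemma Lam_1: "Lam 1 = range form1"
proof
  show "Lam 1 \<subseteq> range form1"
  proof
    fix \<alpha> assume \<alpha>: "\<alpha> \<in> Lam 1"
    have "\<alpha> = form1 (\<chi> i. \<alpha> $ {i})"
    proof -
      have "form1 (\<chi> i. \<alpha> $ {i}) $ I = \<alpha> $ I" for I
      proof (cases "card I = 1")
        case True
        then obtain i where "I = {i}" by (auto simp: card_1_singleton_iff)
        thus ?thesis by (simp add: form1_def axis_def if_distrib cong: if_cong)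
      next
        case False
        thus ?thesis using \<alpha> form1_Lam[of "\<chi> i. \<alpha> $ {i}"] unfolding Lam_def by fastforce
      qed
      thus ?thesis by (simp add: vec_eq_iff)
    qed
    thus "\<alpha> \<in> range form1" by blast
  qed
qed (use form1_Lam in auto)

lemma Lam2_8_eq: "Lam2_8 = range (\<lambda>X. int_v X rho)"
  unfolding Lam2_8_def Lam_1 by (simp add: image_image sigma_plus_form1)

lemma Lam2_8_subset: "Lam2_8 \<subseteq> Lam 2"
  using rho_Lam unfolding Lam2_8_eq int_v_def
  by (auto intro!: subspace_sum[OF subspace_Lam] subspace_scale[OF subspace_Lam] int_e_Lam
      simp: numeral_3_eq_3 numeral_2_eq_2)

text \<open>The defining condition is homogeneous in \<open>hodge rho\<close>, so the scalar from
  \<open>act_form_hodge\<close> does no harm.\<close>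

lemma act_Lam2_20:
  assumes "A \<in> PSU3" "\<omega> \<in> \<mm>"
  shows "act_form A \<omega> \<in> \<mm>"
proof -
  obtain c where "c * c = 1" "act_form A (hodge rho) = c *\<^sub>R hodge (act_form A rho)"
    using act_form_hodge[OF PSU3_D(1)[OF assms(1)]] by metis
  moreover have "act_form A (\<omega> \<^bold>\<and> hodge rho) = 0"
    using assms by (simp add: Lam2_20_def linear_0[OF linear_act_form])
  ultimately show ?thesis
    using assms by (auto simp: act_form_wedge Lam2_20_def act_form_Lam PSU3_D wedge_scale_right)
qed

lemma act_R8_m:
  assumes "A \<in> PSU3" "t \<in> R8_m"
  shows "act_tens A t \<in> R8_m"
proof -
  have "act_tens A t \<in> span {X \<otimes>\<^sub>t \<omega> | X \<omega>. \<omega> \<in> \<mm>}"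
    unfolding act_tens_def
    using assms by (intro span_sum span_base) (auto simp: R8_m_iff intro: act_Lam2_20)
  thus ?thesis by (simp add: R8_m_def)
qed

lemma act_tens_transpose:
  assumes "orthogonal_matrix A"
  shows "act_tens A (act_tens (transpose A) t) = t" "act_tens (transpose A) (act_tens A t) = t"
  by (simp_all add: act_tens_compose orthogonal_matrix_transpose_mult[OF assms])

text \<open>The adjoint of an equivariant map between orthogonal representations is equivariant:
  test against \<open>u\<close>, pull \<open>u\<close> back by the transpose, and use
  \<open>act_Phi1\<close>.\<close>

lemma act_Theta1:
  assumes "A \<in> PSU3"
  shows "act_tens A (Theta1 T) = Theta1 (act_form A T)"
proof (rule R8_m_eqI)
  note o = PSU3_D(1)[OF assms]
  fix u assume u: "u \<in> R8_m"
  define s where "s = act_tens (transpose A) u"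
  have s: "s \<in> R8_m" "u = act_tens A s"
    using u by (auto simp: s_def act_tens_transpose[OF o] intro: act_R8_m PSU3_transpose[OF assms])
  show "act_tens A (Theta1 T) \<bullet> u = Theta1 (act_form A T) \<bullet> u"
    unfolding s(2) using s(1)
    by (simp add: act_tens_inner[OF o] Theta1_adjoint act_R8_m[OF assms] act_form_inner[OF o] flip: act_Phi1)
qed (auto intro: act_R8_m assms Theta1_R8_m)

lemma act_Theta2:
  assumes "A \<in> PSU3"
  shows "act_tens A (Theta2 T) = Theta2 (act_form A T)"
proof (rule R8_m_eqI)
  note o = PSU3_D(1)[OF assms]
  fix u assume u: "u \<in> R8_m"
  define s where "s = act_tens (transpose A) u"
  have s: "s \<in> R8_m" "u = act_tens A s"
    using u by (auto simp: s_def act_tens_transpose[OF o] intro: act_R8_m PSU3_transpose[OF assms])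
  show "act_tens A (Theta2 T) \<bullet> u = Theta2 (act_form A T) \<bullet> u"
    unfolding s(2) using s(1)
    by (simp add: act_tens_inner[OF o] Theta2_adjoint act_R8_m[OF assms] act_form_inner[OF o]
        flip: act_Phi2[OF assms])
qed (auto intro: act_R8_m assms Theta2_R8_m)

section \<open>Orthogonal representations\<close>

lemma invariant_subspaceD:
  assumes "invariant_subspace G act U"
  shows "subspace U" "\<And>g u. g \<in> G \<Longrightarrow> u \<in> U \<Longrightarrow> act g u \<in> U"
  using assms by (auto simp: invariant_subspace_def)

lemma invariant_subspace_Int:
  "invariant_subspace G act U \<Longrightarrow> invariant_subspace G act V \<Longrightarrow> invariant_subspace G act (U \<inter> V)"
  by (auto simp: invariant_subspace_def subspace_inter)

lemma irreducible_moduleD: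
  assumes "irreducible_module G act V"
  shows "invariant_subspace G act V" "V \<noteq> {0}"
    "\<And>U. U \<subseteq> V \<Longrightarrow> invariant_subspace G act U \<Longrightarrow> U = {0} \<or> U = V"
  using assms by (auto simp: irreducible_module_def)

lemma irreducible_module_Int:
  assumes "irreducible_module G act V" "irreducible_module G act W" "V \<noteq> W"
  shows "V \<inter> W = {0}"
proof -
  have "invariant_subspace G act (V \<inter> W)"
    using assms by (intro invariant_subspace_Int irreducible_moduleD(1))
  thus ?thesis
    using irreducible_moduleD(3)[OF assms(1), of "V \<inter> W"] irreducible_moduleD(3)[OF assms(2), of "V \<inter> W"] assms(3)
    by blast
qed

section \<open>Schur's lemma for maps equivariant up to scalars\<close>

text \<open>Nonzero scalars are allowed so that the Hodge operator qualifies as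
  \<open>act_form_hodge\<close> delivers it. They affect neither images nor preimages of invariant
  subspaces.\<close>

definition projectively_equivariant ::
    "'g set \<Rightarrow> ('g \<Rightarrow> 'v \<Rightarrow> 'v) \<Rightarrow> ('g \<Rightarrow> 'w \<Rightarrow> 'w) \<Rightarrow> ('v::real_vector \<Rightarrow> 'w::real_vector) \<Rightarrow> bool" where
  "projectively_equivariant G act act' f \<longleftrightarrow> linear f \<and>
     (\<forall>g\<in>G. \<exists>c. c \<noteq> 0 \<and> (\<forall>v. act' g (f v) = c *\<^sub>R f (act g v)))"

lemma projectively_equivariantI:
  assumes "linear f" "\<And>g v. g \<in> G \<Longrightarrow> act' g (f v) = f (act g v)"
  shows "projectively_equivariant G act act' f"
  unfolding projectively_equivariant_def using assms by (metis scaleR_one zero_neq_one)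

lemma projectively_equivariant_compose:
  assumes f: "projectively_equivariant G act act' f" and h: "projectively_equivariant G act' act'' h"
  shows "projectively_equivariant G act act'' (\<lambda>v. h (f v))"
  unfolding projectively_equivariant_def
proof (intro conjI ballI)
  show "linear (\<lambda>v. h (f v))"
    using assms linear_compose[of f h] by (simp add: projectively_equivariant_def o_def)
  fix g assume "g \<in> G"
  then obtain c d where "c \<noteq> 0" "\<And>v. act' g (f v) = c *\<^sub>R f (act g v)"
      "d \<noteq> 0" "\<And>v. act'' g (h v) = d *\<^sub>R h (act' g v)"
    using assms unfolding projectively_equivariant_def by metis
  moreover have "linear h" using h by (simp add: projectively_equivariant_def)
  ultimately have "d * c \<noteq> 0" "\<And>v. act'' g (h (f v)) = (d * c) *\<^sub>R h (f (act g v))"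
    by (simp_all add: linear_scale)
  thus "\<exists>c. c \<noteq> 0 \<and> (\<forall>v. act'' g (h (f v)) = c *\<^sub>R h (f (act g v)))" by blast
qed

lemma
  assumes f: "projectively_equivariant G act act' f"
  shows invariant_subspace_image: "invariant_subspace G act U \<Longrightarrow> invariant_subspace G act' (f ` U)"
    and invariant_subspace_vimage: "invariant_subspace G act' W \<Longrightarrow> invariant_subspace G act (f -` W)"
proof -
  have lin: "linear f" using f by (simp add: projectively_equivariant_def)
  show "invariant_subspace G act' (f ` U)" if U: "invariant_subspace G act U"
    unfolding invariant_subspace_def
  proof (intro conjI ballI)
    show s: "subspace (f ` U)" using linear_subspace_image[OF lin] invariant_subspaceD(1)[OF U] .
    fix g y assume "g \<in> G" "y \<in> f ` U"
    moreover from this obtain u c where "u \<in> U" "y = f u" "act' g (f u) = c *\<^sub>R f (act g u)"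
      using f unfolding projectively_equivariant_def by blast
    ultimately show "act' g y \<in> f ` U"
      using subspace_scale[OF s] invariant_subspaceD(2)[OF U] by simp
  qed
  show "invariant_subspace G act (f -` W)" if W: "invariant_subspace G act' W"
    unfolding invariant_subspace_def
  proof (intro conjI ballI)
    note s = invariant_subspaceD(1)[OF W]
    show "subspace (f -` W)" using linear_subspace_vimage[OF lin s] .
    fix g v assume g: "g \<in> G" and v: "v \<in> f -` W"
    obtain c where c: "c \<noteq> 0" "act' g (f v) = c *\<^sub>R f (act g v)"
      using f g unfolding projectively_equivariant_def by blast
    have "(1 / c) *\<^sub>R act' g (f v) \<in> W"
      using v invariant_subspaceD(2)[OF W g] by (intro subspace_scale[OF s]) simp
    thus "act g v \<in> f -` W" using c by simp
  qed
qed

text \<open>Schur's lemma: the kernel meets \<open>V\<close> in an invariant subspace that misses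
  \<open>v\<close>, hence in zero. A single nonzero value therefore transports irreducibility and
  dimension to the image.\<close>

lemma irreducible_module_image:
  fixes f :: "'v::euclidean_space \<Rightarrow> 'w::euclidean_space"
  assumes f: "projectively_equivariant G act act' f"
    and z: "\<And>g. g \<in> G \<Longrightarrow> act' g 0 = 0"
    and irr: "irreducible_module G act V" and v: "v \<in> V" "f v \<noteq> 0"
  shows "irreducible_module G act' (f ` V)" "dim (f ` V) = dim V"
proof -
  note V = irreducible_moduleD[OF irr]
  have lin: "linear f" using f by (simp add: projectively_equivariant_def)
  have "invariant_subspace G act' {0}"
    using z by (auto simp: invariant_subspace_def)
  from invariant_subspace_vimage[OF f this]
  have "invariant_subspace G act (V \<inter> f -` {0})"
    using V(1) by (intro invariant_subspace_Int) auto
  hence "V \<inter> f -` {0} = {0} \<or> V \<inter> f -` {0} = V"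
    by (intro V(3)) auto
  hence ker: "V \<inter> f -` {0} = {0}" using v by auto
  have inj: "inj_on f V"
    using ker linear_inj_on_iff_eq_0[OF lin invariant_subspaceD(1)[OF V(1)]] by blast
  thus "dim (f ` V) = dim V"
    using invariant_subspaceD(1)[OF V(1)] by (intro dim_image_eq[OF lin]) (simp add: span_eq_iff[THEN iffD2])
  have "W = {0} \<or> W = f ` V" if W: "W \<subseteq> f ` V" "invariant_subspace G act' W" for W
  proof -
    have "invariant_subspace G act (V \<inter> f -` W)"
      using V(1) invariant_subspace_vimage[OF f W(2)] by (intro invariant_subspace_Int) auto
    hence "V \<inter> f -` W = {0} \<or> V \<inter> f -` W = V" by (intro V(3)) auto
    moreover have "W = f ` (V \<inter> f -` W)" using W(1) by auto
    ultimately show ?thesis using linear_0[OF lin] by auto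
  qed
  moreover have "f ` V \<noteq> {0}" using v by blast
  ultimately show "irreducible_module G act' (f ` V)"
    unfolding irreducible_module_def using invariant_subspace_image[OF f V(1)] by auto
qed

text \<open>Closure under adjoints is exactly what makes orthogonal complements of invariant
  subspaces invariant, and it asks for no group structure on \<open>G\<close>.\<close>

locale orthogonal_representation =
  fixes G :: "'g set" and act :: "'g \<Rightarrow> 'v::euclidean_space \<Rightarrow> 'v"
  assumes adjoint: "g \<in> G \<Longrightarrow> \<exists>h\<in>G. \<forall>x y. act g x \<bullet> y = x \<bullet> act h y"
begin

abbreviation "inv_subspace \<equiv> invariant_subspace G act"
abbreviation "irred \<equiv> irreducible_module G act"

lemma inv_subspace_orthogonal:
  assumes "inv_subspace U"
  shows "inv_subspace {x. \<forall>u\<in>U. x \<bullet> u = 0}"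
  unfolding invariant_subspace_def
proof safe
  show "subspace {x. \<forall>u\<in>U. x \<bullet> u = 0}"
    by (auto simp: subspace_def inner_add_left)
  fix g x u assume "g \<in> G" "\<forall>u\<in>U. x \<bullet> u = 0" "u \<in> U"
  thus "act g x \<bullet> u = 0"
    using adjoint invariant_subspaceD(2)[OF assms] by metis
qed

text \<open>\<open>V\<close> meets the orthogonal complement of \<open>W\<close> trivially, since
  otherwise it would lie inside it. The dimensions of \<open>V\<close> and of that complement thus
  add up to at most the whole, and the complement has codimension \<open>dim W\<close>.\<close>

lemma irreducible_dim_le:
  assumes "irred V" "irred W" "\<not> (\<forall>v\<in>V. \<forall>w\<in>W. v \<bullet> w = 0)"
  shows "dim V \<le> dim W"
proof -
  let ?C = "{x. \<forall>w\<in>W. x \<bullet> w = 0}"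
  have C: "inv_subspace ?C" by (intro inv_subspace_orthogonal irreducible_moduleD assms)
  have sub: "subspace V" "subspace W"
    using assms irreducible_moduleD invariant_subspaceD by blast+
  have "V \<inter> ?C = {0} \<or> V \<inter> ?C = V"
    using invariant_subspace_Int[OF irreducible_moduleD(1)[OF assms(1)] C] irreducible_moduleD(3)[OF assms(1)]
    by blast
  hence "V \<inter> ?C = {0}" using assms(3) by blast
  moreover have "dim {x + y | x y. x \<in> V \<and> y \<in> ?C} + dim (V \<inter> ?C) = dim V + dim ?C"
    by (rule dim_sums_Int[OF sub(1) invariant_subspaceD(1)[OF C]])
  moreover have "dim {y \<in> UNIV. \<forall>x\<in>W. orthogonal x y} + dim W = dim (UNIV :: 'v set)"
    using sub(2) by (intro dim_subspace_orthogonal_to_vectors) auto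
  moreover have "{y \<in> UNIV. \<forall>x\<in>W. orthogonal x y} = ?C"
    by (auto simp: orthogonal_def inner_commute)
  moreover have "dim {x + y | x y. x \<in> V \<and> y \<in> ?C} \<le> dim (UNIV :: 'v set)"
    by (intro dim_subset) auto
  ultimately show ?thesis by simp
qed

lemma irreducible_orthogonal:
  assumes "irred V" "irred W" "dim V \<noteq> dim W" "v \<in> V" "w \<in> W"
  shows "v \<bullet> w = 0"
  using irreducible_dim_le[OF assms(1,2)] irreducible_dim_le[OF assms(2,1)] assms(3-5)
  by (metis inner_commute le_antisym)

text \<open>
  The analogue of generation by a highest weight vector over the reals: \<open>H\<close> plays the role of an
  element of the Cartan algebra, and \<open>a\<close>, \<open>b\<close> are the real and imaginary parts of the highest
  weight vector.  For an invariant \<open>U \<subseteq> V\<close>, both components of \<open>a\<close> with respect to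
  \<open>U \<oplus> U\<^sup>\<bottom>\<close> are eigenvectors of \<open>H\<^sup>2\<close>, hence lie in the plane of \<open>a\<close>, \<open>b\<close>, and any
  nonzero vector of that plane generates \<open>V\<close>.
\<close>

lemma irreducibleI:
  assumes inv: "inv_subspace V" and V: "V = span S" and fin: "finite S"
    and H: "linear H" and skew: "\<And>x y. H x \<bullet> y = - (x \<bullet> H y)"
    and H_inv: "\<And>U x. inv_subspace U \<Longrightarrow> x \<in> U \<Longrightarrow> H x \<in> U"
    and ab: "a \<in> S" "b \<in> S" "a \<noteq> 0" "H a = k *\<^sub>R b" "H b = - k *\<^sub>R a" "k \<noteq> 0"
    and eig: "\<And>s. s \<in> S - {a, b} \<Longrightarrow> \<exists>\<nu>. \<nu> \<noteq> - (k\<^sup>2) \<and> H (H s) = \<nu> *\<^sub>R s"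
    and gen: "\<And>U. inv_subspace U \<Longrightarrow> a \<in> U \<Longrightarrow> b \<in> U \<Longrightarrow> S \<subseteq> U"
  shows "irred V"
  unfolding irreducible_module_def
proof (intro conjI allI impI)
  show "inv_subspace V" by (rule inv)
  have aV: "a \<in> V" using ab V span_base by auto
  thus "V \<noteq> {0}" using ab by auto
  have Hlin: "H 0 = 0" "\<And>x y. H (x + y) = H x + H y" "\<And>x y. H (x - y) = H x - H y" "\<And>c x. H (c *\<^sub>R x) = c *\<^sub>R H x" "\<And>x. H (- x) = - H x"
    using H by (simp_all add: linear_0 linear_add linear_diff linear_scale linear_neg)
  have HH: "H (H a) = - (k\<^sup>2) *\<^sub>R a" "H (H b) = - (k\<^sup>2) *\<^sub>R b"
    using ab by (simp_all add: Hlin power2_eq_square)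
  \<comment> \<open>The part \<open>w\<close> of \<open>u\<close> spanned by the other rows still
    has eigenvalue -k^2, while each of those rows has a different one. As H^2 is symmetric,
    \<open>w\<close> is orthogonal to all of them, hence to itself.\<close>
  have plane: "u \<in> span {a, b}" if u: "u \<in> V" "H (H u) = - (k\<^sup>2) *\<^sub>R u" for u
  proof -
    have "S = insert a (insert b (S - {a, b}))" using ab by auto
    hence "u \<in> span ({a, b} \<union> (S - {a, b}))" using u V by (metis Un_insert_left insert_is_Un sup_bot_left)
    then obtain p w where p: "p \<in> span {a, b}" and w: "w \<in> span (S - {a, b})" and uw: "u = p + w"
      unfolding span_Un by blast
    have sub: "subspace {x. H (H x) = - (k\<^sup>2) *\<^sub>R x}"
      by (auto simp: subspace_def Hlin algebra_simps)
    have "span {a, b} \<subseteq> {x. H (H x) = - (k\<^sup>2) *\<^sub>R x}"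
      using HH by (intro span_minimal sub) auto
    hence Hp: "H (H p) = - (k\<^sup>2) *\<^sub>R p" using p by blast
    have "H (H w) = H (H u) - H (H p)" unfolding uw by (simp add: Hlin)
    hence Hw: "H (H w) = - (k\<^sup>2) *\<^sub>R w"
      unfolding u(2) Hp by (simp add: uw algebra_simps)
    have "w \<bullet> s = 0" if s: "s \<in> S - {a, b}" for s
    proof -
      obtain \<nu> where \<nu>: "\<nu> \<noteq> - (k\<^sup>2)" "H (H s) = \<nu> *\<^sub>R s" using eig[OF s] by blast
      have "H (H w) \<bullet> s = w \<bullet> H (H s)" by (simp add: skew)
      hence "(\<nu> + k\<^sup>2) * (w \<bullet> s) = 0" unfolding Hw \<nu>(2) by (simp add: algebra_simps)
      thus ?thesis using \<nu>(1) by auto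
    qed
    moreover have "subspace {x. w \<bullet> x = 0}" by (rule subspace_hyperplane)
    ultimately have "span (S - {a, b}) \<subseteq> {x. w \<bullet> x = 0}" by (intro span_minimal) auto
    hence "w \<bullet> w = 0" using w by auto
    thus ?thesis using p uw by simp
  qed
  have full: "V \<subseteq> U" if U: "inv_subspace U" "u \<in> U" "u \<in> span {a, b}" "u \<noteq> 0" for U u
  proof -
    note sU = invariant_subspaceD(1)[OF U(1)]
    obtain x y where u: "u = x *\<^sub>R a + y *\<^sub>R b"
      using U(3) by (auto simp: span_insert span_singleton algebra_simps)
    have "H u = k *\<^sub>R (x *\<^sub>R b - y *\<^sub>R a)"
      unfolding u by (simp add: Hlin ab algebra_simps)
    hence "x *\<^sub>R b - y *\<^sub>R a = (1 / k) *\<^sub>R H u" using ab by simp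
    hence v: "x *\<^sub>R b - y *\<^sub>R a \<in> U"
      using H_inv[OF U(1,2)] by (simp add: subspace_scale[OF sU])
    \<comment> \<open>With H / k as imaginary unit the plane is a complex line in which
      \<open>u\<close> is x + iy. Multiplication by the conjugate recovers \<open>a\<close> and
      \<open>b\<close> up to the factor x^2 + y^2.\<close>
    have "x *\<^sub>R u - y *\<^sub>R (x *\<^sub>R b - y *\<^sub>R a) \<in> U" "y *\<^sub>R u + x *\<^sub>R (x *\<^sub>R b - y *\<^sub>R a) \<in> U"
      by (rule subspace_diff[OF sU subspace_scale[OF sU U(2)] subspace_scale[OF sU v]],
          rule subspace_add[OF sU subspace_scale[OF sU U(2)] subspace_scale[OF sU v]])
    moreover have "x *\<^sub>R u - y *\<^sub>R (x *\<^sub>R b - y *\<^sub>R a) = (x\<^sup>2 + y\<^sup>2) *\<^sub>R a"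
      "y *\<^sub>R u + x *\<^sub>R (x *\<^sub>R b - y *\<^sub>R a) = (x\<^sup>2 + y\<^sup>2) *\<^sub>R b"
      unfolding u by (simp_all add: algebra_simps power2_eq_square)
    moreover have "x\<^sup>2 + y\<^sup>2 \<noteq> 0" using U(4) unfolding u by (auto simp: sum_power2_eq_zero_iff)
    ultimately have "a \<in> U" "b \<in> U"
      using subspace_scale[OF sU, of _ "1 / (x\<^sup>2 + y\<^sup>2)"] by fastforce+
    thus ?thesis unfolding V using gen[OF U(1)] sU by (intro span_minimal)
  qed
  fix U assume "U \<subseteq> V \<and> inv_subspace U"
  hence U: "U \<subseteq> V" "inv_subspace U" by auto
  note sU = invariant_subspaceD(1)[OF U(2)] and sV = invariant_subspaceD(1)[OF inv]
  define C where "C = {x. \<forall>u\<in>U. x \<bullet> u = 0}"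
  have C: "inv_subspace C" unfolding C_def by (rule inv_subspace_orthogonal[OF U(2)])
  obtain p w where "p \<in> span U" and "\<And>u. u \<in> span U \<Longrightarrow> orthogonal w u" and a: "a = p + w"
    using orthogonal_subspace_decomp_exists[of U a] by metis
  hence p: "p \<in> U" and w: "w \<in> C"
    using sU by (auto simp: span_eq_iff[THEN iffD2] C_def orthogonal_def)
  have "p \<in> V" "w \<in> V"
    using p U(1) a aV subspace_diff[OF sV, of a p] by auto
  \<comment> \<open>Up to sign, one vector lies both in \<open>U\<close> and in its orthogonal
    complement \<open>C\<close>, so it is zero.\<close>
  have pw: "H (H p) + (k\<^sup>2) *\<^sub>R p = - (H (H w) + (k\<^sup>2) *\<^sub>R w)"
    using HH(1) unfolding a Hlin eq_neg_iff_add_eq_0 by (simp add: algebra_simps eq_neg_iff_add_eq_0)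
  have "H (H p) + (k\<^sup>2) *\<^sub>R p \<in> U" "H (H w) + (k\<^sup>2) *\<^sub>R w \<in> C"
    using p w U(2) C
    by (auto intro!: subspace_add subspace_scale H_inv sU invariant_subspaceD(1))
  hence "(H (H w) + (k\<^sup>2) *\<^sub>R w) \<bullet> (H (H p) + (k\<^sup>2) *\<^sub>R p) = 0"
    unfolding C_def by blast
  hence "H (H p) + (k\<^sup>2) *\<^sub>R p = 0"
    unfolding pw by (simp only: inner_minus_right neg_equal_0_iff_equal inner_eq_zero_iff)
  moreover from this have "H (H w) + (k\<^sup>2) *\<^sub>R w = 0"
    using pw by (metis neg_equal_0_iff_equal)
  ultimately have "p \<in> span {a, b}" "w \<in> span {a, b}"
    using \<open>p \<in> V\<close> \<open>w \<in> V\<close> by (auto intro!: plane simp: eq_neg_iff_add_eq_0)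
  show "U = {0} \<or> U = V"
  proof (cases "p = 0")
    case True
    hence "w \<noteq> 0" using a ab by auto
    hence "V \<subseteq> C" using full[OF C w] \<open>w \<in> span {a, b}\<close> by blast
    hence "u \<bullet> u = 0" if "u \<in> U" for u using U(1) that unfolding C_def by blast
    hence "U \<subseteq> {0}" by auto
    thus ?thesis using subspace_0[OF sU] by auto
  next
    case False
    thus ?thesis using full[OF U(2) p] \<open>p \<in> span {a, b}\<close> U(1) by blast
  qed
qed

end

section \<open>Direct sums\<close>

definition sum_space :: "'v::real_vector set list \<Rightarrow> 'v set" where
  "sum_space Us = {sum_list us | us. list_all2 (\<in>) us Us}"

lemma sum_space_Nil: "sum_space [] = {0}"
  by (simp add: sum_space_def)

lemma sum_space_Cons: "sum_space (U # Us) = {x + y | x y. x \<in> U \<and> y \<in> sum_space Us}"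
proof
  show "sum_space (U # Us) \<subseteq> {x + y | x y. x \<in> U \<and> y \<in> sum_space Us}"
    by (auto simp: sum_space_def list_all2_Cons2) blast
  show "{x + y | x y. x \<in> U \<and> y \<in> sum_space Us} \<subseteq> sum_space (U # Us)"
  proof safe
    fix x y assume "x \<in> U" "y \<in> sum_space Us"
    then obtain us where "list_all2 (\<in>) us Us" "y = sum_list us" by (auto simp: sum_space_def)
    hence "list_all2 (\<in>) (x # us) (U # Us)" "x + y = sum_list (x # us)" using \<open>x \<in> U\<close> by auto
    thus "x + y \<in> sum_space (U # Us)" unfolding sum_space_def by blast
  qed
qed

lemma subspace_sum_space: "(\<And>U. U \<in> set Us \<Longrightarrow> subspace U) \<Longrightarrow> subspace (sum_space Us)"
  by (induction Us) (auto simp: sum_space_Nil sum_space_Cons subspace_sums)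

lemma dim_sum_space:
  fixes Us :: "'v::euclidean_space set list"
  assumes "\<And>U. U \<in> set Us \<Longrightarrow> subspace U"
    and "\<And>us. list_all2 (\<in>) us Us \<Longrightarrow> sum_list us = 0 \<Longrightarrow> set us \<subseteq> {0}"
  shows "dim (sum_space Us) = sum_list (map dim Us)"
  using assms
proof (induction Us)
  case (Cons U Us)
  have IH: "dim (sum_space Us) = sum_list (map dim Us)"
  proof (rule Cons.IH)
    show "subspace V" if "V \<in> set Us" for V using Cons.prems that by auto
    fix us assume "list_all2 (\<in>) us Us" "sum_list us = 0"
    hence "list_all2 (\<in>) (0 # us) (U # Us)" "sum_list (0 # us) = 0"
      using Cons.prems(1)[of U] by (auto simp: subspace_0)
    from Cons.prems(2)[OF this] show "set us \<subseteq> {0}" by simp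
  qed
  have "U \<inter> sum_space Us \<subseteq> {0}"
  proof
    fix x assume "x \<in> U \<inter> sum_space Us"
    then obtain us where us: "x \<in> U" "list_all2 (\<in>) us Us" "x = sum_list us"
      by (auto simp: sum_space_def)
    hence "list_all2 (\<in>) (- x # us) (U # Us)" "sum_list (- x # us) = 0"
      using Cons.prems(1)[of U] by (auto simp: subspace_neg)
    from Cons.prems(2)[OF this] show "x \<in> {0}" by simp
  qed
  hence 0: "dim (U \<inter> sum_space Us) = 0" by simp
  have "dim {x + y | x y. x \<in> U \<and> y \<in> sum_space Us} + dim (U \<inter> sum_space Us) = dim U + dim (sum_space Us)"
    using Cons.prems(1) by (intro dim_sums_Int subspace_sum_space) auto
  thus ?case unfolding sum_space_Cons 0 IH by simp
qed (simp add: sum_space_Nil)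

text \<open>Independence fixes the dimension of the sum, and the bound on \<open>dim V\<close> makes
  the sum fill \<open>V\<close>. Two decompositions of one vector differ by a decomposition of
  zero.\<close>

lemma is_direct_sumI:
  fixes Us :: "'v::euclidean_space set list"
  assumes V: "subspace V" and Us: "\<And>U. U \<in> set Us \<Longrightarrow> subspace U" "\<And>U. U \<in> set Us \<Longrightarrow> U \<subseteq> V"
    and ind: "\<And>us. list_all2 (\<in>) us Us \<Longrightarrow> sum_list us = 0 \<Longrightarrow> set us \<subseteq> {0}"
    and dim: "dim V \<le> sum_list (map dim Us)"
  shows "is_direct_sum V Us"
proof -
  have "sum_space Us \<subseteq> V" using Us(2)
    by (induction Us) (auto simp: sum_space_Nil sum_space_Cons subspace_0[OF V] intro!: subspace_add[OF V])
  hence eq: "V = sum_space Us"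
    using dim V subspace_sum_space[OF Us(1)] dim_sum_space[OF Us(1) ind] by (metis subspace_dim_equal)
  have "\<exists>!us. list_all2 (\<in>) us Us \<and> v = sum_list us" if "v \<in> V" for v
  proof -
    obtain us where us: "list_all2 (\<in>) us Us" "v = sum_list us"
      using \<open>v \<in> V\<close> unfolding eq sum_space_def by blast
    have "vs = us" if vs: "list_all2 (\<in>) vs Us" "v = sum_list vs" for vs
    proof -
      let ?d = "map2 (-) vs us"
      have l: "length vs = length us" using us vs by (metis list_all2_lengthD)
      have "list_all2 (\<in>) ?d Us"
        using us(1) vs(1) Us(1) by (auto simp: list_all2_conv_all_nth subspace_diff)
      moreover have "sum_list ?d = sum_list vs - sum_list us"
        using l by (induction vs us rule: list_induct2) auto
      ultimately have "set ?d \<subseteq> {0}" using us vs by (intro ind) auto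
      with l show "vs = us" by (induction vs us rule: list_induct2) auto
    qed
    thus ?thesis using us by blast
  qed
  thus ?thesis using V Us by (simp add: is_direct_sum_def)
qed

section \<open>The infinitesimal action\<close>

text \<open>The derivation of the exterior algebra that extends \<open>M\<close> on one-forms: the
  derivative at t = 0 of the action of exp (t M). \<open>der_tens\<close> is its extension to
  tensors by the Leibniz rule.\<close>

definition der_form :: "real^8^8 \<Rightarrow> form \<Rightarrow> form" where
  "der_form M \<alpha> = (\<Sum>i\<in>UNIV. form1 (M *v axis i 1) \<^bold>\<and> int_e i \<alpha>)"

definition der_tens :: "real^8^8 \<Rightarrow> tens \<Rightarrow> tens" where
  "der_tens M t = (\<Sum>i\<in>UNIV. (M *v axis i 1) \<otimes>\<^sub>t (t $ i) + axis i 1 \<otimes>\<^sub>t der_form M (t $ i))"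

lemma linear_der_form: "linear (der_form M)"
  by (rule linearI) (simp_all add: der_form_def int_e_lin
      wedge_lin sum.distrib scaleR_right.sum)

lemmas der_form_lin = linear_add[OF linear_der_form] linear_scale[OF linear_der_form]

lemma linear_der_tens: "linear (der_tens M)"
  by (rule linearI) (simp_all add: der_tens_def der_form_lin
      tensor_add_right tensor_scale_right sum.distrib scaleR_right.sum scaleR_right_distrib)

lemmas der_tens_lin = linear_add[OF linear_der_tens] linear_scale[OF linear_der_tens]

lemma matrix_vector_expand: "(M :: real^'n^'m) *v v = (\<Sum>i\<in>UNIV. v $ i *\<^sub>R (M *v axis i 1))"
  unfolding matrix_vector_mult_basis by (simp add: matrix_mult_sum scalar_mult_eq_scaleR)

lemma der_form_one [simp]: "der_form M (axis {} 1) = 0"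
  by (simp add: der_form_def int_e_axis)

lemma der_form_form1_wedge:
  "der_form M (form1 v \<^bold>\<and> \<alpha>) = form1 (M *v v) \<^bold>\<and> \<alpha> + form1 v \<^bold>\<and> der_form M \<alpha>"
proof -
  have i: "int_e i (form1 v \<^bold>\<and> \<alpha>) = v $ i *\<^sub>R \<alpha> - form1 v \<^bold>\<and> int_e i \<alpha>" for i
    using int_v_wedge[of "axis i 1" v \<alpha>] by (simp add: inner_axis')
  have "der_form M (form1 v \<^bold>\<and> \<alpha>) =
      (\<Sum>i\<in>UNIV. v $ i *\<^sub>R (form1 (M *v axis i 1) \<^bold>\<and> \<alpha>)) +
      (\<Sum>i\<in>UNIV. form1 v \<^bold>\<and> form1 (M *v axis i 1) \<^bold>\<and> int_e i \<alpha>)"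
    unfolding der_form_def i sum.distrib[symmetric]
    by (intro sum.cong refl)
       (simp add: wedge_diff_right wedge_scale_right form1_swap[of "M *v axis _ 1" v])
  also have "(\<Sum>i\<in>UNIV. v $ i *\<^sub>R (form1 (M *v axis i 1) \<^bold>\<and> \<alpha>)) = form1 (M *v v) \<^bold>\<and> \<alpha>"
    unfolding matrix_vector_expand[of M v] linear_sum[OF linear_form1] linear_scale[OF linear_form1]
      wedge_sum_left wedge_scale_left ..
  finally show ?thesis by (simp add: der_form_def wedge_sum_right)
qed

lemma der_tens_tensor:
  "der_tens M (X \<otimes>\<^sub>t \<alpha>) = (M *v X) \<otimes>\<^sub>t \<alpha> + X \<otimes>\<^sub>t der_form M \<alpha>"
proof -
  have l: "linear (\<lambda>X. X \<otimes>\<^sub>t \<beta>)" for \<beta>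
    by (rule linearI) (simp_all add: tensor_add_left tensor_scale_left)
  have "der_tens M (X \<otimes>\<^sub>t \<alpha>) = (\<Sum>i\<in>UNIV. X $ i *\<^sub>R ((M *v axis i 1) \<otimes>\<^sub>t \<alpha>)) +
      (\<Sum>i\<in>UNIV. axis i 1 \<otimes>\<^sub>t (X \<otimes>\<^sub>t der_form M \<alpha>) $ i)"
    unfolding der_tens_def sum.distrib
    by (simp add: tensor_def[of X] linear_scale[OF linear_der_form] tensor_scale_right)
  also have "(\<Sum>i\<in>UNIV. X $ i *\<^sub>R ((M *v axis i 1) \<otimes>\<^sub>t \<alpha>)) = (M *v X) \<otimes>\<^sub>t \<alpha>"
    unfolding matrix_vector_expand[of M X] linear_sum[OF l] linear_scale[OF l] ..
  finally show ?thesis by (simp flip: tens_expand)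
qed

lemma matrix_vector_minus: "(- A) *v x = - (A *v (x :: real^'n))"
  by (simp add: matrix_vector_mult_def vec_eq_iff sum_negf)

lemma skew_matrix_inner:
  fixes M :: "real^'n^'n"
  assumes "transpose M = - M"
  shows "(M *v x) \<bullet> y = - (x \<bullet> (M *v y))"
proof -
  have "(transpose M *v x) \<bullet> y = x \<bullet> (M *v y)"
    by (simp add: transpose_matrix_vector dot_lmul_matrix)
  thus ?thesis by (simp add: assms matrix_vector_minus)
qed

lemma der_form_skew:
  assumes "transpose M = - M"
  shows "der_form M \<alpha> \<bullet> \<beta> = - (\<alpha> \<bullet> der_form M \<beta>)"
proof -
  have e: "int_v (M *v axis i 1) \<beta> = (\<Sum>k\<in>UNIV. M $ k $ i *\<^sub>R int_e k \<beta>)" for i \<beta>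
    by (simp add: int_v_def matrix_vector_mult_basis column_def)
  have M: "M $ k $ i = - M $ i $ k" for i k
    using arg_cong[OF assms, of "\<lambda>N. N $ i $ k"] by (simp add: transpose_def)
  have D: "der_form M \<alpha> \<bullet> \<beta> = (\<Sum>i\<in>UNIV. \<Sum>k\<in>UNIV. M $ k $ i * (int_e i \<alpha> \<bullet> int_e k \<beta>))" for \<alpha> \<beta>
    by (simp add: der_form_def inner_sum_left form1_wedge_adjoint e inner_sum_right)
  note D[of \<alpha> \<beta>]
  also have "(\<Sum>i\<in>UNIV. \<Sum>k\<in>UNIV. M $ k $ i * (int_e i \<alpha> \<bullet> int_e k \<beta>)) =
      (\<Sum>k\<in>UNIV. \<Sum>i\<in>UNIV. M $ k $ i * (int_e i \<alpha> \<bullet> int_e k \<beta>))"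
    by (rule sum.swap)
  also have "\<dots> = - (\<Sum>k\<in>UNIV. \<Sum>i\<in>UNIV. M $ i $ k * (int_e i \<alpha> \<bullet> int_e k \<beta>))"
    unfolding sum_negf[symmetric] by (intro sum.cong refl, subst M, simp)
  also have "(\<Sum>k\<in>UNIV. \<Sum>i\<in>UNIV. M $ i $ k * (int_e i \<alpha> \<bullet> int_e k \<beta>)) = der_form M \<beta> \<bullet> \<alpha>"
    unfolding D by (intro sum.cong refl) (simp add: inner_commute)
  finally show ?thesis by (simp add: inner_commute)
qed

lemma der_tens_skew:
  assumes "transpose M = - M"
  shows "der_tens M s \<bullet> t = - (s \<bullet> der_tens M t)"
proof -
  have 1: "der_tens M s \<bullet> (X \<otimes>\<^sub>t \<alpha>) = - (s \<bullet> der_tens M (X \<otimes>\<^sub>t \<alpha>))" for X \<alpha>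
    by (rule linear_eq_tensor[of "\<lambda>s. der_tens M s \<bullet> (X \<otimes>\<^sub>t \<alpha>)" "\<lambda>s. - (s \<bullet> der_tens M (X \<otimes>\<^sub>t \<alpha>))"])
       (auto simp: der_tens_lin inner_add_left inner_add_right
         der_tens_tensor tensor_inner skew_matrix_inner[OF assms] der_form_skew[OF assms] algebra_simps intro!: linearI)
  show ?thesis
    by (rule linear_eq_tensor[of "\<lambda>t. der_tens M s \<bullet> t" "\<lambda>t. - (s \<bullet> der_tens M t)"])
       (auto simp: der_tens_lin inner_add_right 1 intro!: linearI)
qed

section \<open>One-parameter groups and their derivatives\<close>

lemma bounded_bilinear_wedge: "bounded_bilinear (\<^bold>\<and>)"
  using bilinear_wedge bilinear_conv_bounded_bilinear by blast

lemma bounded_bilinear_tensor: "bounded_bilinear (\<otimes>\<^sub>t)"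
proof -
  have "bilinear (\<otimes>\<^sub>t)"
    unfolding bilinear_def
    by (auto intro!: linearI simp: tensor_add_left tensor_scale_left tensor_add_right tensor_scale_right)
  thus ?thesis by (simp add: bilinear_conv_bounded_bilinear)
qed

lemma bounded_linear_matrix_vector: "bounded_linear (\<lambda>A :: real^'n^'m. A *v x)"
  by (intro linear_conv_bounded_linear[THEN iffD1] linearI)
     (simp_all add: matrix_vector_mult_add_rdistrib scaleR_matrix_vector_assoc)

text \<open>\<open>A t\<close> stands for exp (t M), given through its differential equation so that
  any explicit solution can be plugged in.\<close>

locale flow =
  fixes M :: "real^8^8" and A :: "real \<Rightarrow> real^8^8"
  assumes A0: "A 0 = mat 1"
    and A': "(A has_vector_derivative M ** A t) (at t)"
begin

lemma vector: "((\<lambda>t. A t *v x) has_vector_derivative M *v (A t *v x)) (at t)"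
  using bounded_linear.has_vector_derivative[OF bounded_linear_matrix_vector A']
  by (simp add: matrix_vector_mul_assoc)

lemma form: "((\<lambda>t. act_form (A t) \<alpha>) has_vector_derivative der_form M (act_form (A t) \<alpha>)) (at t)"
proof (rule form_induct[where P = "\<lambda>\<alpha>. ((\<lambda>t. act_form (A t) \<alpha>) has_vector_derivative der_form M (act_form (A t) \<alpha>)) (at t)"])
  show "subspace {\<alpha>. ((\<lambda>t. act_form (A t) \<alpha>) has_vector_derivative der_form M (act_form (A t) \<alpha>)) (at t)}"
    by (auto simp: subspace_def linear_0[OF linear_act_form] act_form_lin
        linear_0[OF linear_der_form] der_form_lin
        intro!: derivative_eq_intros)
  fix v \<alpha> assume IH: "((\<lambda>t. act_form (A t) \<alpha>) has_vector_derivative der_form M (act_form (A t) \<alpha>)) (at t)"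
  have "((\<lambda>t. form1 (A t *v v)) has_vector_derivative form1 (M *v (A t *v v))) (at t)"
    by (intro bounded_linear.has_vector_derivative[OF linear_conv_bounded_linear[THEN iffD1, OF linear_form1]] vector)
  from bounded_bilinear.has_vector_derivative[OF bounded_bilinear_wedge this IH]
  show "((\<lambda>t. act_form (A t) (form1 v \<^bold>\<and> \<alpha>)) has_vector_derivative der_form M (act_form (A t) (form1 v \<^bold>\<and> \<alpha>))) (at t)"
    by (simp add: act_form_form1_wedge der_form_form1_wedge add.commute)
qed simp

lemma tens: "((\<lambda>t. act_tens (A t) s) has_vector_derivative der_tens M (act_tens (A t) s)) (at t)"
proof -
  have "((\<lambda>t. act_tens (A t) (X \<otimes>\<^sub>t \<alpha>)) has_vector_derivative der_tens M (act_tens (A t) (X \<otimes>\<^sub>t \<alpha>))) (at t)" for X \<alpha>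
    using bounded_bilinear.has_vector_derivative[OF bounded_bilinear_tensor vector[of X t] form[of \<alpha> t]]
    by (simp add: act_tens_tensor der_tens_tensor add.commute)
  hence "((\<lambda>t. \<Sum>i\<in>UNIV. act_tens (A t) (axis i 1 \<otimes>\<^sub>t s $ i)) has_vector_derivative
      (\<Sum>i\<in>UNIV. der_tens M (act_tens (A t) (axis i 1 \<otimes>\<^sub>t s $ i)))) (at t)"
    by (intro has_vector_derivative_sum)
  thus ?thesis
    by (simp flip: linear_sum[OF linear_act_tens] linear_sum[OF linear_der_tens] tens_expand)
qed

end

text \<open>Split the derivative along \<open>U\<close>. The curve has constant product zero with
  the normal part \<open>w\<close>, so the derivative is orthogonal to \<open>w\<close>, which
  forces \<open>w = 0\<close>.\<close>

lemma derivative_in_subspace: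
  fixes f :: "real \<Rightarrow> 'a::euclidean_space"
  assumes "(f has_vector_derivative f') (at t)" "subspace U" "\<And>t. f t \<in> U"
  shows "f' \<in> U"
proof -
  obtain y w where "y \<in> span U" and w: "\<And>u. u \<in> span U \<Longrightarrow> orthogonal w u" and f': "f' = y + w"
    using orthogonal_subspace_decomp_exists[of U f'] by metis
  hence y: "y \<in> U" using assms(2) by (simp add: span_eq_iff[THEN iffD2])
  have 0: "f t \<bullet> w = 0" for t
    using w[OF span_base[OF assms(3)]] by (simp add: orthogonal_def inner_commute)
  have "((\<lambda>t. f t \<bullet> w) has_vector_derivative f' \<bullet> w) (at t)"
    by (rule bounded_linear.has_vector_derivative[OF bounded_linear_inner_left assms(1)])
  hence "f' \<bullet> w = 0"
    unfolding 0 using vector_derivative_unique_at has_vector_derivative_const by blast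
  moreover have "y \<bullet> w = 0" using w[OF span_base[OF y]] by (simp add: orthogonal_def inner_commute)
  ultimately show ?thesis using y by (simp add: f' inner_add_left)
qed

text \<open>A skew equation conserves the squared norm, so a solution starting at zero stays
  there.\<close>

lemma skew_flow_unique:
  fixes f :: "real \<Rightarrow> 'a::real_inner"
  assumes "\<And>t. (f has_vector_derivative D (f t)) (at t)" "\<And>x. D x \<bullet> x = 0" "f 0 = 0"
  shows "f t = 0"
proof -
  have "((\<lambda>t. f t \<bullet> f t) has_real_derivative 0) (at t)" for t
    using bounded_bilinear.has_vector_derivative[OF bounded_bilinear_inner assms(1) assms(1), of t] assms(2)[of "f t"]
    by (simp add: has_real_derivative_iff_has_vector_derivative inner_commute)
  hence "f t \<bullet> f t = f 0 \<bullet> f 0"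
    by (rule DERIV_isconst_all[rule_format])
  thus ?thesis using assms(3) by simp
qed

locale skew_flow = flow +
  assumes skew: "transpose M = - M" and rho: "der_form M rho = 0"
begin

lemma orthogonal: "orthogonal_matrix (A t)"
proof -
  have "((\<lambda>t. (A t *v x) \<bullet> (A t *v y)) has_real_derivative 0) (at t)" for x y t
    using bounded_bilinear.has_vector_derivative[OF bounded_bilinear_inner vector[of x t] vector[of y t]]
    by (simp add: has_real_derivative_iff_has_vector_derivative skew_matrix_inner[OF skew])
  hence "(A t *v x) \<bullet> (A t *v y) = (A 0 *v x) \<bullet> (A 0 *v y)" for x y
    by (rule DERIV_isconst_all[rule_format])
  hence "orthogonal_transformation ((*v) (A t))"
    by (simp add: orthogonal_transformation_def A0)
  thus ?thesis by (simp add: orthogonal_transformation_matrix)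
qed

text \<open>The determinant is continuous, takes only the values 1 and -1, and starts at 1; reaching
  -1 would force it through 0.\<close>

lemma det: "det (A t) = 1"
proof -
  have "continuous_on UNIV A"
    using A' by (auto simp: continuous_on_eq_continuous_within intro: has_vector_derivative_continuous)
  hence c: "continuous_on UNIV (\<lambda>t. det (A t))"
    unfolding det_def by (intro continuous_intros)
  have pm: "det (A t) = 1 \<or> det (A t) = -1" for t
    by (rule det_orthogonal_matrix[OF orthogonal])
  have "is_interval (range (\<lambda>t. det (A t)))"
    by (intro is_interval_connected_1[THEN iffD2] connected_continuous_image c connected_UNIV)
  moreover have "det (A 0) = 1" by (simp add: A0)
  ultimately have "0 \<in> range (\<lambda>t. det (A t))" if "det (A t) = -1"
    using that mem_is_interval_1_I[OF _ rangeI[of "\<lambda>t. det (A t)" t] rangeI[of "\<lambda>t. det (A t)" 0], of 0]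
    by simp
  then obtain s where "det (A s) = 0" if "det (A t) = -1" by fastforce
  thus ?thesis using pm[of s] pm[of t] by fastforce
qed

text \<open>Because the derivation kills \<open>rho\<close>, the defect of \<open>rho\<close> under
  \<open>A t\<close> solves the same skew linear equation with initial value zero.\<close>

lemma PSU3: "A t \<in> PSU3"
proof -
  have "act_form (A t) rho - rho = 0"
  proof (rule skew_flow_unique[where D = "der_form M"])
    show "((\<lambda>t. act_form (A t) rho - rho) has_vector_derivative der_form M (act_form (A t) rho - rho)) (at t)" for t
      using form[of rho t] by (auto simp: linear_diff[OF linear_der_form] rho intro!: derivative_eq_intros)
    show "der_form M x \<bullet> x = 0" for x
      using der_form_skew[OF skew, of x x] by (simp add: inner_commute)
  qed (simp add: A0)
  thus ?thesis by (simp add: PSU3_def SO8_def orthogonal det)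
qed

lemma der_form_invariant:
  assumes "invariant_subspace PSU3 act_form U" "u \<in> U"
  shows "der_form M u \<in> U"
  using derivative_in_subspace[OF form[of u 0] invariant_subspaceD(1)[OF assms(1)]]
    invariant_subspaceD(2)[OF assms(1) PSU3 assms(2)] by (simp add: A0)

lemma der_tens_invariant:
  assumes "invariant_subspace PSU3 act_tens U" "u \<in> U"
  shows "der_tens M u \<in> U"
  using derivative_in_subspace[OF tens[of u 0] invariant_subspaceD(1)[OF assms(1)]]
    invariant_subspaceD(2)[OF assms(1) PSU3 assms(2)] by (simp add: A0)

end

text \<open>
  A skew matrix with eigenvalues in \<open>{0, \<plusminus>i, \<plusminus>2i}\<close> generates the one-parameter group
  \<open>exp (t M)\<close>, which is obtained by interpolating the exponential function on the spectrum.
\<close>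

lemma quintic_flow:
  fixes M :: "real^8^8"
  assumes "M ** M ** M ** M ** M = - 5 *\<^sub>R (M ** M ** M) - 4 *\<^sub>R M"
  shows "\<exists>A. flow M A"
proof
  \<comment> \<open>Write exp (t M) as a polynomial of degree 4 in M. Reducing M^5 gives the system
    a1' = 1 - 4 a4, a2' = a1, a3' = a2 - 5 a4, a4' = a3 with zero initial values, which these
    functions solve.\<close>
  define a3 where "a3 t = (2 * sin t - sin (2 * t)) / 6" for t :: real
  define a4 where "a4 t = (cos (2 * t) - 4 * cos t + 3) / 12" for t :: real
  define a1 where "a1 t = sin t + a3 t" for t
  define a2 where "a2 t = a4 t + 1 - cos t" for t
  let ?A = "\<lambda>t. mat 1 + a1 t *\<^sub>R M + a2 t *\<^sub>R (M ** M) + a3 t *\<^sub>R (M ** M ** M) + a4 t *\<^sub>R (M ** M ** M ** M)"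
  have d4: "(a4 has_real_derivative a3 t) (at t)" for t
    unfolding a3_def a4_def by (auto intro!: derivative_eq_intros simp: field_simps)
  have d3: "(a3 has_real_derivative a2 t - 5 * a4 t) (at t)" for t
    unfolding a2_def a3_def a4_def by (auto intro!: derivative_eq_intros simp: field_simps)
  have d2: "(a2 has_real_derivative a1 t) (at t)" for t
    unfolding a1_def a2_def using d4 by (auto intro!: derivative_eq_intros)
  have d1: "(a1 has_real_derivative 1 - 4 * a4 t) (at t)" for t
    unfolding a1_def using d3[of t] by (auto intro!: derivative_eq_intros simp: a2_def)
  have scale: "M ** (c *\<^sub>R B) = c *\<^sub>R (M ** B)" for c and B :: "real^8^8"
    by (simp add: matrix_matrix_mult_def vec_eq_iff sum_distrib_left mult_ac)
  show "flow M ?A"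
  proof
    show "?A 0 = mat 1" by (simp add: a1_def a2_def a3_def a4_def)
    fix t
    have "(?A has_vector_derivative (1 - 4 * a4 t) *\<^sub>R M + a1 t *\<^sub>R (M ** M) + (a2 t - 5 * a4 t) *\<^sub>R (M ** M ** M)
        + a3 t *\<^sub>R (M ** M ** M ** M)) (at t)"
      using d1[of t] d2[of t] d3[of t] d4[of t]
      by (auto intro!: derivative_eq_intros simp: has_real_derivative_iff_has_vector_derivative)
    moreover have "M ** ?A t = M + a1 t *\<^sub>R (M ** M) + a2 t *\<^sub>R (M ** M ** M) + a3 t *\<^sub>R (M ** M ** M ** M)
        + a4 t *\<^sub>R (M ** M ** M ** M ** M)"
      by (simp add: matrix_add_ldistrib scale matrix_mul_assoc)
    moreover have "\<dots> = (1 - 4 * a4 t) *\<^sub>R M + a1 t *\<^sub>R (M ** M) + (a2 t - 5 * a4 t) *\<^sub>R (M ** M ** M)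
        + a3 t *\<^sub>R (M ** M ** M ** M)"
      unfolding assms by (simp add: algebra_simps)
    ultimately show "(?A has_vector_derivative M ** ?A t) (at t)" by (simp only:)
  qed
qed

section \<open>Integral computations\<close>

text \<open>A copy of the index type with constructors, so that evaluation proceeds by pattern
  matching instead of arithmetic modulo 8.\<close>

datatype ix = I1 | I2 | I3 | I4 | I5 | I6 | I7 | I8

fun lt :: "ix \<Rightarrow> ix \<Rightarrow> bool" where
  "lt I1 j \<longleftrightarrow> j \<noteq> I1"
| "lt I2 j \<longleftrightarrow> j \<noteq> I1 \<and> j \<noteq> I2"
| "lt I3 j \<longleftrightarrow> j \<noteq> I1 \<and> j \<noteq> I2 \<and> j \<noteq> I3"
| "lt I4 j \<longleftrightarrow> j = I5 \<or> j = I6 \<or> j = I7 \<or> j = I8"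
| "lt I5 j \<longleftrightarrow> j = I6 \<or> j = I7 \<or> j = I8"
| "lt I6 j \<longleftrightarrow> j = I7 \<or> j = I8"
| "lt I7 j \<longleftrightarrow> j = I8"
| "lt I8 j \<longleftrightarrow> False"

fun pos :: "ix \<Rightarrow> nat" where
  "pos I1 = 0" | "pos I2 = 1" | "pos I3 = 2" | "pos I4 = 3"
| "pos I5 = 4" | "pos I6 = 5" | "pos I7 = 6" | "pos I8 = 7"

definition idx :: "ix \<Rightarrow> 8" where "idx i = of_nat (pos i)"

lemma idx_less: "lt i j \<Longrightarrow> idx i < idx j"
  unfolding idx_def by (rule of_nat_8_less) (cases i; cases j; simp)+

lemma lt_cases: "i = j \<or> lt i j \<or> lt j i"
  by (cases i; cases j; simp)

lemma lt_trans: "lt i j \<Longrightarrow> lt j k \<Longrightarrow> lt i k"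
  by (cases i; cases j; simp; cases k; simp)

lemma inj_idx: "inj idx"
  using lt_cases idx_less by (metis injI less_irrefl)

lemma UNIV_ix: "UNIV = {I1, I2, I3, I4, I5, I6, I7, I8}"
  using ix.exhaust by auto

instance ix :: finite
  by standard (simp add: UNIV_ix)

lemma range_idx: "range idx = UNIV"
proof (rule card_subset_eq)
  have "card (UNIV :: ix set) = 8" by (simp add: UNIV_ix)
  thus "card (range idx) = card (UNIV :: 8 set)"
    using inj_idx by (simp add: card_image)
qed auto

lemma sum_idx: "(\<Sum>i\<in>UNIV. f i) = (\<Sum>i\<in>UNIV. f (idx i))"
  using sum.reindex[OF inj_idx, of f] by (simp add: range_idx)

text \<open>
  With respect to the orthogonal basis \<open>e\<^sub>1, \<dots>, e\<^sub>7, e\<^sub>8 / \<surd>3\<close> the structure constants of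
  the Lie algebra defined by \<open>rho\<close> are integers.
\<close>

definition bv_scale :: "ix \<Rightarrow> real" where
  "bv_scale i = (if i = I8 then 1 / sqrt 3 else 1)"

definition bv :: "ix \<Rightarrow> real^8" where
  "bv i = bv_scale i *\<^sub>R axis (idx i) 1"

lemma bv_scale_pos: "bv_scale i > 0"
  by (simp add: bv_scale_def)

text \<open>Three times the squared length of \<open>bv i\<close>; the factor three keeps it
  integral.\<close>

definition norm3 :: "ix \<Rightarrow> int" where
  "norm3 i = (if i = I8 then 1 else 3)"

lemma bv_scale_square: "bv_scale i * bv_scale i = norm3 i / 3"
  by (simp add: bv_scale_def norm3_def)

lemma bv_inner: "bv i \<bullet> bv j = (if i = j then norm3 i / 3 else 0)"
  using inj_idx by (auto simp: bv_def inner_axis_one bv_scale_square inj_def)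

type_synonym vec = "(ix list \<times> int) list"

text \<open>The list is a formal linear combination whose keys may repeat and need not be sorted;
  normalisation is left to \<open>vanish\<close>. The choice of \<open>b\<close> decides between
  forms and tensors.\<close>

definition ev :: "(ix list \<Rightarrow> 'v::real_vector) \<Rightarrow> vec \<Rightarrow> 'v" where
  "ev b v = sum_list (map (\<lambda>(k, c). of_int c *\<^sub>R b k) v)"

fun scl :: "int \<Rightarrow> vec \<Rightarrow> vec" where
  "scl a [] = []"
| "scl a ((k, c) # v) = (k, a * c) # scl a v"

fun cons_key :: "ix \<Rightarrow> vec \<Rightarrow> vec" where
  "cons_key i [] = []"
| "cons_key i ((k, c) # v) = (i # k, c) # cons_key i v"

fun append_key :: "ix list \<Rightarrow> vec \<Rightarrow> vec" where
  "append_key l [] = []"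
| "append_key l ((k, c) # v) = (l @ k, c) # append_key l v"

fun wedgev :: "vec \<Rightarrow> vec \<Rightarrow> vec" where
  "wedgev [] v = []"
| "wedgev ((k, c) # u) v = scl c (append_key k v) @ wedgev u v"

fun lin :: "(ix list \<Rightarrow> vec) \<Rightarrow> vec \<Rightarrow> vec" where
  "lin f [] = []"
| "lin f ((k, c) # v) = scl c (f k) @ lin f v"

text \<open>The Leibniz rule on words. It does not see whether the first letter is a wedge factor or
  the tensor slot, so one function computes both \<open>der_form\<close> and
  \<open>der_tens\<close>.\<close>

fun derk :: "(ix \<Rightarrow> (ix \<times> int) list) \<Rightarrow> ix list \<Rightarrow> vec" where
  "derk M [] = []"
| "derk M (i # k) = map (\<lambda>(j, c). (j # k, c)) (M i) @ cons_key i (derk M k)"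

text \<open>Contraction by the dual basis, which stays integral. The factor
  \<open>norm3 j / 3\<close> that turns it into contraction by \<open>bv j\<close> is restored in
  \<open>ev_intk\<close>.\<close>

fun intk :: "ix \<Rightarrow> ix list \<Rightarrow> vec" where
  "intk j [] = []"
| "intk j (i # k) = (if i = j then [(k, 1)] else []) @ scl (-1) (cons_key i (intk j k))"

lemma ev_Nil [simp]: "ev b [] = 0"
  and ev_Cons [simp]: "ev b ((k, c) # v) = of_int c *\<^sub>R b k + ev b v"
  and ev_append [simp]: "ev b (u @ v) = ev b u + ev b v"
  by (simp_all add: ev_def)

lemma ev_scl [simp]: "ev b (scl a v) = of_int a *\<^sub>R ev b v"
  by (induction v) (auto simp: scaleR_right_distrib)

lemma ev_lin:
  assumes "linear T" "\<And>k. T (b k) = ev b' (f k)"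
  shows "ev b' (lin f v) = T (ev b v)"
  by (induction v) (auto simp: linear_0 linear_add linear_scale assms)

definition fb :: "ix list \<Rightarrow> form" where
  "fb k = wedge_list (map (\<lambda>i. form1 (bv i)) k)"

lemma fb_Nil [simp]: "fb [] = axis {} 1"
  and fb_Cons [simp]: "fb (i # k) = form1 (bv i) \<^bold>\<and> fb k"
  by (simp_all add: fb_def)

lemma fb_append: "fb (k @ l) = fb k \<^bold>\<and> fb l"
  by (induction k) (simp_all add: wedge_assoc)

lemma ev_cons_key: "ev fb (cons_key i v) = form1 (bv i) \<^bold>\<and> ev fb v"
  by (induction v) (auto simp: wedge_lin)

lemma ev_wedgev [simp]: "ev fb (wedgev u v) = ev fb u \<^bold>\<and> ev fb v"
proof -
  have "ev fb (append_key k v) = fb k \<^bold>\<and> ev fb v" for k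
    by (induction v) (auto simp: wedge_lin fb_append)
  thus ?thesis by (induction u) (auto simp: wedge_lin)
qed

text \<open>The first letter is the vector slot and the remaining word a wedge product. The empty
  word denotes no tensor; its value 0 agrees with the sign 0 given to it by
  \<open>tsrtk\<close>.\<close>

fun tb :: "ix list \<Rightarrow> tens" where
  "tb [] = 0"
| "tb (i # k) = bv i \<otimes>\<^sub>t fb k"

lemma ev_tb_cons_key: "ev tb (cons_key i v) = bv i \<otimes>\<^sub>t ev fb v"
  by (induction v) (auto simp: tensor_add_right tensor_scale_right tensor_def vec_eq_iff algebra_simps)

definition vecv :: "(ix \<times> int) list \<Rightarrow> real^8" where
  "vecv l = sum_list (map (\<lambda>(j, c). of_int c *\<^sub>R bv j) l)"

text \<open>The bracketed quotient is the coordinate of \<open>x\<close> along \<open>bv j\<close>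
  in this orthogonal, not orthonormal, basis.\<close>

definition mat_of :: "(ix \<Rightarrow> (ix \<times> int) list) \<Rightarrow> real^8^8" where
  "mat_of M = matrix (\<lambda>x. \<Sum>j\<in>UNIV. (3 * (x \<bullet> bv j) / norm3 j) *\<^sub>R vecv (M j))"

lemma norm3_pos: "norm3 i > 0"
  by (simp add: norm3_def)

lemma mat_of_bv: "mat_of M *v bv i = vecv (M i)"
proof -
  have "linear (\<lambda>x. \<Sum>j\<in>UNIV. (3 * (x \<bullet> bv j) / norm3 j) *\<^sub>R vecv (M j))"
    by (intro linearI) (simp_all add: inner_add_left algebra_simps add_divide_distrib sum.distrib scaleR_right.sum)
  hence "mat_of M *v bv i = (\<Sum>j\<in>UNIV. (3 * (bv i \<bullet> bv j) / norm3 j) *\<^sub>R vecv (M j))"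
    unfolding mat_of_def by (simp add: matrix_works)
  also have "\<dots> = (\<Sum>j\<in>UNIV. if j = i then vecv (M i) else 0)"
    using norm3_pos by (intro sum.cong refl) (auto simp: bv_inner less_imp_neq[symmetric])
  finally show ?thesis by simp
qed

lemma linear_eq_bv:
  assumes "linear f" "linear g" "\<And>i. f (bv i) = g (bv i)"
  shows "f (x :: real^8) = g x"
proof (rule linear_eq_axis[OF assms(1,2)])
  fix n :: 8
  obtain i where n: "n = idx i" using range_idx by blast
  have "axis n (1::real) = (1 / bv_scale i) *\<^sub>R bv i"
    using bv_scale_pos[of i] by (simp add: n bv_def)
  thus "f (axis n 1) = g (axis n 1)"
    using assms by (simp add: linear_scale)
qed

lemma matrix_eq_bv:
  fixes A B :: "real^8^8"
  assumes "\<And>i. A *v bv i = B *v bv i"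
  shows "A = B"
proof -
  have "A *v x = B *v x" for x
    by (rule linear_eq_bv[of "(*v) A" "(*v) B"]) (simp_all add: assms)
  thus ?thesis by (simp add: matrix_eq)
qed

lemma ev_derk: "ev fb (derk M k) = der_form (mat_of M) (fb k)"
proof (induction k)
  case (Cons i k)
  have "ev fb (map (\<lambda>(j, c). (j # k, c)) l) = form1 (vecv l) \<^bold>\<and> fb k" for l
    by (induction l) (auto simp: vecv_def wedge_lin form1_lin
        linear_0[OF linear_form1])
  thus ?case using Cons by (simp add: der_form_form1_wedge mat_of_bv ev_cons_key)
qed (simp add: linear_0)

lemma ev_tb_derk: "ev tb (derk M k) = der_tens (mat_of M) (tb k)"
proof (cases k)
  case Nil
  thus ?thesis by (simp add: linear_0[OF linear_der_tens])
next
  case (Cons i k)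
  have "ev tb (map (\<lambda>(j, c). (j # k, c)) l) = vecv l \<otimes>\<^sub>t fb k" for l
    by (induction l) (auto simp: vecv_def tensor_add_left tensor_scale_left tensor_def vec_eq_iff algebra_simps)
  thus ?thesis using Cons by (simp add: der_tens_tensor mat_of_bv ev_tb_cons_key ev_derk)
qed

lemma ev_intk: "int_v (bv j) (fb k) = (norm3 j / 3) *\<^sub>R ev fb (intk j k)"
proof (induction k)
  case (Cons i k)
  thus ?case
    by (auto simp: int_v_wedge bv_inner ev_cons_key wedge_scale_right scaleR_diff_right)
qed simp

subsection \<open>Normal forms\<close>

text \<open>Sign 0 records a repeated factor, the accompanying word being a dummy; the sign stays 0
  through all further insertions.\<close>

fun insk :: "ix \<Rightarrow> ix list \<Rightarrow> int \<times> ix list" where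
  "insk i [] = (1, [i])"
| "insk i (j # k) = (if i = j then (0, []) else if lt i j then (1, i # j # k)
     else (case insk i k of (s, l) \<Rightarrow> (- s, j # l)))"

fun srtk :: "ix list \<Rightarrow> int \<times> ix list" where
  "srtk [] = (1, [])"
| "srtk (i # k) = (case srtk k of (s, l) \<Rightarrow> (case insk i l of (s', l') \<Rightarrow> (s * s', l')))"

fun tsrtk :: "ix list \<Rightarrow> int \<times> ix list" where
  "tsrtk [] = (0, [])"
| "tsrtk (i # k) = (case srtk k of (s, l) \<Rightarrow> (s, i # l))"

lemma fb_insk: "form1 (bv i) \<^bold>\<and> fb k = of_int (fst (insk i k)) *\<^sub>R fb (snd (insk i k))"
proof (induction k)
  case (Cons j k)
  show ?case
  proof (cases "i = j")
    case False
    have "form1 (bv i) \<^bold>\<and> fb (j # k) = - (form1 (bv j) \<^bold>\<and> form1 (bv i) \<^bold>\<and> fb k)"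
      using form1_swap[of "bv i" "bv j" "fb k"] by simp
    thus ?thesis using Cons False by (auto simp: case_prod_unfold wedge_scale_right)
  qed simp
qed simp

lemma fb_srtk: "fb k = of_int (fst (srtk k)) *\<^sub>R fb (snd (srtk k))"
proof (induction k)
  case (Cons i k)
  have "fb (i # k) = of_int (fst (srtk k)) *\<^sub>R (form1 (bv i) \<^bold>\<and> fb (snd (srtk k)))"
    by (simp add: wedge_scale_right[symmetric] Cons[symmetric])
  thus ?case by (simp add: fb_insk case_prod_unfold)
qed simp

lemma tb_tsrtk: "tb k = of_int (fst (tsrtk k)) *\<^sub>R tb (snd (tsrtk k))"
proof (cases k)
  case (Cons i k)
  thus ?thesis using fb_srtk[of k] by (simp add: case_prod_unfold tensor_scale_right[symmetric])
qed simp

text \<open>Tries over \<^typ>\<open>ix list\<close> make the collection of terms fast.\<close>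

datatype 'a tr = E | N 'a "'a tr" "'a tr" "'a tr" "'a tr" "'a tr" "'a tr" "'a tr" "'a tr"

fun upd :: "('a \<Rightarrow> 'a) \<Rightarrow> 'a \<Rightarrow> ix list \<Rightarrow> 'a tr \<Rightarrow> 'a tr" where
  "upd f d [] E = N (f d) E E E E E E E E"
| "upd f d [] (N x t1 t2 t3 t4 t5 t6 t7 t8) = N (f x) t1 t2 t3 t4 t5 t6 t7 t8"
| "upd f d (I1 # k) E = N d (upd f d k E) E E E E E E E"
| "upd f d (I2 # k) E = N d E (upd f d k E) E E E E E E"
| "upd f d (I3 # k) E = N d E E (upd f d k E) E E E E E"
| "upd f d (I4 # k) E = N d E E E (upd f d k E) E E E E"
| "upd f d (I5 # k) E = N d E E E E (upd f d k E) E E E"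
| "upd f d (I6 # k) E = N d E E E E E (upd f d k E) E E"
| "upd f d (I7 # k) E = N d E E E E E E (upd f d k E) E"
| "upd f d (I8 # k) E = N d E E E E E E E (upd f d k E)"
| "upd f d (I1 # k) (N x t1 t2 t3 t4 t5 t6 t7 t8) = N x (upd f d k t1) t2 t3 t4 t5 t6 t7 t8"
| "upd f d (I2 # k) (N x t1 t2 t3 t4 t5 t6 t7 t8) = N x t1 (upd f d k t2) t3 t4 t5 t6 t7 t8"
| "upd f d (I3 # k) (N x t1 t2 t3 t4 t5 t6 t7 t8) = N x t1 t2 (upd f d k t3) t4 t5 t6 t7 t8"
| "upd f d (I4 # k) (N x t1 t2 t3 t4 t5 t6 t7 t8) = N x t1 t2 t3 (upd f d k t4) t5 t6 t7 t8"
| "upd f d (I5 # k) (N x t1 t2 t3 t4 t5 t6 t7 t8) = N x t1 t2 t3 t4 (upd f d k t5) t6 t7 t8"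
| "upd f d (I6 # k) (N x t1 t2 t3 t4 t5 t6 t7 t8) = N x t1 t2 t3 t4 t5 (upd f d k t6) t7 t8"
| "upd f d (I7 # k) (N x t1 t2 t3 t4 t5 t6 t7 t8) = N x t1 t2 t3 t4 t5 t6 (upd f d k t7) t8"
| "upd f d (I8 # k) (N x t1 t2 t3 t4 t5 t6 t7 t8) = N x t1 t2 t3 t4 t5 t6 t7 (upd f d k t8)"

fun look :: "'a \<Rightarrow> 'a tr \<Rightarrow> ix list \<Rightarrow> 'a" where
  "look d E k = d"
| "look d (N x t1 t2 t3 t4 t5 t6 t7 t8) [] = x"
| "look d (N x t1 t2 t3 t4 t5 t6 t7 t8) (I1 # k) = look d t1 k"
| "look d (N x t1 t2 t3 t4 t5 t6 t7 t8) (I2 # k) = look d t2 k"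
| "look d (N x t1 t2 t3 t4 t5 t6 t7 t8) (I3 # k) = look d t3 k"
| "look d (N x t1 t2 t3 t4 t5 t6 t7 t8) (I4 # k) = look d t4 k"
| "look d (N x t1 t2 t3 t4 t5 t6 t7 t8) (I5 # k) = look d t5 k"
| "look d (N x t1 t2 t3 t4 t5 t6 t7 t8) (I6 # k) = look d t6 k"
| "look d (N x t1 t2 t3 t4 t5 t6 t7 t8) (I7 # k) = look d t7 k"
| "look d (N x t1 t2 t3 t4 t5 t6 t7 t8) (I8 # k) = look d t8 k"

fun all_tr :: "('a \<Rightarrow> bool) \<Rightarrow> 'a tr \<Rightarrow> bool" where
  "all_tr P E \<longleftrightarrow> True"
| "all_tr P (N x t1 t2 t3 t4 t5 t6 t7 t8) \<longleftrightarrow> P x \<and> all_tr P t1 \<and> all_tr P t2 \<and> all_tr P t3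
     \<and> all_tr P t4 \<and> all_tr P t5 \<and> all_tr P t6 \<and> all_tr P t7 \<and> all_tr P t8"

lemma look_upd: "look d (upd f d k t) l = (if l = k then f (look d t k) else look d t l)"
  by (induction f d k t arbitrary: l rule: upd.induct; case_tac l; simp; case_tac a; simp)

lemma all_tr_look: "all_tr P t \<Longrightarrow> P d \<Longrightarrow> P (look d t k)"
  by (induction d t k rule: look.induct) auto

fun collect :: "(ix list \<Rightarrow> int \<times> ix list) \<Rightarrow> vec \<Rightarrow> int tr \<Rightarrow> int tr" where
  "collect nk [] t = t"
| "collect nk ((k, c) # v) t = (case nk k of (s, l) \<Rightarrow>
     collect nk v (if s = 0 then t else upd (\<lambda>x. x + s * c) 0 l t))"

definition vanish :: "(ix list \<Rightarrow> int \<times> ix list) \<Rightarrow> vec \<Rightarrow> bool" where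
  "vanish nk v \<longleftrightarrow> all_tr (\<lambda>x. x = 0) (collect nk v E)"

definition tr_keys :: "int tr \<Rightarrow> ix list set" where
  "tr_keys t = {k. look 0 t k \<noteq> 0}"

text \<open>The sums run over one fixed finite set \<open>K\<close> holding every normal key that
  can arise, so an update of the trie changes a single summand and never the index set.\<close>

lemma ev_collect:
  assumes "\<And>k. b k = of_int (fst (nk k)) *\<^sub>R b (snd (nk k))" "finite K" "tr_keys t \<subseteq> K"
    "\<And>k c. (k, c) \<in> set v \<Longrightarrow> fst (nk k) \<noteq> 0 \<Longrightarrow> snd (nk k) \<in> K"
  shows "(\<Sum>k\<in>K. of_int (look 0 (collect nk v t) k) *\<^sub>R b k) = (\<Sum>k\<in>K. of_int (look 0 t k) *\<^sub>R b k) + ev b v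
    \<and> tr_keys (collect nk v t) \<subseteq> K"
  using assms(3,4)
proof (induction v arbitrary: t)
  case (Cons kc v)
  obtain k c where kc: "kc = (k, c)" by (cases kc)
  obtain s l where sl: "nk k = (s, l)" by (cases "nk k")
  show ?case
  proof (cases "s = 0")
    case True
    hence "b k = 0" using assms(1)[of k] sl by simp
    moreover have "(\<Sum>k\<in>K. of_int (look 0 (collect nk v t) k) *\<^sub>R b k) = (\<Sum>k\<in>K. of_int (look 0 t k) *\<^sub>R b k) + ev b v
        \<and> tr_keys (collect nk v t) \<subseteq> K"
      using Cons.prems by (intro Cons.IH) auto
    ultimately show ?thesis using True by (simp add: kc sl)
  next
    case False
    hence l: "l \<in> K" using Cons.prems(2)[of k c] by (simp add: kc sl)
    let ?t = "upd (\<lambda>x. x + s * c) 0 l t"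
    have "tr_keys ?t \<subseteq> K"
      using Cons.prems(1) l by (auto simp: tr_keys_def look_upd split: if_splits)
    hence IH: "(\<Sum>k\<in>K. of_int (look 0 (collect nk v ?t) k) *\<^sub>R b k) = (\<Sum>k\<in>K. of_int (look 0 ?t k) *\<^sub>R b k) + ev b v
        \<and> tr_keys (collect nk v ?t) \<subseteq> K"
      using Cons.prems(2) by (intro Cons.IH) auto
    have "(\<Sum>k\<in>K. of_int (look 0 ?t k) *\<^sub>R b k) =
        (\<Sum>k\<in>K. of_int (look 0 t k) *\<^sub>R b k + (if k = l then of_int (s * c) *\<^sub>R b l else 0))"
      by (intro sum.cong refl) (auto simp: look_upd algebra_simps)
    also have "\<dots> = (\<Sum>k\<in>K. of_int (look 0 t k) *\<^sub>R b k) + of_int (s * c) *\<^sub>R b l"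
      using assms(2) l by (simp add: sum.distrib)
    also have "of_int (s * c) *\<^sub>R b l = of_int c *\<^sub>R b k"
      using assms(1)[of k] sl by (simp add: mult.commute)
    finally show ?thesis using IH False by (simp add: kc sl)
  qed
qed simp

lemma vanish_ev:
  assumes "\<And>k. b k = of_int (fst (nk k)) *\<^sub>R b (snd (nk k))" "vanish nk v"
  shows "ev b v = 0"
proof -
  let ?K = "(\<lambda>(k, c). snd (nk k)) ` set v"
  have "(\<Sum>k\<in>?K. of_int (look 0 (collect nk v E) k) *\<^sub>R b k) = (\<Sum>k\<in>?K. of_int (look 0 E k) *\<^sub>R b k) + ev b v"
  proof (rule ev_collect[THEN conjunct1])
    show "snd (nk k) \<in> ?K" if "(k, c) \<in> set v" for k c
      using that by (rule image_eqI[rotated]) simp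
  qed (rule assms(1), auto simp: tr_keys_def)
  moreover have "look 0 (collect nk v E) k = 0" for k
    using all_tr_look[of "\<lambda>x :: int. x = 0"] assms(2) by (simp add: vanish_def)
  ultimately show ?thesis by simp
qed

lemmas vanish_fb = vanish_ev[of fb srtk, OF fb_srtk]
lemmas vanish_tb = vanish_ev[of tb tsrtk, OF tb_tsrtk]

fun sortedk :: "ix list \<Rightarrow> bool" where
  "sortedk [] \<longleftrightarrow> True"
| "sortedk [i] \<longleftrightarrow> True"
| "sortedk (i # j # k) \<longleftrightarrow> lt i j \<and> sortedk (j # k)"

definition key_scale :: "ix list \<Rightarrow> real" where
  "key_scale k = prod_list (map bv_scale k)"

lemma key_scale_pos: "key_scale k > 0"
  by (induction k) (auto simp: key_scale_def bv_scale_pos)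

lemma sortedk_lt: "sortedk (i # k) \<Longrightarrow> j \<in> set k \<Longrightarrow> lt i j"
  by (induction k arbitrary: i) (auto dest: lt_trans)

lemma sortedk_tl: "sortedk (i # k) \<Longrightarrow> sortedk k"
  by (cases k) auto

lemma fb_sorted: "sortedk k \<Longrightarrow> fb k = key_scale k *\<^sub>R axis (idx ` set k) 1"
proof (induction k)
  case (Cons i k)
  have less: "idx i < idx j" if "j \<in> set k" for j
    using sortedk_lt[OF Cons.prems that] by (rule idx_less)
  hence "{(a, b). a \<in> {idx i} \<and> b \<in> idx ` set k \<and> b < a} = {}" by fastforce
  hence "shuffle_sign {idx i} (idx ` set k) = 1"
    by (simp only: shuffle_sign_def card.empty power_0)
  moreover have "idx i \<notin> idx ` set k" using less by fastforce
  ultimately show ?case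
    using Cons sortedk_tl[OF Cons.prems]
    by (simp add: bv_def key_scale_def linear_scale[OF linear_form1] wedge_lin form1_wedge_axis)
qed (simp add: key_scale_def)

lemma lt_irrefl: "\<not> lt i i"
  by (cases i) simp_all

lemma sortedk_eqI: "sortedk k \<Longrightarrow> sortedk l \<Longrightarrow> set k = set l \<Longrightarrow> k = l"
proof (induction k arbitrary: l)
  case (Cons i k)
  then obtain j m where l: "l = j # m" by (cases l) auto
  have "i = j"
    using Cons.prems sortedk_lt[of i k j] sortedk_lt[of j m i] lt_trans lt_irrefl unfolding l
    by (metis list.set_intros(1) set_ConsD)
  moreover have "i \<notin> set k" "j \<notin> set m"
    using Cons.prems sortedk_lt lt_irrefl unfolding l by blast+
  ultimately have "set k = set m" using Cons.prems(3) unfolding l by auto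
  thus ?case using Cons.IH[of m] Cons.prems sortedk_tl \<open>i = j\<close> unfolding l by blast
qed simp

text \<open>Sorted words give positive multiples of distinct basis forms. Coefficients at sorted
  words can therefore serve as the pivot functionals of the tables.\<close>

lemma fb_component:
  assumes "sortedk k" "sortedk l"
  shows "fb l $ (idx ` set k) = (if l = k then key_scale k else 0)"
proof -
  have "idx ` set l = idx ` set k \<longleftrightarrow> l = k"
    using sortedk_eqI[OF assms(2,1)] inj_image_eq_iff[OF inj_idx] by auto
  thus ?thesis using fb_sorted[OF assms(2)] by (auto simp: axis_def)
qed

subsection \<open>Structure constants\<close>

text \<open>\<open>ad_table i j\<close> lists the coordinates of \<open>rho\<close> contracted by
  \<open>bv i\<close> and then by \<open>bv j\<close>: the bracket of su(3) that has
  \<open>rho\<close> as its structure form.\<close>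

fun ad_table :: "ix \<Rightarrow> ix \<Rightarrow> (ix \<times> int) list" where
  "ad_table I1 I1 = []" | "ad_table I1 I2 = [(I7,1),(I8,3)]"
| "ad_table I1 I3 = [(I6,-1)]" | "ad_table I1 I4 = [(I5,-1)]"
| "ad_table I1 I5 = [(I4,1)]" | "ad_table I1 I6 = [(I3,1)]"
| "ad_table I1 I7 = [(I2,-1)]" | "ad_table I1 I8 = [(I2,-1)]"
| "ad_table I2 I1 = [(I7,-1),(I8,-3)]" | "ad_table I2 I2 = []"
| "ad_table I2 I3 = [(I5,-1)]" | "ad_table I2 I4 = [(I6,1)]"
| "ad_table I2 I5 = [(I3,1)]" | "ad_table I2 I6 = [(I4,-1)]"
| "ad_table I2 I7 = [(I1,1)]" | "ad_table I2 I8 = [(I1,1)]"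
| "ad_table I3 I1 = [(I6,1)]" | "ad_table I3 I2 = [(I5,1)]"
| "ad_table I3 I3 = []" | "ad_table I3 I4 = [(I7,1),(I8,-3)]"
| "ad_table I3 I5 = [(I2,-1)]" | "ad_table I3 I6 = [(I1,-1)]"
| "ad_table I3 I7 = [(I4,-1)]" | "ad_table I3 I8 = [(I4,1)]"
| "ad_table I4 I1 = [(I5,1)]" | "ad_table I4 I2 = [(I6,-1)]"
| "ad_table I4 I3 = [(I7,-1),(I8,3)]" | "ad_table I4 I4 = []"
| "ad_table I4 I5 = [(I1,-1)]" | "ad_table I4 I6 = [(I2,1)]"
| "ad_table I4 I7 = [(I3,1)]" | "ad_table I4 I8 = [(I3,-1)]"
| "ad_table I5 I1 = [(I4,-1)]" | "ad_table I5 I2 = [(I3,-1)]"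
| "ad_table I5 I3 = [(I2,1)]" | "ad_table I5 I4 = [(I1,1)]"
| "ad_table I5 I5 = []" | "ad_table I5 I6 = [(I7,-2)]"
| "ad_table I5 I7 = [(I6,2)]" | "ad_table I5 I8 = []"
| "ad_table I6 I1 = [(I3,-1)]" | "ad_table I6 I2 = [(I4,1)]"
| "ad_table I6 I3 = [(I1,1)]" | "ad_table I6 I4 = [(I2,-1)]"
| "ad_table I6 I5 = [(I7,2)]" | "ad_table I6 I6 = []"
| "ad_table I6 I7 = [(I5,-2)]" | "ad_table I6 I8 = []"
| "ad_table I7 I1 = [(I2,1)]" | "ad_table I7 I2 = [(I1,-1)]"
| "ad_table I7 I3 = [(I4,1)]" | "ad_table I7 I4 = [(I3,-1)]"
| "ad_table I7 I5 = [(I6,-2)]" | "ad_table I7 I6 = [(I5,2)]"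
| "ad_table I7 I7 = []" | "ad_table I7 I8 = []"
| "ad_table I8 I1 = [(I2,1)]" | "ad_table I8 I2 = [(I1,-1)]"
| "ad_table I8 I3 = [(I4,-1)]" | "ad_table I8 I4 = [(I3,1)]"
| "ad_table I8 I5 = []" | "ad_table I8 I6 = []"
| "ad_table I8 I7 = []" | "ad_table I8 I8 = []"

text \<open>A Cartan element with values 3, 1, 2 up to sign on the root planes of e_1 e_2, e_3 e_4,
  e_5 e_6. With this choice the largest value in each table belongs to its first two rows alone, as
  \<open>top_ok\<close> checks.\<close>

fun h_table :: "ix \<Rightarrow> (ix \<times> int) list" where
  "h_table I1 = [(I2,3)]"
| "h_table I2 = [(I1,-3)]"
| "h_table I3 = [(I4,-1)]"
| "h_table I4 = [(I3,1)]"
| "h_table I5 = [(I6,-2)]"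
| "h_table I6 = [(I5,2)]"
| "h_table I7 = []"
| "h_table I8 = []"

definition rho_vec :: vec where
  "rho_vec = [([I1,I2,I7],1),([I1,I2,I8],3),([I1,I3,I6],-1),([I1,I4,I5],-1),([I2,I3,I5],-1),
    ([I2,I4,I6],1),([I3,I4,I7],1),([I3,I4,I8],-3),([I5,I6,I7],-2)]"

definition ixs :: "ix list" where "ixs = [I1,I2,I3,I4,I5,I6,I7,I8]"

fun coefv :: "ix \<Rightarrow> (ix \<times> int) list \<Rightarrow> int" where
  "coefv j [] = 0"
| "coefv j ((i, c) # l) = (if i = j then c else 0) + coefv j l"

text \<open>The weights \<open>norm3\<close> enter because the basis is not orthonormal.\<close>

definition skew_table :: "(ix \<Rightarrow> (ix \<times> int) list) \<Rightarrow> bool" where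
  "skew_table M \<longleftrightarrow> list_all (\<lambda>j. list_all (\<lambda>k. coefv k (M j) * norm3 k + coefv j (M k) * norm3 j = 0) ixs) ixs"

text \<open>On one-letter words \<open>derk M\<close> is the matrix itself. The polynomial is x (x^2
  + 1) (x^2 + 4), as \<open>quintic_flow\<close> requires.\<close>

definition quintic_table :: "(ix \<Rightarrow> (ix \<times> int) list) \<Rightarrow> bool" where
  "quintic_table M \<longleftrightarrow> list_all (\<lambda>j. let v1 = lin (derk M) [([j], 1)]; v2 = lin (derk M) v1; v3 = lin (derk M) v2;
     v4 = lin (derk M) v3; v5 = lin (derk M) v4 in vanish srtk (v5 @ scl 5 v3 @ scl 4 v1)) ixs"

lemma skew_ad_table: "list_all (\<lambda>i. skew_table (ad_table i)) ixs"
  by code_simp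

lemma skew_h_table: "skew_table h_table"
  by code_simp

lemma quintic_ad_table: "list_all (\<lambda>i. quintic_table (ad_table i)) ixs"
  by code_simp

text \<open>This is the Jacobi identity, in the form that the structure form is invariant under its
  own bracket.\<close>

lemma der_rho_ad_table: "list_all (\<lambda>i. vanish srtk (lin (derk (ad_table i)) rho_vec)) ixs"
  by code_simp

subsection \<open>Tables of weight vectors\<close>

text \<open>
  An entry consists of the address of a vector, the vector, the key of a pivot coefficient, the
  square root of the negative of its eigenvalue under the square of the Cartan element, a nonzero
  factor, and an expression of this multiple of the vector by images of earlier vectors.
\<close>

type_synonym entry = "ix list \<times> vec \<times> ix list \<times> int \<times> int \<times> (ix option \<times> int \<times> ix list) list"

fun opx :: "ix option \<Rightarrow> vec \<Rightarrow> vec" where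
  "opx None v = v"
| "opx (Some i) v = lin (derk (ad_table i)) v"

fun comb :: "vec tr \<Rightarrow> (ix option \<times> int \<times> ix list) list \<Rightarrow> vec" where
  "comb T [] = []"
| "comb T ((x, a, p) # r) = scl a (opx x (look [] T p)) @ comb T r"

text \<open>\<open>T\<close> stores the vectors reached so far, so every row has to come from
  earlier ones. An address not yet stored reads as the empty list, that is, as the zero vector,
  which is harmless in every subspace.\<close>

fun gen_ok :: "(ix list \<Rightarrow> int \<times> ix list) \<Rightarrow> vec tr \<Rightarrow> entry list \<Rightarrow> bool" where
  "gen_ok nk T [] \<longleftrightarrow> True"
| "gen_ok nk T ((p, v, q, k, c, r) # es) \<longleftrightarrow>
     c \<noteq> 0 \<and> vanish nk (scl (- c) v @ comb T r) \<and> gen_ok nk (upd (\<lambda>_. v) [] p T) es"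

fun eig_ok :: "(ix list \<Rightarrow> int \<times> ix list) \<Rightarrow> entry list \<Rightarrow> bool" where
  "eig_ok nk [] \<longleftrightarrow> True"
| "eig_ok nk ((p, v, q, k, c, r) # es) \<longleftrightarrow>
     vanish nk (lin (derk h_table) (lin (derk h_table) v) @ scl (k * k) v) \<and> eig_ok nk es"

fun coef :: "ix list \<Rightarrow> vec \<Rightarrow> int" where
  "coef q [] = 0"
| "coef q ((k, c) # v) = (if k = q then c else 0) + coef q v"

fun keys_ok :: "(ix list \<Rightarrow> bool) \<Rightarrow> vec \<Rightarrow> bool" where
  "keys_ok okk [] \<longleftrightarrow> True"
| "keys_ok okk ((k, c) # v) \<longleftrightarrow> okk k \<and> keys_ok okk v"

fun pivot_zero :: "ix list \<Rightarrow> int \<Rightarrow> entry list \<Rightarrow> bool" where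
  "pivot_zero q k [] \<longleftrightarrow> True"
| "pivot_zero q k ((p', v', q', k', c', r') # es) \<longleftrightarrow> (if k' = k then coef q v' = 0 else True) \<and> pivot_zero q k es"

fun pivots_ok :: "(ix list \<Rightarrow> bool) \<Rightarrow> entry list \<Rightarrow> bool" where
  "pivots_ok okk [] \<longleftrightarrow> True"
| "pivots_ok okk ((p, v, q, k, c, r) # es) \<longleftrightarrow>
     okk q \<and> keys_ok okk v \<and> 0 \<le> k \<and> coef q v \<noteq> 0 \<and> pivot_zero q k es \<and> pivots_ok okk es"

fun top_ok :: "int \<Rightarrow> entry list \<Rightarrow> bool" where
  "top_ok k0 [] \<longleftrightarrow> True"
| "top_ok k0 ((p, v, q, k, c, r) # es) \<longleftrightarrow> k \<noteq> k0 \<and> top_ok k0 es"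

text \<open>The first two rows span the highest weight plane, on which H is a rotation by a right
  angle times \<open>k\<close>. All other rows must be generated from them and have another
  eigenvalue.\<close>

fun table_ok :: "(ix list \<Rightarrow> int \<times> ix list) \<Rightarrow> (ix list \<Rightarrow> bool) \<Rightarrow> entry list \<Rightarrow> bool" where
  "table_ok nk okk ((p, a, q, k, c, r) # (p', b, q', k', c', r') # es) \<longleftrightarrow> 0 < k \<and> k = k'
     \<and> vanish nk (lin (derk h_table) a @ scl (- k) b) \<and> vanish nk (lin (derk h_table) b @ scl k a)
     \<and> top_ok k es
     \<and> gen_ok nk (upd (\<lambda>_. b) [] p' (upd (\<lambda>_. a) [] p E)) es
     \<and> eig_ok nk ((p, a, q, k, c, r) # (p', b, q', k', c', r') # es)
     \<and> pivots_ok okk ((p, a, q, k, c, r) # (p', b, q', k', c', r') # es)"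
| "table_ok nk okk _ \<longleftrightarrow> False"

fun tens_key :: "ix list \<Rightarrow> bool" where
  "tens_key [] \<longleftrightarrow> False"
| "tens_key (i # k) \<longleftrightarrow> sortedk k"

text \<open>The adjoint module: 3 is the value of the highest root, and the two rows with eigenvalue
  0 span the Cartan algebra.\<close>

definition vector_table :: "entry list" where
  "vector_table = [
([I1,I1],[([I1],1)],[I1],3,1,[]),
([I1,I2],[([I2],1)],[I2],3,1,[]),
([I1,I3],[([I4],1)],[I4],1,1,[(Some I6,1,[I1,I2])]),
([I1,I4],[([I5],1)],[I5],2,1,[(Some I4,1,[I1,I1])]),
([I1,I5],[([I3],1)],[I3],1,1,[(Some I2,1,[I1,I4])]),
([I1,I6],[([I6],-1)],[I6],2,1,[(Some I1,1,[I1,I5])]),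
([I1,I7],[([I7],1)],[I7],0,2,[(Some I5,1,[I1,I6])]),
([I1,I8],[([I8],1)],[I8],0,3,[(Some I4,1,[I1,I5]),(None,1,[I1,I7])])]"

lemma vector_table_ok: "table_ok srtk sortedk vector_table"
  by code_simp

text \<open>Complexified, the sum of (3,0) and (0,3). The larger of their highest weights is twice
  the simple root of value 2 plus the one of value 1, whence 5.\<close>

definition m_table :: "entry list" where
  "m_table = [
([I1,I1],[([I1,I6],-1),([I2,I5],1)],[I2,I5],5,1,[]),
([I1,I2],[([I1,I5],-1),([I2,I6],-1)],[I2,I6],5,1,[]),
([I1,I3],[([I2,I7],2),([I3,I6],1),([I4,I5],1)],[I3,I6],3,1,[(Some I5,1,[I1,I2])]),
([I1,I4],[([I7,I8],-1)],[I7,I8],0,6,[(Some I1,1,[I1,I3])]),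
([I1,I5],[([I6,I8],-1)],[I6,I8],2,2,[(Some I5,1,[I1,I4])]),
([I1,I6],[([I5,I8],1)],[I5,I8],2,2,[(Some I6,1,[I1,I4])]),
([I1,I7],[([I3,I5],1),([I4,I6],1)],[I3,I5],1,1,[(Some I4,1,[I1,I6]),(Some I3,1,[I1,I5])]),
([I1,I8],[([I3,I6],1),([I4,I5],-1)],[I3,I6],1,1,[(Some I3,1,[I1,I6]),(Some I4,-1,[I1,I5])]),
([I2,I1],[([I4,I7],1),([I4,I8],1)],[I4,I8],1,1,[(Some I3,1,[I1,I4])]),
([I2,I2],[([I2,I7],-1),([I2,I8],1)],[I2,I8],3,1,[(Some I1,1,[I1,I4])]),
([I2,I3],[([I1,I7],1),([I1,I8],-1)],[I1,I7],3,1,[(Some I2,1,[I1,I4])]),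
([I2,I4],[([I3,I7],-1),([I3,I8],-1)],[I3,I7],1,1,[(Some I4,1,[I1,I4])]),
([I2,I5],[([I1,I3],1),([I2,I4],1)],[I2,I4],4,2,[(Some I2,1,[I2,I4]),(Some I1,1,[I2,I1])]),
([I2,I6],[([I1,I4],-1),([I2,I3],1)],[I2,I3],4,2,[(Some I3,1,[I2,I3]),(Some I4,-1,[I2,I2])]),
([I2,I7],[([I1,I6],1),([I2,I5],1),([I4,I7],-2)],[I2,I5],1,1,[(Some I6,1,[I1,I8])]),
([I2,I8],[([I1,I5],1),([I2,I6],-1),([I3,I8],-2)],[I1,I5],1,1,[(Some I1,1,[I1,I5]),(Some I2,-1,[I1,I6])]),
([I3,I1],[([I1,I2],-1),([I3,I4],-1),([I5,I6],-1)],[I5,I6],0,2,[(Some I3,1,[I2,I8])]),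
([I3,I2],[([I1,I8],-2),([I3,I5],1),([I4,I6],-1)],[I3,I5],3,1,[(Some I4,1,[I1,I6]),(Some I3,-1,[I1,I5])]),
([I3,I3],[([I1,I4],-1),([I2,I3],-1),([I6,I7],1)],[I1,I4],2,2,[(Some I6,1,[I3,I1])]),
([I3,I4],[([I1,I3],1),([I2,I4],-1),([I5,I7],1)],[I1,I3],2,2,[(Some I5,1,[I3,I1])])]"

lemma m_table_ok: "table_ok srtk sortedk m_table"
  by code_simp

text \<open>Highest weight (2,2), which is twice the highest root; hence the top value 6.\<close>

definition cubic_table :: "entry list" where
  "cubic_table = [
([I1,I1],[([I1,I3,I5],1),([I1,I4,I6],-1),([I2,I3,I6],1),([I2,I4,I5],1)],[I1,I4,I6],6,1,[]),
([I1,I2],[([I1,I3,I6],-1),([I1,I4,I5],-1),([I2,I3,I5],1),([I2,I4,I6],-1)],[I1,I3,I6],6,1,[]),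
([I1,I3],[([I1,I3,I7],1),([I2,I4,I7],1)],[I1,I3,I7],4,2,[(Some I5,1,[I1,I2])]),
([I1,I4],[([I1,I4,I7],1),([I2,I3,I7],-1)],[I2,I3,I7],4,2,[(Some I5,1,[I1,I1])]),
([I1,I5],[([I1,I7,I8],-3),([I2,I3,I4],-1),([I3,I5,I7],-1),([I4,I6,I7],1)],[I4,I6,I7],3,1,[(Some I4,1,[I1,I3])]),
([I1,I6],[([I1,I2,I4],1),([I1,I5,I7],-1),([I2,I6,I7],1),([I3,I7,I8],-3)],[I1,I5,I7],1,1,[(Some I1,1,[I1,I4])]),
([I1,I7],[([I1,I6,I7],1),([I1,I6,I8],-3),([I2,I5,I7],-1),([I2,I5,I8],3)],[I2,I5,I7],5,1,[(Some I3,1,[I1,I1])]),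
([I1,I8],[([I1,I3,I5],-1),([I1,I4,I6],-1),([I2,I3,I6],1),([I2,I4,I5],-1)],[I2,I4,I5],2,2,[(Some I6,1,[I1,I3]),(Some I5,-1,[I1,I4])]),
([I2,I1],[([I3,I5,I7],1),([I3,I5,I8],3),([I4,I6,I7],1),([I4,I6,I8],3)],[I3,I5,I7],1,1,[(Some I2,1,[I1,I8])]),
([I2,I2],[([I1,I5,I7],1),([I1,I5,I8],-3),([I2,I6,I7],1),([I2,I6,I8],-3)],[I1,I5,I7],5,1,[(Some I4,1,[I1,I1])]),
([I2,I3],[([I1,I2,I3],-1),([I1,I6,I7],1),([I2,I5,I7],1),([I4,I7,I8],-3)],[I1,I2,I3],1,1,[(Some I2,1,[I1,I4])]),
([I2,I4],[([I1,I3,I6],-1),([I1,I4,I5],1),([I2,I3,I5],1),([I2,I4,I6],1)],[I1,I4,I5],4,4,[(Some I4,1,[I1,I7]),(Some I3,1,[I2,I2])]),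
([I2,I5],[([I1,I3,I6],-1),([I1,I4,I5],1),([I2,I3,I5],-1),([I2,I4,I6],-1)],[I1,I4,I5],2,2,[(Some I4,1,[I2,I3]),(Some I3,-1,[I1,I6])]),
([I2,I6],[([I1,I3,I5],1),([I1,I4,I6],1),([I2,I3,I6],1),([I2,I4,I5],-1)],[I2,I3,I6],4,4,[(Some I3,1,[I1,I7]),(Some I4,-1,[I2,I2])]),
([I2,I7],[([I1,I2,I6],-1),([I1,I3,I7],1),([I2,I4,I7],-1),([I3,I4,I6],-1)],[I2,I4,I7],2,2,[(Some I6,1,[I2,I6])]),
([I2,I8],[([I3,I6,I7],-1),([I3,I6,I8],-3),([I4,I5,I7],1),([I4,I5,I8],3)],[I4,I5,I7],1,2,[(Some I5,1,[I1,I6]),(Some I6,1,[I2,I3])]),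
([I3,I1],[([I1,I2,I5],-1),([I1,I4,I7],1),([I2,I3,I7],1),([I3,I4,I5],-1)],[I2,I3,I7],2,2,[(Some I6,1,[I2,I4])]),
([I3,I2],[([I1,I3,I4],-1),([I2,I7,I8],3),([I3,I6,I7],-1),([I4,I5,I7],-1)],[I4,I5,I7],3,1,[(Some I4,1,[I1,I4])]),
([I3,I3],[([I1,I3,I4],-1),([I1,I5,I6],-2),([I2,I7,I8],-3),([I3,I6,I8],-3),([I4,I5,I8],-3)],[I1,I3,I4],3,2,[(Some I5,1,[I1,I6]),(Some I6,-1,[I2,I3])]),
([I3,I4],[([I1,I7,I8],-3),([I2,I3,I4],1),([I2,I5,I6],2),([I3,I5,I8],3),([I4,I6,I8],-3)],[I2,I3,I4],3,2,[(Some I5,1,[I2,I3]),(Some I6,1,[I1,I6])]),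
([I3,I5],[([I1,I2,I4],1),([I1,I5,I8],3),([I2,I6,I8],-3),([I3,I7,I8],3),([I4,I5,I6],2)],[I1,I2,I4],1,2,[(Some I6,1,[I1,I5]),(Some I5,-1,[I3,I2])]),
([I3,I6],[([I1,I2,I7],2),([I1,I3,I6],1),([I1,I4,I5],1),([I2,I3,I5],1),([I2,I4,I6],-1),([I3,I4,I7],2)],[I1,I3,I6],0,4,[(Some I5,1,[I2,I7]),(Some I6,-1,[I3,I1])]),
([I3,I7],[([I1,I6,I7],1),([I1,I6,I8],3),([I2,I5,I7],1),([I2,I5,I8],3),([I3,I5,I6],2),([I4,I7,I8],-6)],[I1,I6,I7],1,1,[(Some I2,1,[I3,I1]),(Some I1,1,[I2,I7])]),
([I3,I8],[([I1,I2,I6],-1),([I1,I3,I8],-3),([I2,I4,I8],3),([I3,I4,I6],1),([I5,I7,I8],-6)],[I1,I2,I6],2,1,[(Some I1,1,[I1,I7]),(None,-1,[I2,I7])]),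
([I4,I1],[([I1,I2,I7],1),([I1,I2,I8],-3),([I3,I4,I7],-1),([I3,I4,I8],-3),([I5,I6,I8],-6)],[I1,I2,I7],0,2,[(Some I5,1,[I3,I8])]),
([I4,I2],[([I1,I2,I5],-1),([I1,I4,I8],-3),([I2,I3,I8],-3),([I3,I4,I5],1),([I6,I7,I8],6)],[I1,I2,I5],2,2,[(Some I6,1,[I4,I1])]),
([I4,I3],[([I1,I2,I8],6),([I3,I4,I7],5),([I3,I4,I8],9),([I5,I6,I7],1),([I5,I6,I8],15)],[I5,I6,I7],0,4,[(Some I2,1,[I3,I2]),(Some I1,-1,[I1,I5]),(None,2,[I3,I6]),(None,-10,[I4,I1])])]"

lemma cubic_table_ok: "table_ok srtk sortedk cubic_table"
  by code_simp

text \<open>Complexified, the sum of (4,1) and (1,4). The top weight is the sum of those of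
  \<open>vector_table\<close> and \<open>m_table\<close>, hence 8 = 3 + 5.\<close>

definition tensor_table :: "entry list" where
  "tensor_table = [
([I1,I1],[([I1,I1,I5],-1),([I1,I2,I6],-1),([I2,I1,I6],-1),([I2,I2,I5],1)],[I2,I2,I5],8,1,[]),
([I1,I2],[([I1,I1,I6],1),([I1,I2,I5],-1),([I2,I1,I5],-1),([I2,I2,I6],-1)],[I2,I2,I6],8,1,[]),
([I1,I3],[([I5,I1,I6],1),([I5,I2,I5],-1),([I6,I1,I5],1),([I6,I2,I6],1)],[I6,I1,I5],7,1,[(Some I4,1,[I1,I2])]),
([I1,I4],[([I5,I1,I5],-1),([I5,I2,I6],-1),([I6,I1,I6],1),([I6,I2,I5],-1)],[I6,I2,I5],7,1,[(Some I4,1,[I1,I1])]),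
([I1,I5],[([I5,I1,I7],-2),([I5,I3,I5],1),([I5,I4,I6],-1),([I6,I2,I7],-2),([I6,I3,I6],-1),([I6,I4,I5],-1),([I7,I1,I5],-2),([I7,I2,I6],-2)],[I5,I4,I6],5,1,[(Some I6,1,[I1,I4])]),
([I1,I6],[([I5,I2,I7],2),([I5,I3,I6],1),([I5,I4,I5],1),([I6,I1,I7],-2),([I6,I3,I5],1),([I6,I4,I6],-1),([I7,I1,I6],-2),([I7,I2,I5],2)],[I6,I3,I5],5,1,[(Some I5,1,[I1,I4])]),
([I1,I7],[([I5,I2,I5],-1),([I5,I4,I7],1),([I6,I2,I6],-1),([I6,I3,I7],1),([I7,I2,I7],2),([I7,I3,I6],1),([I7,I4,I5],1)],[I7,I4,I5],3,8,[(Some I5,1,[I1,I5]),(Some I6,1,[I1,I6])]),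
([I1,I8],[([I5,I1,I5],-1),([I5,I3,I7],-1),([I6,I1,I6],-1),([I6,I4,I7],1),([I7,I1,I7],2),([I7,I3,I5],-1),([I7,I4,I6],1)],[I7,I3,I5],3,8,[(Some I5,1,[I1,I6]),(Some I6,-1,[I1,I5])]),
([I2,I1],[([I5,I2,I7],-1),([I5,I4,I5],-1),([I6,I1,I7],-1),([I6,I4,I6],-1),([I7,I1,I6],-1),([I7,I2,I5],-1),([I7,I4,I7],2)],[I7,I2,I5],1,6,[(Some I6,1,[I1,I7]),(Some I5,-1,[I1,I8])]),
([I2,I2],[([I5,I1,I7],-1),([I5,I3,I5],1),([I6,I2,I7],1),([I6,I3,I6],1),([I7,I1,I5],-1),([I7,I2,I6],1),([I7,I3,I7],-2)],[I5,I1,I7],1,6,[(Some I5,1,[I1,I7]),(Some I6,1,[I1,I8])]),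
([I2,I3],[([I5,I1,I6],-1),([I5,I2,I5],-1),([I5,I4,I7],2),([I6,I1,I5],-1),([I6,I2,I6],1),([I6,I3,I7],-2),([I7,I3,I6],-2),([I7,I4,I5],2)],[I6,I1,I5],1,4,[(Some I5,1,[I2,I2]),(Some I6,-1,[I2,I1])]),
([I2,I4],[([I5,I1,I5],1),([I5,I2,I6],-1),([I5,I3,I7],2),([I6,I1,I6],-1),([I6,I2,I5],-1),([I6,I4,I7],2),([I7,I3,I5],2),([I7,I4,I6],2)],[I5,I1,I5],1,4,[(Some I5,1,[I2,I1]),(Some I6,1,[I2,I2])]),
([I2,I5],[([I5,I3,I5],-1),([I5,I4,I6],-1),([I6,I3,I6],1),([I6,I4,I5],-1)],[I5,I4,I6],3,10,[(Some I6,1,[I2,I4]),(Some I5,-1,[I2,I3])]),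
([I2,I6],[([I5,I3,I6],1),([I5,I4,I5],-1),([I6,I3,I5],1),([I6,I4,I6],1)],[I5,I4,I5],3,10,[(Some I6,1,[I2,I3]),(Some I5,1,[I2,I4])]),
([I2,I7],[([I3,I3,I5],1),([I3,I4,I6],1),([I4,I3,I6],1),([I4,I4,I5],-1)],[I3,I4,I6],0,2,[(Some I3,1,[I2,I3]),(Some I4,1,[I2,I4])]),
([I2,I8],[([I3,I3,I6],1),([I3,I4,I5],-1),([I4,I3,I5],-1),([I4,I4,I6],-1)],[I4,I4,I6],0,1,[(Some I2,1,[I2,I6])]),
([I3,I1],[([I1,I3,I6],-1),([I1,I4,I5],1),([I2,I3,I5],-1),([I2,I4,I6],-1),([I3,I1,I6],-1),([I3,I2,I5],-1),([I3,I4,I7],2),([I4,I1,I5],1),([I4,I2,I6],-1),([I4,I3,I7],2)],[I3,I1,I6],2,1,[(Some I3,1,[I2,I2]),(Some I4,1,[I2,I1])]),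
([I3,I2],[([I1,I2,I7],2),([I1,I3,I6],1),([I1,I4,I5],1),([I2,I1,I7],2),([I2,I3,I5],-1),([I2,I4,I6],1),([I3,I1,I6],1),([I3,I2,I5],-1),([I4,I1,I5],1),([I4,I2,I6],1)],[I1,I4,I5],6,2,[(Some I3,1,[I1,I5]),(Some I4,-1,[I1,I6])]),
([I3,I3],[([I1,I1,I7],2),([I1,I3,I5],-1),([I1,I4,I6],1),([I2,I2,I7],-2),([I2,I3,I6],-1),([I2,I4,I5],-1),([I3,I1,I5],-1),([I3,I2,I6],-1),([I4,I1,I6],1),([I4,I2,I5],-1)],[I1,I3,I5],6,2,[(Some I3,1,[I1,I6]),(Some I4,1,[I1,I5])]),
([I3,I4],[([I1,I3,I5],-1),([I1,I4,I6],-1),([I2,I3,I6],1),([I2,I4,I5],-1),([I3,I1,I5],-1),([I3,I2,I6],1),([I3,I3,I7],-2),([I4,I1,I6],-1),([I4,I2,I5],-1),([I4,I4,I7],2)],[I1,I3,I5],2,2,[(Some I1,1,[I2,I3]),(Some I2,-1,[I2,I4])]),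
([I3,I5],[([I1,I1,I6],1),([I1,I2,I5],1),([I1,I4,I7],-2),([I2,I1,I5],1),([I2,I2,I6],-1),([I2,I3,I7],2),([I3,I2,I7],2),([I3,I3,I6],1),([I3,I4,I5],1),([I4,I1,I7],-2),([I4,I3,I5],1),([I4,I4,I6],-1)],[I4,I3,I5],4,4,[(Some I5,1,[I3,I3]),(Some I6,-1,[I3,I2])]),
([I3,I6],[([I3,I1,I6],-1),([I3,I2,I5],1),([I4,I1,I5],1),([I4,I2,I6],1),([I5,I1,I4],1),([I5,I2,I3],1),([I5,I6,I7],-1),([I5,I6,I8],-3),([I6,I1,I3],-1),([I6,I2,I4],1),([I6,I5,I7],-1),([I6,I5,I8],-3)],[I3,I1,I6],4,2,[(Some I3,1,[I1,I5]),(Some I4,1,[I1,I6])]),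
([I3,I7],[([I1,I3,I6],-1),([I1,I4,I5],1),([I2,I3,I5],1),([I2,I4,I6],1),([I5,I1,I4],-1),([I5,I2,I3],-1),([I5,I6,I7],1),([I5,I6,I8],-3),([I6,I1,I3],1),([I6,I2,I4],-1),([I6,I5,I7],1),([I6,I5,I8],-3)],[I5,I1,I4],4,1,[(Some I3,1,[I2,I5])]),
([I3,I8],[([I3,I1,I5],-1),([I3,I2,I6],-1),([I4,I1,I6],-1),([I4,I2,I5],1),([I5,I1,I3],-1),([I5,I2,I4],1),([I5,I5,I7],-1),([I5,I5,I8],-3),([I6,I1,I4],-1),([I6,I2,I3],-1),([I6,I6,I7],1),([I6,I6,I8],3)],[I4,I1,I6],4,2,[(Some I4,1,[I1,I5]),(Some I3,-1,[I1,I6])]),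
([I4,I1],[([I1,I3,I5],-1),([I1,I4,I6],-1),([I2,I3,I6],-1),([I2,I4,I5],1),([I5,I1,I3],1),([I5,I2,I4],-1),([I5,I5,I7],1),([I5,I5,I8],-3),([I6,I1,I4],1),([I6,I2,I3],1),([I6,I6,I7],-1),([I6,I6,I8],3)],[I6,I6,I7],4,1,[(Some I3,1,[I2,I6])]),
([I4,I2],[([I1,I1,I5],-1),([I1,I2,I6],1),([I1,I3,I7],-2),([I2,I1,I6],1),([I2,I2,I5],1),([I2,I4,I7],-2),([I3,I1,I7],-2),([I3,I3,I5],1),([I3,I4,I6],-1),([I4,I2,I7],-2),([I4,I3,I6],-1),([I4,I4,I5],-1)],[I4,I4,I5],4,4,[(Some I6,1,[I3,I4]),(Some I5,-1,[I3,I1])]),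
([I4,I3],[([I1,I1,I3],-1),([I1,I2,I4],1),([I1,I5,I7],-1),([I1,I5,I8],-3),([I2,I1,I4],1),([I2,I2,I3],1),([I2,I6,I7],-1),([I2,I6,I8],-3),([I7,I1,I5],1),([I7,I2,I6],1),([I8,I1,I5],3),([I8,I2,I6],3)],[I7,I2,I6],5,1,[(Some I2,1,[I1,I1])]),
([I4,I4],[([I3,I1,I4],1),([I3,I2,I3],1),([I3,I6,I7],-1),([I3,I6,I8],3),([I4,I1,I3],1),([I4,I2,I4],-1),([I4,I5,I7],1),([I4,I5,I8],-3),([I7,I3,I6],1),([I7,I4,I5],-1),([I8,I3,I6],-3),([I8,I4,I5],3)],[I7,I3,I6],1,1,[(Some I3,1,[I2,I7])]),
([I4,I5],[([I1,I1,I4],-1),([I1,I2,I3],-1),([I1,I6,I7],1),([I1,I6,I8],3),([I2,I1,I3],-1),([I2,I2,I4],1),([I2,I5,I7],-1),([I2,I5,I8],-3),([I7,I1,I6],-1),([I7,I2,I5],1),([I8,I1,I6],-3),([I8,I2,I5],3)],[I7,I1,I6],5,1,[(Some I1,1,[I1,I1])]),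
([I4,I6],[([I3,I1,I3],1),([I3,I2,I4],-1),([I3,I5,I7],1),([I3,I5,I8],-3),([I4,I1,I4],-1),([I4,I2,I3],-1),([I4,I6,I7],1),([I4,I6,I8],-3),([I7,I3,I5],-1),([I7,I4,I6],-1),([I8,I3,I5],3),([I8,I4,I6],3)],[I3,I1,I3],1,1,[(Some I4,1,[I2,I7])]),
([I4,I7],[([I1,I1,I5],2),([I1,I3,I7],-1),([I1,I3,I8],-3),([I2,I2,I5],2),([I2,I4,I7],1),([I2,I4,I8],3),([I7,I1,I3],1),([I7,I2,I4],-1),([I7,I5,I7],1),([I7,I5,I8],3),([I8,I1,I3],3),([I8,I2,I4],-3),([I8,I5,I7],3),([I8,I5,I8],9)],[I7,I5,I7],2,4,[(Some I2,1,[I4,I3]),(Some I1,-1,[I4,I5])]),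
([I4,I8],[([I1,I1,I6],-2),([I1,I4,I7],-1),([I1,I4,I8],-3),([I2,I2,I6],-2),([I2,I3,I7],-1),([I2,I3,I8],-3),([I7,I1,I4],1),([I7,I2,I3],1),([I7,I6,I7],-1),([I7,I6,I8],-3),([I8,I1,I4],3),([I8,I2,I3],3),([I8,I6,I7],-3),([I8,I6,I8],-9)],[I7,I6,I7],2,4,[(Some I2,1,[I4,I5]),(Some I1,1,[I4,I3])]),
([I5,I1],[([I3,I5,I8],-2),([I4,I6,I8],-2),([I5,I3,I7],-1),([I5,I3,I8],-1),([I6,I4,I7],-1),([I6,I4,I8],-1),([I7,I3,I5],-1),([I7,I4,I6],-1),([I8,I3,I5],1),([I8,I4,I6],1)],[I7,I4,I6],1,12,[(Some I1,1,[I3,I6]),(Some I2,1,[I3,I8]),(None,-4,[I2,I4]),(None,4,[I4,I6])]),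
([I5,I2],[([I1,I1,I3],-2),([I1,I5,I7],-1),([I1,I5,I8],-3),([I2,I2,I3],-2),([I2,I6,I7],1),([I2,I6,I8],3),([I7,I1,I5],1),([I7,I2,I6],-1),([I7,I3,I7],-1),([I7,I3,I8],-3),([I8,I1,I5],3),([I8,I2,I6],-3),([I8,I3,I7],-3),([I8,I3,I8],-9)],[I2,I6,I7],1,6,[(Some I1,1,[I4,I8]),(Some I2,-1,[I4,I7])]),
([I5,I3],[([I1,I1,I7],2),([I1,I3,I5],-1),([I1,I4,I6],1),([I2,I2,I7],2),([I2,I3,I6],1),([I2,I4,I5],1),([I3,I1,I5],-1),([I3,I2,I6],1),([I3,I3,I7],-2),([I4,I1,I6],1),([I4,I2,I5],1),([I4,I4,I7],-2),([I5,I5,I8],-6),([I6,I6,I8],-6),([I7,I7,I8],12)],[I4,I2,I5],0,1,[(Some I4,1,[I2,I2]),(Some I3,1,[I2,I1])]),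
([I5,I4],[([I1,I1,I6],1),([I1,I4,I7],-1),([I2,I2,I6],1),([I2,I3,I7],-1),([I3,I2,I7],-1),([I3,I3,I6],-1),([I4,I1,I7],-1),([I4,I4,I6],-1),([I6,I7,I8],6),([I7,I6,I8],6)],[I4,I1,I7],2,6,[(Some I5,1,[I5,I3])]),
([I5,I5],[([I1,I1,I5],-1),([I1,I3,I7],-1),([I2,I2,I5],-1),([I2,I4,I7],1),([I3,I1,I7],-1),([I3,I3,I5],1),([I4,I2,I7],1),([I4,I4,I5],1),([I5,I7,I8],-6),([I7,I5,I8],-6)],[I3,I1,I7],2,6,[(Some I6,1,[I5,I3])]),
([I5,I6],[([I1,I1,I4],-1),([I1,I2,I3],-1),([I1,I6,I7],1),([I1,I6,I8],1),([I2,I1,I3],-1),([I2,I2,I4],1),([I2,I5,I7],-1),([I2,I5,I8],-1),([I5,I2,I7],-1),([I5,I2,I8],1),([I6,I1,I7],1),([I6,I1,I8],-1),([I8,I1,I6],-2),([I8,I2,I5],2)],[I2,I5,I7],5,12,[(Some I3,1,[I4,I1]),(Some I4,-1,[I3,I7]),(None,-4,[I1,I6]),(None,8,[I4,I5])]),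
([I5,I7],[([I2,I7,I8],4),([I3,I6,I8],2),([I4,I5,I8],2),([I5,I2,I5],1),([I5,I4,I8],1),([I6,I2,I6],1),([I6,I3,I8],1),([I7,I2,I7],-2),([I7,I2,I8],2),([I8,I2,I7],-2),([I8,I3,I6],-1),([I8,I4,I5],-1)],[I6,I3,I8],3,1,[(Some I5,1,[I4,I3]),(Some I6,1,[I5,I6]),(None,1,[I1,I7])]),
([I5,I8],[([I1,I7,I8],4),([I3,I5,I8],-2),([I4,I6,I8],2),([I5,I1,I5],1),([I5,I3,I8],-1),([I6,I1,I6],1),([I6,I4,I8],1),([I7,I1,I7],-2),([I7,I1,I8],2),([I8,I1,I7],-2),([I8,I3,I5],1),([I8,I4,I6],-1)],[I5,I1,I5],3,1,[(Some I5,1,[I5,I6]),(Some I6,-1,[I4,I3]),(None,1,[I1,I8])]),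
([I6,I1],[([I1,I5,I8],-2),([I2,I6,I8],2),([I3,I7,I8],-4),([I5,I1,I8],-1),([I5,I3,I5],1),([I6,I2,I8],1),([I6,I3,I6],1),([I7,I3,I7],-2),([I7,I3,I8],-2),([I8,I1,I5],1),([I8,I2,I6],-1),([I8,I3,I7],2)],[I5,I3,I5],1,4,[(Some I5,1,[I5,I7]),(Some I6,1,[I5,I8]),(None,6,[I2,I2])]),
([I6,I2],[([I1,I1,I7],-3),([I1,I1,I8],3),([I2,I2,I7],3),([I2,I2,I8],-3),([I3,I1,I5],1),([I3,I2,I6],1),([I4,I1,I6],-1),([I4,I2,I5],1),([I5,I1,I3],1),([I5,I2,I4],1),([I6,I1,I4],-1),([I6,I2,I3],1)],[I3,I1,I5],6,2,[(Some I1,1,[I5,I7]),(Some I2,1,[I5,I8]),(None,1,[I3,I3])]),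
([I6,I3],[([I1,I6,I8],2),([I2,I5,I8],2),([I4,I7,I8],-4),([I5,I2,I8],1),([I5,I4,I5],1),([I6,I1,I8],1),([I6,I4,I6],1),([I7,I4,I7],-2),([I7,I4,I8],-2),([I8,I1,I6],-1),([I8,I2,I5],-1),([I8,I4,I7],2)],[I6,I4,I6],1,4,[(Some I5,1,[I5,I8]),(Some I6,-1,[I5,I7]),(None,-6,[I2,I1])]),
([I6,I4],[([I1,I3,I6],-1),([I1,I4,I5],1),([I2,I3,I5],-1),([I2,I4,I6],-1),([I3,I4,I7],3),([I3,I4,I8],3),([I4,I3,I7],3),([I4,I3,I8],3),([I5,I1,I4],-1),([I5,I2,I3],1),([I6,I1,I3],1),([I6,I2,I4],1)],[I5,I2,I3],2,2,[(Some I3,1,[I6,I1]),(Some I4,-1,[I6,I3]),(None,-1,[I3,I1])]),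
([I6,I5],[([I1,I2,I7],-3),([I1,I2,I8],3),([I2,I1,I7],-3),([I2,I1,I8],3),([I3,I1,I6],-1),([I3,I2,I5],1),([I4,I1,I5],-1),([I4,I2,I6],-1),([I5,I1,I4],-1),([I5,I2,I3],1),([I6,I1,I3],-1),([I6,I2,I4],-1)],[I5,I2,I3],6,2,[(Some I2,1,[I5,I7]),(Some I1,-1,[I5,I8]),(None,1,[I3,I2])]),
([I6,I6],[([I1,I1,I3],1),([I1,I2,I4],1),([I2,I1,I4],1),([I2,I2,I3],-1)],[I1,I1,I3],7,8,[(Some I3,1,[I6,I5]),(Some I4,-1,[I6,I2])]),
([I6,I7],[([I1,I1,I4],1),([I1,I2,I3],-1),([I2,I1,I3],-1),([I2,I2,I4],-1)],[I1,I1,I4],7,8,[(Some I4,1,[I6,I5]),(Some I3,1,[I6,I2])]),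
([I6,I8],[([I3,I1,I4],-1),([I3,I2,I3],1),([I4,I1,I3],-1),([I4,I2,I4],-1)],[I4,I2,I4],5,1,[(Some I6,1,[I6,I7])]),
([I7,I1],[([I3,I1,I3],1),([I3,I2,I4],1),([I4,I1,I4],-1),([I4,I2,I3],1)],[I4,I2,I3],5,1,[(Some I5,1,[I6,I7])]),
([I7,I2],[([I1,I1,I5],-1),([I1,I2,I6],1),([I1,I3,I7],1),([I1,I3,I8],3),([I2,I1,I6],1),([I2,I2,I5],1),([I2,I4,I7],1),([I2,I4,I8],3),([I7,I1,I3],-1),([I7,I2,I4],-1),([I8,I1,I3],-3),([I8,I2,I4],-3)],[I7,I2,I4],4,1,[(Some I1,1,[I6,I7])]),
([I7,I3],[([I3,I1,I5],1),([I3,I2,I6],-1),([I3,I3,I7],-1),([I3,I3,I8],-3),([I4,I1,I6],1),([I4,I2,I5],1),([I4,I4,I7],1),([I4,I4,I8],3),([I5,I1,I3],1),([I5,I2,I4],1),([I6,I1,I4],1),([I6,I2,I3],-1)],[I5,I2,I4],2,1,[(Some I1,1,[I6,I8])]),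
([I7,I4],[([I1,I1,I6],-1),([I1,I2,I5],-1),([I1,I4,I7],-1),([I1,I4,I8],-3),([I2,I1,I5],-1),([I2,I2,I6],1),([I2,I3,I7],1),([I2,I3,I8],3),([I7,I1,I4],1),([I7,I2,I3],-1),([I8,I1,I4],3),([I8,I2,I3],-3)],[I2,I2,I6],4,1,[(Some I1,1,[I6,I6])]),
([I7,I5],[([I1,I4,I7],1),([I1,I4,I8],1),([I2,I3,I7],-1),([I2,I3,I8],-1),([I3,I2,I7],-1),([I3,I2,I8],1),([I4,I1,I7],1),([I4,I1,I8],-1),([I8,I1,I4],-2),([I8,I2,I3],2)],[I3,I2,I8],4,3,[(Some I6,1,[I3,I2]),(Some I5,1,[I6,I2]),(None,3,[I3,I5]),(None,-2,[I7,I4])]),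
([I7,I6],[([I1,I3,I7],-1),([I1,I3,I8],-1),([I2,I4,I7],-1),([I2,I4,I8],-1),([I3,I1,I7],-1),([I3,I1,I8],1),([I4,I2,I7],-1),([I4,I2,I8],1),([I8,I1,I3],2),([I8,I2,I4],2)],[I1,I3,I7],4,3,[(Some I5,1,[I6,I4]),(Some I6,-1,[I3,I4]),(None,5,[I4,I2]),(None,-2,[I7,I2])]),
([I7,I7],[([I1,I1,I3],1),([I1,I2,I4],-1),([I1,I5,I7],1),([I1,I5,I8],1),([I2,I1,I4],-1),([I2,I2,I3],-1),([I2,I6,I7],1),([I2,I6,I8],1),([I5,I1,I7],1),([I5,I1,I8],-1),([I6,I2,I7],1),([I6,I2,I8],-1),([I8,I1,I5],-2),([I8,I2,I6],-2)],[I2,I1,I4],5,6,[(Some I6,1,[I5,I8]),(Some I5,-1,[I5,I7]),(None,-6,[I4,I3])]),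
([I7,I8],[([I1,I7,I8],4),([I3,I1,I3],-2),([I3,I5,I7],-1),([I3,I5,I8],1),([I4,I1,I4],-2),([I4,I6,I7],1),([I4,I6,I8],-1),([I5,I3,I7],-1),([I5,I3,I8],-1),([I6,I4,I7],1),([I6,I4,I8],1),([I7,I1,I7],1),([I7,I1,I8],-1),([I8,I1,I7],-5),([I8,I1,I8],9),([I8,I3,I5],-2),([I8,I4,I6],2)],[I5,I3,I8],3,2,[(Some I3,1,[I7,I5]),(Some I4,1,[I7,I6])]),
([I8,I1],[([I1,I2,I8],-2),([I1,I3,I6],-1),([I1,I4,I5],-1),([I2,I1,I8],2),([I2,I3,I5],-1),([I2,I4,I6],1),([I3,I1,I6],-1),([I3,I2,I5],-1),([I3,I4,I8],-2),([I4,I1,I5],-1),([I4,I2,I6],1),([I4,I3,I8],2),([I5,I6,I8],-2),([I6,I5,I8],2),([I8,I1,I2],4),([I8,I3,I4],4),([I8,I5,I6],4)],[I1,I3,I6],0,1,[(Some I2,1,[I5,I7]),(Some I1,1,[I5,I8])]),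
([I8,I2],[([I1,I1,I6],-1),([I1,I4,I8],-1),([I2,I2,I6],-1),([I2,I3,I8],-1),([I3,I2,I8],1),([I3,I3,I6],1),([I4,I1,I8],1),([I4,I4,I6],1),([I6,I7,I8],-2),([I7,I6,I8],-4),([I8,I1,I4],2),([I8,I2,I3],2),([I8,I6,I7],-2)],[I1,I4,I8],2,4,[(Some I6,1,[I8,I1]),(None,-2,[I5,I4])]),
([I8,I3],[([I1,I1,I5],-1),([I1,I3,I8],1),([I2,I2,I5],-1),([I2,I4,I8],-1),([I3,I1,I8],-1),([I3,I3,I5],1),([I4,I2,I8],1),([I4,I4,I5],1),([I5,I7,I8],-2),([I7,I5,I8],-4),([I8,I1,I3],-2),([I8,I2,I4],2),([I8,I5,I7],-2)],[I4,I4,I5],2,4,[(Some I5,1,[I8,I1]),(None,2,[I5,I5])]),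
([I8,I4],[([I3,I1,I4],1),([I3,I2,I3],1),([I3,I6,I7],-1),([I3,I6,I8],1),([I4,I1,I3],1),([I4,I2,I4],-1),([I4,I5,I7],1),([I4,I5,I8],-1),([I5,I4,I7],1),([I5,I4,I8],1),([I6,I3,I7],-1),([I6,I3,I8],-1),([I8,I3,I6],-2),([I8,I4,I5],2)],[I4,I1,I3],1,6,[(Some I5,1,[I6,I1]),(Some I6,1,[I6,I3]),(None,6,[I4,I4])]),
([I8,I5],[([I1,I1,I4],-2),([I1,I6,I7],1),([I1,I6,I8],1),([I2,I2,I4],-2),([I2,I5,I7],1),([I2,I5,I8],1),([I4,I7,I8],4),([I5,I2,I7],1),([I5,I2,I8],-1),([I6,I1,I7],1),([I6,I1,I8],-1),([I7,I4,I7],-1),([I7,I4,I8],-1),([I8,I1,I6],-2),([I8,I2,I5],-2),([I8,I4,I7],-5),([I8,I4,I8],-9)],[I7,I4,I8],1,2,[(Some I2,1,[I7,I5]),(Some I1,1,[I7,I6])]),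
([I8,I6],[([I3,I2,I3],2),([I3,I6,I7],-1),([I3,I6,I8],3),([I4,I2,I4],2),([I4,I5,I7],-1),([I4,I5,I8],3),([I5,I2,I5],1),([I5,I4,I7],-1),([I6,I2,I6],1),([I6,I3,I7],-1),([I7,I2,I7],-3),([I7,I2,I8],3),([I8,I2,I7],3),([I8,I2,I8],-9),([I8,I3,I6],-3),([I8,I4,I5],-3)],[I3,I6,I7],3,1,[(Some I1,1,[I6,I2]),(None,3,[I5,I7])]),
([I8,I7],[([I1,I1,I4],1),([I1,I2,I3],1),([I1,I6,I7],-1),([I1,I6,I8],3),([I2,I1,I3],-1),([I2,I2,I4],1),([I2,I5,I7],-1),([I2,I5,I8],3),([I3,I1,I2],-2),([I3,I3,I4],-2),([I3,I5,I6],-2),([I4,I7,I8],-6),([I5,I2,I7],-1),([I5,I3,I6],-1),([I6,I1,I7],-1),([I6,I3,I5],1),([I8,I1,I6],-3),([I8,I2,I5],-3),([I8,I4,I7],6)],[I2,I1,I3],1,2,[(Some I6,1,[I4,I4]),(Some I5,-1,[I4,I6]),(None,2,[I2,I1])]),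
([I8,I8],[([I1,I7,I8],-6),([I2,I1,I2],-2),([I2,I3,I4],-2),([I2,I5,I6],-2),([I3,I1,I3],1),([I3,I2,I4],-1),([I3,I5,I7],1),([I3,I5,I8],3),([I4,I1,I4],1),([I4,I2,I3],1),([I4,I6,I7],-1),([I4,I6,I8],-3),([I5,I2,I6],-1),([I5,I3,I7],1),([I6,I2,I5],1),([I6,I4,I7],-1),([I8,I1,I7],6),([I8,I3,I5],-3),([I8,I4,I6],3)],[I4,I1,I4],3,2,[(Some I5,1,[I4,I5]),(Some I6,1,[I4,I3]),(None,-2,[I1,I8])]),
([I1,I1,I1],[([I1,I1,I5],4),([I1,I2,I6],-1),([I1,I3,I8],-5),([I2,I1,I6],1),([I2,I2,I5],4),([I2,I4,I8],5),([I3,I1,I8],-1),([I3,I4,I6],-1),([I4,I2,I8],1),([I4,I3,I6],1),([I5,I7,I8],4),([I6,I1,I2],2),([I6,I3,I4],2),([I6,I5,I6],2),([I7,I5,I8],8),([I8,I1,I3],4),([I8,I2,I4],-4),([I8,I5,I7],4),([I8,I5,I8],18)],[I4,I2,I8],2,1,[(Some I5,1,[I3,I7]),(None,2,[I4,I7]),(None,1,[I8,I3])]),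
([I1,I1,I2],[([I1,I1,I6],1),([I1,I2,I5],-1),([I2,I1,I5],1),([I2,I2,I6],1),([I3,I2,I8],-6),([I3,I3,I6],-5),([I3,I4,I5],-1),([I4,I1,I8],-6),([I4,I3,I5],1),([I4,I4,I6],-5),([I5,I1,I2],2),([I5,I3,I4],2),([I5,I5,I6],2),([I6,I7,I8],6),([I7,I6,I8],12),([I8,I1,I4],-6),([I8,I2,I3],-6),([I8,I6,I7],6),([I8,I6,I8],-18)],[I3,I4,I5],2,1,[(Some I2,1,[I2,I1]),(Some I1,1,[I2,I2]),(None,2,[I4,I8]),(None,-6,[I8,I2])]),
([I1,I1,I3],[([I1,I1,I2],-2),([I1,I3,I4],-2),([I1,I5,I6],-2),([I2,I7,I8],6),([I3,I1,I4],-1),([I3,I2,I3],1),([I3,I6,I8],6),([I4,I1,I3],1),([I4,I2,I4],1),([I4,I5,I8],6),([I5,I1,I6],-1),([I5,I2,I5],1),([I6,I1,I5],1),([I6,I2,I6],1),([I7,I2,I7],-3),([I7,I2,I8],3),([I8,I2,I7],-3),([I8,I2,I8],-9),([I8,I3,I6],-6),([I8,I4,I5],-6)],[I4,I1,I3],3,1,[(Some I2,1,[I3,I2]),(None,1,[I1,I7]),(None,1,[I8,I6])]),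
([I1,I1,I4],[([I1,I1,I3],-1),([I1,I2,I4],-1),([I1,I5,I8],-4),([I2,I1,I4],1),([I2,I2,I3],-1),([I2,I6,I8],4),([I3,I7,I8],-2),([I4,I1,I2],2),([I4,I3,I4],2),([I4,I5,I6],2),([I5,I1,I8],1),([I5,I4,I6],1),([I6,I2,I8],-1),([I6,I4,I5],-1),([I7,I3,I7],-1),([I7,I3,I8],-1),([I8,I1,I5],5),([I8,I2,I6],-5),([I8,I3,I7],1),([I8,I3,I8],-9)],[I6,I2,I8],1,2,[(Some I6,1,[I4,I6]),(Some I5,1,[I4,I4]),(None,2,[I5,I2]),(None,-2,[I6,I1])]),
([I1,I1,I5],[([I1,I1,I7],1),([I1,I1,I8],-3),([I1,I3,I5],1),([I1,I4,I6],-1),([I2,I2,I7],1),([I2,I2,I8],-3),([I2,I3,I6],-1),([I2,I4,I5],-1),([I3,I3,I7],3),([I3,I3,I8],3),([I4,I4,I7],3),([I4,I4,I8],3),([I5,I1,I3],-1),([I5,I2,I4],1),([I5,I5,I7],-1),([I5,I5,I8],3),([I6,I1,I4],1),([I6,I2,I3],1),([I6,I6,I7],-1),([I6,I6,I8],3),([I7,I7,I8],-6),([I8,I7,I8],18)],[I5,I5,I7],0,2,[(Some I5,1,[I4,I8]),(Some I6,1,[I4,I7]),(None,-2,[I5,I3])]),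
([I1,I1,I6],[([I1,I2,I7],1),([I1,I2,I8],-1),([I2,I1,I7],-1),([I2,I1,I8],1),([I3,I1,I6],-1),([I3,I2,I5],-1),([I3,I4,I7],1),([I3,I4,I8],-1),([I4,I1,I5],-1),([I4,I2,I6],1),([I4,I3,I7],-1),([I4,I3,I8],1),([I5,I1,I4],-1),([I5,I2,I3],-1),([I5,I6,I7],1),([I5,I6,I8],-1),([I6,I1,I3],-1),([I6,I2,I4],1),([I6,I5,I7],-1),([I6,I5,I8],1),([I7,I1,I2],-2),([I7,I3,I4],-2),([I7,I5,I6],-2),([I8,I1,I2],2),([I8,I3,I4],2),([I8,I5,I6],2)],[I5,I1,I4],0,2,[(Some I2,1,[I1,I7]),(Some I1,1,[I1,I8]),(None,1,[I8,I1])])]"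

lemma tensor_table_ok: "table_ok tsrtk tens_key tensor_table"
  by code_simp

subsection \<open>The Lie algebra\<close>

lemma rho_vec: "rho = ev fb rho_vec"
proof -
  have eb: "eb ns = wedge_list (map (\<lambda>n. form1 (axis (of_nat (n - 1)) 1)) ns)" for ns
    by (rule eb_def)
  have 7: "bv i = axis (of_nat (pos i)) 1" if "i \<noteq> I8" for i
    using that by (simp add: bv_def bv_scale_def idx_def)
  have 8: "3 *\<^sub>R form1 (bv I8) = sqrt 3 *\<^sub>R form1 (axis (of_nat 7) 1)"
  proof -
    have "3 *\<^sub>R form1 (bv I8) = (3 / sqrt 3) *\<^sub>R form1 (axis (of_nat 7) 1)"
      by (simp add: bv_def bv_scale_def idx_def linear_scale[OF linear_form1])
    thus ?thesis by (simp add: real_div_sqrt)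
  qed
  have e8: "sqrt 3 *\<^sub>R ((eb [1,2] - eb [3,4]) \<^bold>\<and> eb [8]) =
      3 *\<^sub>R (form1 (bv I1) \<^bold>\<and> form1 (bv I2) \<^bold>\<and> form1 (bv I8)) -
      3 *\<^sub>R (form1 (bv I3) \<^bold>\<and> form1 (bv I4) \<^bold>\<and> form1 (bv I8))"
    unfolding wedge_scale_right[symmetric] 8
    by (simp add: eb 7 wedge_diff_left wedge_assoc wedge_scale_right scaleR_diff_right)
  show ?thesis
    unfolding rho_def e8
    by (simp add: rho_vec_def eb 7 wedge_diff_left wedge_add_left wedge_scale_left wedge_assoc)
qed

lemma form1_component: "form1 v $ {i} = v $ i"
  by (simp add: form1_def axis_def if_distrib cong: if_cong)

lemma form1_eq_0: "form1 v = 0 \<Longrightarrow> v = 0"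
  by (metis form1_component vec_eq_iff zero_index)

lemma UNIV_ixs: "set ixs = UNIV"
  by (simp add: ixs_def UNIV_ix)

lemma vecv_inner: "vecv l \<bullet> bv k = coefv k l * norm3 k / 3"
  by (induction l) (auto simp: vecv_def inner_add_left bv_inner algebra_simps)

lemma skew_mat_of:
  assumes "skew_table M"
  shows "transpose (mat_of M) = - mat_of M"
proof -
  let ?K = "mat_of M"
  have *: "(?K *v bv j) \<bullet> bv k = - (bv j \<bullet> (?K *v bv k))" for j k
  proof -
    have "coefv k (M j) * norm3 k + coefv j (M k) * norm3 j = 0"
      using assms by (simp add: skew_table_def list_all_iff UNIV_ixs)
    hence "coefv k (M j) * norm3 k = - (coefv j (M k) * norm3 j)" by simp
    hence "real_of_int (coefv k (M j) * norm3 k) = - real_of_int (coefv j (M k) * norm3 j)"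
      by (simp only: of_int_minus)
    thus ?thesis by (simp add: mat_of_bv vecv_inner inner_commute[of "bv j"])
  qed
  have 1: "(?K *v x) \<bullet> bv k = - (x \<bullet> (?K *v bv k))" for x k
    by (rule linear_eq_bv[of "\<lambda>x. (?K *v x) \<bullet> bv k" "\<lambda>x. - (x \<bullet> (?K *v bv k))"])
       (auto simp: * matrix_vector_right_distrib matrix_vector_mult_scaleR inner_add_left intro!: linearI)
  have 2: "(?K *v x) \<bullet> y = - (x \<bullet> (?K *v y))" for x y
    by (rule linear_eq_bv[of "\<lambda>y. (?K *v x) \<bullet> y" "\<lambda>y. - (x \<bullet> (?K *v y))"])
       (auto simp: 1 matrix_vector_right_distrib matrix_vector_mult_scaleR inner_add_right intro!: linearI)
  have "transpose ?K *v x = (- ?K) *v x" for x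
  proof -
    have "(transpose ?K *v x) \<bullet> y = ((- ?K) *v x) \<bullet> y" for y
    proof -
      have "(transpose ?K *v x) \<bullet> y = x \<bullet> (?K *v y)"
        by (simp add: transpose_matrix_vector dot_lmul_matrix)
      thus ?thesis by (simp add: 2 matrix_vector_minus)
    qed
    thus ?thesis by (metis vector_eq_rdot)
  qed
  thus ?thesis by (simp add: matrix_eq)
qed

lemma der_form_form1: "der_form M (form1 v) = form1 (M *v v)"
  using der_form_form1_wedge[of M v "axis {} 1"] by simp

lemma ev_fb_derk: "ev fb (lin (derk M) v) = der_form (mat_of M) (ev fb v)"
  by (rule ev_lin[OF linear_der_form]) (simp add: ev_derk)

lemma ev_tb_lin_derk: "ev tb (lin (derk M) v) = der_tens (mat_of M) (ev tb v)"
  by (rule ev_lin[OF linear_der_tens]) (simp add: ev_tb_derk)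

lemma quintic_mat_of:
  assumes "quintic_table M"
  defines "K \<equiv> mat_of M"
  shows "K ** K ** K ** K ** K = - 5 *\<^sub>R (K ** K ** K) - 4 *\<^sub>R K"
proof (rule matrix_eq_bv)
  fix j
  let ?v = "bv j"
  have f: "ev fb [([j], 1)] = form1 ?v" by simp
  have "ev fb (lin (derk M) (lin (derk M) (lin (derk M) (lin (derk M) (lin (derk M) [([j], 1)])))) @
      scl 5 (lin (derk M) (lin (derk M) (lin (derk M) [([j], 1)]))) @ scl 4 (lin (derk M) [([j], 1)])) = 0"
    using assms(1) by (intro vanish_fb) (simp add: quintic_table_def Let_def list_all_iff UNIV_ixs)
  hence "form1 (K *v (K *v (K *v (K *v (K *v ?v)))) + (5 *\<^sub>R (K *v (K *v (K *v ?v))) + 4 *\<^sub>R (K *v ?v))) = 0"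
    unfolding ev_append ev_scl ev_fb_derk f der_form_form1 K_def[symmetric]
    by (simp add: form1_lin)
  from form1_eq_0[OF this]
  have "K *v (K *v (K *v (K *v (K *v ?v)))) = - (5 *\<^sub>R (K *v (K *v (K *v ?v))) + 4 *\<^sub>R (K *v ?v))"
    by (simp only: eq_neg_iff_add_eq_0)
  thus "(K ** K ** K ** K ** K) *v ?v = (- 5 *\<^sub>R (K ** K ** K) - 4 *\<^sub>R K) *v ?v"
    by (simp add: matrix_vector_mul_assoc[symmetric] matrix_vector_mult_diff_rdistrib
        matrix_vector_minus scaleR_matrix_vector_assoc[symmetric])
qed

definition ad :: "ix \<Rightarrow> real^8^8" where "ad i = mat_of (ad_table i)"

lemma skew_flow_ad: "\<exists>A. skew_flow (ad i) A"
proof -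
  have "quintic_table (ad_table i)" "skew_table (ad_table i)" "vanish srtk (lin (derk (ad_table i)) rho_vec)"
    using quintic_ad_table skew_ad_table der_rho_ad_table by (simp_all add: list_all_iff UNIV_ixs)
  hence "\<exists>A. flow (ad i) A" "transpose (ad i) = - ad i" "der_form (ad i) rho = 0"
    unfolding ad_def rho_vec ev_fb_derk[symmetric]
    by (auto intro: quintic_flow[OF quintic_mat_of] skew_mat_of vanish_fb)
  thus ?thesis by (auto simp: skew_flow_def skew_flow_axioms_def)
qed

definition cartan :: "real^8^8" where "cartan = mat_of h_table"

text \<open>Places H inside the Lie algebra, which is why invariant subspaces are stable under
  it.\<close>

lemma cartan_eq: "cartan = ad I7 + 2 *\<^sub>R ad I8"
proof (rule matrix_eq_bv)
  have "vecv (h_table i) = vecv (ad_table I7 i) + 2 *\<^sub>R vecv (ad_table I8 i)" for i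
    by (cases i) (simp_all add: vecv_def vec_eq_iff)
  thus "cartan *v bv i = (ad I7 + 2 *\<^sub>R ad I8) *v bv i" for i
    by (simp add: cartan_def ad_def mat_of_bv matrix_vector_mult_add_rdistrib scaleR_matrix_vector_assoc[symmetric])
qed

lemma der_form_add: "der_form (M + K) \<alpha> = der_form M \<alpha> + der_form K \<alpha>"
  and der_form_scale: "der_form (c *\<^sub>R M) \<alpha> = c *\<^sub>R der_form M \<alpha>"
  by (simp_all add: der_form_def matrix_vector_mult_add_rdistrib scaleR_matrix_vector_assoc[symmetric]
      form1_lin wedge_lin sum.distrib scaleR_right.sum)

lemma der_tens_add: "der_tens (M + K) t = der_tens M t + der_tens K t"
  and der_tens_scale: "der_tens (c *\<^sub>R M) t = c *\<^sub>R der_tens M t"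
  by (simp_all add: der_tens_def matrix_vector_mult_add_rdistrib scaleR_matrix_vector_assoc[symmetric]
      der_form_add der_form_scale tensor_add_left tensor_add_right tensor_scale_left tensor_scale_right
      sum.distrib scaleR_right.sum scaleR_right_distrib)

subsection \<open>Soundness of the tables\<close>

text \<open>
  Eigenvectors of \<open>H\<^sup>2\<close> for different eigenvalues are orthogonal, so a triangular system of
  functionals is only required within each eigenspace.
\<close>

lemma weight_vectors_independent:
  fixes x :: "nat \<Rightarrow> 'v::euclidean_space"
  assumes skew: "\<And>u v. H u \<bullet> v = - (u \<bullet> H v)"
    and eig: "\<And>i. i < n \<Longrightarrow> H (H (x i)) = - ((\<kappa> i)\<^sup>2) *\<^sub>R x i" "\<And>i. i < n \<Longrightarrow> 0 \<le> \<kappa> i"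
    and \<phi>: "\<And>i. linear (\<phi> i :: 'v \<Rightarrow> real)" "\<And>i. i < n \<Longrightarrow> \<phi> i (x i) \<noteq> 0"
      "\<And>i j. i < j \<Longrightarrow> j < n \<Longrightarrow> \<kappa> j = \<kappa> i \<Longrightarrow> \<phi> i (x j) = 0"
  shows "dim (span (x ` {..<n})) = n"
proof -
  have orth: "x i \<bullet> x j = 0" if "i < n" "j < n" "\<kappa> i \<noteq> \<kappa> j" for i j
  proof -
    have "H (H (x i)) \<bullet> x j = x i \<bullet> H (H (x j))" by (simp add: skew)
    hence "((\<kappa> j)\<^sup>2 - (\<kappa> i)\<^sup>2) * (x i \<bullet> x j) = 0"
      using that by (simp add: eig algebra_simps)
    moreover have "(\<kappa> j)\<^sup>2 \<noteq> (\<kappa> i)\<^sup>2" using that eig(2) by (simp add: power2_eq_iff_nonneg)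
    ultimately show ?thesis by simp
  qed
  have zero: "c j = 0" if c: "(\<Sum>i<n. c i *\<^sub>R x i) = 0" and "j < n" for c j
    using \<open>j < n\<close>
  proof (induction j rule: less_induct)
    case (less j)
    let ?I = "{i. i < n \<and> \<kappa> i = \<kappa> j}"
    let ?s = "\<Sum>i\<in>?I. c i *\<^sub>R x i"
    let ?r = "\<Sum>i\<in>{..<n} - ?I. c i *\<^sub>R x i"
    have "(\<Sum>i<n. c i *\<^sub>R x i) = ?r + ?s"
      by (rule sum.subset_diff) auto
    hence r: "?r = - ?s" using c by (simp add: eq_neg_iff_add_eq_0)
    have "?s \<bullet> ?r = 0"
      unfolding inner_sum_left inner_sum_right by (intro sum.neutral ballI) (auto simp: orth)
    hence "?s = 0" unfolding r by simp
    hence "\<phi> j ?s = 0" using linear_0[OF \<phi>(1)] by simp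
    moreover have "\<phi> j ?s = (\<Sum>i\<in>?I. if i = j then c j * \<phi> j (x j) else 0)"
      unfolding linear_sum[OF \<phi>(1)] linear_scale[OF \<phi>(1)]
    proof (intro sum.cong refl)
      fix i assume i: "i \<in> ?I"
      show "c i *\<^sub>R \<phi> j (x i) = (if i = j then c j * \<phi> j (x j) else 0)"
        using less.IH[of i] \<phi>(3)[of j i] i by (cases i j rule: linorder_cases) auto
    qed
    ultimately show ?case using \<phi>(2)[OF less.prems] less.prems by simp
  qed
  have inj: "inj_on x {..<n}"
  proof (rule inj_onI, rule ccontr)
    fix i j assume ij: "i \<in> {..<n}" "j \<in> {..<n}" "x i = x j" "i \<noteq> j"
    let ?c = "\<lambda>l. (if l = i then 1 else 0) - (if l = j then 1 else 0) :: real"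
    have "(\<Sum>l<n. ?c l *\<^sub>R x l) = (\<Sum>l<n. (if l = i then x i else 0) - (if l = j then x j else 0))"
      by (intro sum.cong refl) auto
    also have "\<dots> = 0" using ij by (simp add: sum_subtractf)
    finally show False using zero[of ?c i] ij by auto
  qed
  have "independent (x ` {..<n})"
  proof
    assume "dependent (x ` {..<n})"
    then obtain u v where u: "v \<in> x ` {..<n}" "u v \<noteq> 0" "(\<Sum>v\<in>x ` {..<n}. u v *\<^sub>R v) = 0"
      using dependent_finite[of "x ` {..<n}"] by auto
    have "(\<Sum>i<n. u (x i) *\<^sub>R x i) = 0" using u(3) by (simp add: sum.reindex[OF inj])
    thus False using zero[of "u \<circ> x"] u(1,2) by auto
  qed
  thus ?thesis using inj by (simp add: dim_span dim_eq_card_independent card_image)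
qed

text \<open>Collects what the tables require of a representation, so that forms and tensors share
  one soundness proof.\<close>

locale weight_tables = orthogonal_representation PSU3 act
  for act :: "real^8^8 \<Rightarrow> 'v::euclidean_space \<Rightarrow> 'v" +
  fixes D :: "real^8^8 \<Rightarrow> 'v \<Rightarrow> 'v" and b :: "ix list \<Rightarrow> 'v"
    and nk :: "ix list \<Rightarrow> int \<times> ix list" and okk :: "ix list \<Rightarrow> bool"
    and crd :: "ix list \<Rightarrow> 'v \<Rightarrow> real"
  assumes linear_D: "linear (D M)"
    and ev_lin_derk: "ev b (lin (derk f) v) = D (mat_of f) (ev b v)"
    and D_skew: "transpose M = - M \<Longrightarrow> D M x \<bullet> y = - (x \<bullet> D M y)"
    and D_add: "D (M + K) x = D M x + D K x"
    and D_scale: "D (c *\<^sub>R M) x = c *\<^sub>R D M x"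
    and D_invariant: "skew_flow M A \<Longrightarrow> inv_subspace U \<Longrightarrow> x \<in> U \<Longrightarrow> D M x \<in> U"
    and vanish: "vanish nk v \<Longrightarrow> ev b v = 0"
    and linear_crd: "linear (crd q)"
    and crd_b: "okk q \<Longrightarrow> okk k \<Longrightarrow> crd q (b k) \<noteq> 0 \<longleftrightarrow> k = q"
begin

lemma ad_invariant: "inv_subspace U \<Longrightarrow> x \<in> U \<Longrightarrow> D (ad i) x \<in> U"
  using D_invariant skew_flow_ad by blast

lemma cartan_invariant: "inv_subspace U \<Longrightarrow> x \<in> U \<Longrightarrow> D cartan x \<in> U"
  unfolding cartan_eq D_add D_scale
  using invariant_subspaceD(1)[of PSU3 act U] ad_invariant by (simp add: subspace_add subspace_scale)

lemma cartan_skew: "D cartan x \<bullet> y = - (x \<bullet> D cartan y)"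
  unfolding cartan_def by (intro D_skew skew_mat_of skew_h_table)

lemma comb_in:
  assumes U: "inv_subspace U" and T: "\<And>p. ev b (look [] T p) \<in> U"
  shows "ev b (comb T r) \<in> U"
proof (induction r)
  case Nil
  thus ?case using subspace_0[OF invariant_subspaceD(1)[OF U]] by simp
next
  case (Cons y r)
  obtain x a p where y: "y = (x, a, p)" by (cases y)
  have "ev b (opx x (look [] T p)) \<in> U"
    using T[of p] ad_invariant[OF U T] by (cases x) (simp_all add: ev_lin_derk flip: ad_def)
  thus ?case
    using Cons invariant_subspaceD(1)[OF U] by (simp add: y subspace_add subspace_scale)
qed

lemma gen_ok_in:
  assumes U: "inv_subspace U"
  shows "gen_ok nk T es \<Longrightarrow> (\<And>p. ev b (look [] T p) \<in> U) \<Longrightarrow> e \<in> set es \<Longrightarrow> ev b (fst (snd e)) \<in> U"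
proof (induction es arbitrary: T)
  case (Cons f es)
  obtain p v q k c r where f: "f = (p, v, q, k, c, r)" by (cases f)
  have c: "c \<noteq> 0" "vanish nk (scl (- c) v @ comb T r)" "gen_ok nk (upd (\<lambda>_. v) [] p T) es"
    using Cons.prems(1) by (simp_all add: f)
  have "ev b v = (1 / of_int c) *\<^sub>R (of_int c *\<^sub>R ev b v)" using c(1) by simp
  also have "of_int c *\<^sub>R ev b v = ev b (comb T r)"
    using vanish[OF c(2)] by simp
  finally have "ev b v = (1 / of_int c) *\<^sub>R ev b (comb T r)" .
  moreover have "ev b (comb T r) \<in> U" by (rule comb_in[OF U Cons.prems(2)])
  ultimately have v: "ev b v \<in> U"
    using invariant_subspaceD(1)[OF U] by (simp add: subspace_scale)
  show ?case
  proof (cases "e = f")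
    case True
    thus ?thesis using v by (simp add: f)
  next
    case False
    have "ev b (look [] (upd (\<lambda>_. v) [] p T) p') \<in> U" for p'
      using v Cons.prems(2) by (simp add: look_upd)
    thus ?thesis using Cons.IH[OF c(3)] Cons.prems(3) False by auto
  qed
qed simp

lemma eig_ok_D: "eig_ok nk es \<Longrightarrow> (p, v, q, k, c, r) \<in> set es \<Longrightarrow>
    D cartan (D cartan (ev b v)) = - ((real_of_int k)\<^sup>2) *\<^sub>R ev b v"
proof (induction es)
  case (Cons f es)
  obtain p' v' q' k' c' r' where f: "f = (p', v', q', k', c', r')" by (cases f)
  show ?case
  proof (cases "(p, v, q, k, c, r) = f")
    case True
    hence "vanish nk (lin (derk h_table) (lin (derk h_table) v) @ scl (k * k) v)"
      using Cons.prems(1) by (simp add: f)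
    from vanish[OF this] show ?thesis
      by (simp add: ev_lin_derk eq_neg_iff_add_eq_0 power2_eq_square flip: cartan_def)
  next
    case False
    thus ?thesis using Cons by (auto simp: f)
  qed
qed simp

lemma crd_coef: "okk q \<Longrightarrow> keys_ok okk v \<Longrightarrow> crd q (ev b v) = of_int (coef q v) * crd q (b q)"
proof (induction v)
  case (Cons kc v)
  obtain k c where kc: "kc = (k, c)" by (cases kc)
  thus ?case using Cons crd_b[of q k]
    by (auto simp: kc linear_add[OF linear_crd] linear_scale[OF linear_crd] algebra_simps)
qed (simp add: linear_0[OF linear_crd])

lemma pivot_zero_D: "pivot_zero q k es \<Longrightarrow> (p', v', q', k, c', r') \<in> set es \<Longrightarrow> coef q v' = 0"
  by (induction es) (auto split: if_splits)

lemma pivots_ok_D: "pivots_ok okk es \<Longrightarrow> (p, v, q, k, c, r) \<in> set es \<Longrightarrow>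
    okk q \<and> keys_ok okk v \<and> 0 \<le> k \<and> coef q v \<noteq> 0"
  by (induction es) auto

lemma pivots_ok_nth: "pivots_ok okk es \<Longrightarrow> i < j \<Longrightarrow> j < length es \<Longrightarrow> es ! i = (p, v, q, k, c, r) \<Longrightarrow>
    es ! j = (p', v', q', k, c', r') \<Longrightarrow> coef q v' = 0"
proof (induction es arbitrary: i j)
  case (Cons f es)
  obtain j' where j: "j = Suc j'" using Cons.prems(2) by (cases j) auto
  have mem: "(p', v', q', k, c', r') \<in> set es" using Cons.prems(3,5) nth_mem[of j' es] by (simp add: j)
  show ?case
  proof (cases i)
    case 0
    thus ?thesis using Cons.prems(1,4) mem pivot_zero_D by auto
  next
    case (Suc i')
    moreover have "pivots_ok okk es" using Cons.prems(1) by (cases f) auto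
    ultimately show ?thesis using Cons.IH[of i' j'] Cons.prems j by simp
  qed
qed simp

lemma top_ok_D: "top_ok k0 es \<Longrightarrow> (p, v, q, k, c, r) \<in> set es \<Longrightarrow> k \<noteq> k0"
  by (induction es) auto

text \<open>The rows lie in \<open>W\<close> by generation and are independent by their pivots, so
  the upper bound on \<open>dim W\<close> makes \<open>W\<close> their span. Only then does
  \<open>irreducibleI\<close> apply, since it needs a spanning set of eigenvectors.\<close>

theorem table_irreducible:
  assumes ok: "table_ok nk okk es" and hd: "es = (p, a, q, k, c, r) # es'"
    and W: "inv_subspace W" and aW: "ev b a \<in> W" and dim: "dim W \<le> length es"
  shows "irred W" "dim W = length es"
proof -
  let ?H = "D cartan"
  obtain p' a' q' c' r' fs where es': "es' = (p', a', q', k, c', r') # fs"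
    using ok hd by (cases es') auto
  note okD = ok[unfolded hd es' table_ok.simps]
  have k: "k > 0" using okD by simp
  have ab: "?H (ev b a) = of_int k *\<^sub>R ev b a'" "?H (ev b a') = - of_int k *\<^sub>R ev b a"
    using okD vanish[of "lin (derk h_table) a @ scl (- k) a'"] vanish[of "lin (derk h_table) a' @ scl k a"]
    by (simp_all add: ev_lin_derk eq_neg_iff_add_eq_0 flip: cartan_def)
  have gen: "ev b (fst (snd e)) \<in> U" if U: "inv_subspace U" "ev b a \<in> U" "ev b a' \<in> U" "e \<in> set es" for U e
  proof (cases "e \<in> set fs")
    case True
    have "gen_ok nk (upd (\<lambda>_. a') [] p' (upd (\<lambda>_. a) [] p E)) fs" using okD by simp
    moreover have "ev b (look [] (upd (\<lambda>_. a') [] p' (upd (\<lambda>_. a) [] p E)) x) \<in> U" for x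
      using U subspace_0[OF invariant_subspaceD(1)[OF U(1)]] by (simp add: look_upd)
    ultimately show ?thesis using gen_ok_in[OF U(1)] True by blast
  next
    case False
    thus ?thesis using U by (auto simp: hd es')
  qed
  have "(1 / of_int k) *\<^sub>R ?H (ev b a) \<in> W"
    using invariant_subspaceD(1)[OF W] cartan_invariant[OF W aW] by (simp add: subspace_scale)
  hence bW: "ev b a' \<in> W" using k by (simp add: ab)
  define x where "x i = ev b (fst (snd (es ! i)))" for i
  let ?S = "x ` {..<length es}"
  have S: "?S = (\<lambda>e. ev b (fst (snd e))) ` set es"
  proof -
    have "set es = (\<lambda>i. es ! i) ` {..<length es}" by (auto simp: set_conv_nth)
    thus ?thesis unfolding x_def by (simp only: image_image)
  qed
  define key \<kappa> where "key i = fst (snd (snd (es ! i)))" and "\<kappa> i = real_of_int (fst (snd (snd (snd (es ! i)))))" for i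
  have eig: "?H (?H (x i)) = - ((\<kappa> i)\<^sup>2) *\<^sub>R x i" if "i < length es" for i
    using eig_ok_D[of es] okD nth_mem[OF that] unfolding x_def \<kappa>_def hd es'
    by (metis prod.collapse)
  have piv: "pivots_ok okk es" using okD by (simp add: hd es')
  have crd: "okk (key i) \<and> crd (key i) (x i) \<noteq> 0 \<and> 0 \<le> \<kappa> i" if "i < length es" for i
  proof -
    obtain p v q k c r where e: "es ! i = (p, v, q, k, c, r)" by (cases "es ! i")
    have "okk q \<and> keys_ok okk v \<and> 0 \<le> k \<and> coef q v \<noteq> 0"
      using pivots_ok_D[OF piv] nth_mem[OF that] unfolding e by blast
    thus ?thesis using crd_coef[of q v] crd_b[of q q] by (simp add: key_def \<kappa>_def x_def e)
  qed
  have crd0: "crd (key i) (x j) = 0" if ij: "i < j" "j < length es" "\<kappa> j = \<kappa> i" for i j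
  proof -
    obtain p v q k c r where e: "es ! i = (p, v, q, k, c, r)" by (cases "es ! i")
    obtain p' v' q' c' r' where e': "es ! j = (p', v', q', k, c', r')"
      using ij(3) by (cases "es ! j") (auto simp: e \<kappa>_def)
    have "coef q v' = 0" by (rule pivots_ok_nth[OF piv ij(1,2) e e'])
    moreover have "okk q" "keys_ok okk v'"
      using pivots_ok_D[OF piv] nth_mem[OF ij(2)] crd[of i] ij unfolding e' key_def e by auto
    ultimately show ?thesis using crd_coef[of q v'] by (simp add: key_def x_def e e')
  qed
  have dimS: "dim (span ?S) = length es"
    by (rule weight_vectors_independent[where H = ?H and \<kappa> = \<kappa> and \<phi> = "\<lambda>i. crd (key i)"])
       (use cartan_skew eig crd crd0 linear_crd in auto)
  have "span ?S \<subseteq> W"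
    using gen[OF W aW bW] invariant_subspaceD(1)[OF W] by (intro span_minimal) (auto simp: S)
  hence WS: "W = span ?S"
    using dim dimS invariant_subspaceD(1)[OF W] dim_subset[of "span ?S" W]
    by (intro subspace_dim_equal[symmetric]) auto
  show "dim W = length es" using WS dimS by simp
  show "irred W"
  proof (rule irreducibleI[OF W WS, where H = ?H and a = "ev b a" and b = "ev b a'" and k = "of_int k"])
    show "ev b a \<in> ?S" "ev b a' \<in> ?S" unfolding S by (auto simp: hd es' intro!: image_eqI)
    show "ev b a \<noteq> 0" using crd[of 0] linear_0[OF linear_crd] by (auto simp: x_def hd)
    fix s assume s: "s \<in> ?S - {ev b a, ev b a'}"
    then obtain e where e: "e \<in> set es" "s = ev b (fst (snd e))" unfolding S by blast
    obtain p v q k2 c r where e': "e = (p, v, q, k2, c, r)" by (cases e)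
    have "e \<in> set fs" using e s by (auto simp: hd es')
    hence "k2 \<noteq> k" using okD top_ok_D unfolding e' by metis
    moreover have "0 \<le> k2" using pivots_ok_D[OF piv] e(1) unfolding e' by blast
    ultimately have "- ((real_of_int k2)\<^sup>2) \<noteq> - ((of_int k)\<^sup>2)" using k by (simp add: power2_eq_iff_nonneg)
    moreover have "?H (?H s) = - ((real_of_int k2)\<^sup>2) *\<^sub>R s"
      using eig_ok_D[of es] okD e unfolding e' hd es' by (metis fst_conv snd_conv)
    ultimately show "\<exists>\<nu>. \<nu> \<noteq> - ((of_int k)\<^sup>2) \<and> ?H (?H s) = \<nu> *\<^sub>R s" by blast
  next
    show "?S \<subseteq> U" if "inv_subspace U" "ev b a \<in> U" "ev b a' \<in> U" for U
      using gen[OF that] unfolding S by blast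
  qed (use ab k linear_D cartan_skew cartan_invariant in auto)
qed

end

section \<open>The modules of forms\<close>

interpretation F: weight_tables act_form der_form fb srtk sortedk "\<lambda>q \<alpha>. \<alpha> $ (idx ` set q)"
proof (intro weight_tables.intro orthogonal_representation.intro weight_tables_axioms.intro)
  fix g assume g: "g \<in> PSU3"
  note o = PSU3_D(1)[OF g]
  have "act_form g x \<bullet> y = x \<bullet> act_form (transpose g) y" for x y
    using act_form_inner[OF o, of x "act_form (transpose g) y"] by (simp add: act_form_transpose[OF o])
  thus "\<exists>h\<in>PSU3. \<forall>x y. act_form g x \<bullet> y = x \<bullet> act_form h y"
    using PSU3_transpose[OF g] by blast
next
  show "(fb k $ (idx ` set q) \<noteq> 0) = (k = q)" if "sortedk q" "sortedk k" for q k
    using fb_component[OF that] key_scale_pos[of q] by simp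
next
  show "linear (\<lambda>\<alpha> :: form. \<alpha> $ (idx ` set q))" for q
    by (rule linearI) simp_all
qed (auto simp: linear_der_form ev_fb_derk der_form_skew der_form_add der_form_scale skew_flow.der_form_invariant
  vanish_fb)

interpretation T: weight_tables act_tens der_tens tb tsrtk tens_key
  "\<lambda>q t. t $ idx (hd q) $ (idx ` set (tl q))"
proof (intro weight_tables.intro orthogonal_representation.intro weight_tables_axioms.intro)
  fix g assume g: "g \<in> PSU3"
  note o = PSU3_D(1)[OF g]
  have "act_tens g x \<bullet> y = x \<bullet> act_tens (transpose g) y" for x y
    using act_tens_inner[OF o, of x "act_tens (transpose g) y"] by (simp add: act_tens_transpose[OF o])
  thus "\<exists>h\<in>PSU3. \<forall>x y. act_tens g x \<bullet> y = x \<bullet> act_tens h y"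
    using PSU3_transpose[OF g] by blast
next
  fix q k assume qk: "tens_key q" "tens_key k"
  then obtain i q' j k' where q: "q = i # q'" "k = j # k'" "sortedk q'" "sortedk k'"
    by (cases q; cases k) auto
  have "bv j $ idx i \<noteq> 0 \<longleftrightarrow> j = i"
    using bv_scale_pos[of j] inj_idx by (auto simp: bv_def axis_def inj_def)
  thus "(tb k $ idx (hd q) $ (idx ` set (tl q)) \<noteq> 0) = (k = q)"
    using fb_component[OF q(3,4)] key_scale_pos[of q'] by (auto simp: q tensor_def)
next
  show "linear (\<lambda>t :: tens. t $ idx (hd q) $ (idx ` set (tl q)))" for q
    by (rule linearI) simp_all
qed (auto simp: linear_der_tens ev_tb_lin_derk der_tens_skew der_tens_add der_tens_scale skew_flow.der_tens_invariant
  vanish_tb)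

section \<open>Dimension and sign rules for forms\<close>

lemma dim_Lam_le: "dim (Lam k) \<le> 8 choose k"
proof -
  let ?B = "(\<lambda>I. axis I 1 :: form) ` {I. card I = k}"
  have "Lam k \<subseteq> span ?B"
  proof
    fix \<alpha> assume \<alpha>: "\<alpha> \<in> Lam k"
    have "\<alpha> $ I *\<^sub>R axis I 1 \<in> span ?B" for I
    proof (cases "card I = k")
      case True
      thus ?thesis by (intro span_scale span_base) auto
    next
      case False
      thus ?thesis using \<alpha> by (simp add: Lam_def span_0)
    qed
    thus "\<alpha> \<in> span ?B" by (subst form_expand) (intro span_sum)
  qed
  hence "dim (Lam k) \<le> card ?B" by (intro dim_le_card) auto
  also have "\<dots> \<le> card {I :: 8 set. I \<subseteq> UNIV \<and> card I = k}"
    using card_image_le[of "{I :: 8 set. card I = k}"] by simp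
  also have "\<dots> = 8 choose k" by (subst n_subsets) auto
  finally show ?thesis .
qed

lemma act_form_0 [simp]: "act_form A 0 = 0" and act_tens_0 [simp]: "act_tens A 0 = 0"
  by (simp_all add: linear_0 linear_act_form linear_act_tens)

lemma invariant_Lam: "invariant_subspace PSU3 act_form (Lam k)"
  by (simp add: invariant_subspace_def subspace_Lam act_form_Lam)

lemma Lam_3_anticommute: "\<alpha> \<in> Lam 3 \<Longrightarrow> form1 v \<^bold>\<and> \<alpha> = - (\<alpha> \<^bold>\<and> form1 v)"
proof -
  assume \<alpha>: "\<alpha> \<in> Lam 3"
  have list: "form1 v \<^bold>\<and> wedge_list (map f is) = ((-1) ^ length is) *\<^sub>R (wedge_list (map f is) \<^bold>\<and> form1 v)"
    if "f = (\<lambda>i. form1 (axis i 1))" for f and "is" :: "8 list"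
  proof (induction "is")
    case (Cons i "is")
    thus ?case
      using form1_swap[of v "axis i 1" "wedge_list (map f is)"]
      by (simp add: that wedge_assoc wedge_scale_right)
  qed simp
  have "\<alpha> $ I *\<^sub>R (form1 v \<^bold>\<and> axis I 1) = - (\<alpha> $ I *\<^sub>R (axis I 1 \<^bold>\<and> form1 v))" for I
  proof (cases "card I = 3")
    case True
    thus ?thesis using list[OF refl, of "sorted_list_of_set I"] by (simp add: wedge_list_sorted)
  next
    case False
    thus ?thesis using \<alpha> by (simp add: Lam_def)
  qed
  hence "(\<Sum>I\<in>UNIV. \<alpha> $ I *\<^sub>R (form1 v \<^bold>\<and> axis I 1)) = (\<Sum>I\<in>UNIV. - (\<alpha> $ I *\<^sub>R (axis I 1 \<^bold>\<and> form1 v)))"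
    by (intro sum.cong refl)
  also have "\<dots> = - (\<Sum>I\<in>UNIV. \<alpha> $ I *\<^sub>R (axis I 1 \<^bold>\<and> form1 v))" by (rule sum_negf)
  finally have "form1 v \<^bold>\<and> (\<Sum>I\<in>UNIV. \<alpha> $ I *\<^sub>R axis I 1) = - ((\<Sum>I\<in>UNIV. \<alpha> $ I *\<^sub>R axis I 1) \<^bold>\<and> form1 v)"
    by (simp only: wedge_sum_left wedge_sum_right wedge_scale_left wedge_scale_right)
  thus ?thesis by (simp flip: form_expand)
qed

text \<open>Lets the factor \<open>rho\<close> change sides, so that the condition defining
  \<open>Lam3_27\<close> becomes an orthogonality relation through
  \<open>hodge_inner\<close>.\<close>

lemma rho_anticommute:
  assumes "\<alpha> \<in> Lam 3"
  shows "rho \<^bold>\<and> \<alpha> = - (\<alpha> \<^bold>\<and> rho)"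
proof -
  note c = Lam_3_anticommute[OF assms]
  have "fb [i, j, k] \<^bold>\<and> \<alpha> = - (\<alpha> \<^bold>\<and> fb [i, j, k])" for i j k
    by (simp add: wedge_assoc c wedge_minus_left wedge_minus_right)
       (simp add: c wedge_minus_left wedge_minus_right flip: wedge_assoc)
  thus ?thesis
    unfolding rho_vec rho_vec_def ev_Cons ev_Nil wedge_add_left wedge_add_right wedge_scale_left wedge_scale_right
    by simp
qed

subsection \<open>Evaluation of contractions and of the Hodge operator\<close>

definition compl :: "ix list \<Rightarrow> ix list" where
  "compl k = filter (\<lambda>i. i \<notin> set k) ixs"

text \<open>Exactly one of a word and its complement contains e_8 / sqrt 3. After multiplication by
  \<open>sqrt 3\<close> the Hodge operator is therefore integral, with factor 1 or 3.\<close>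

definition hodgek :: "ix list \<Rightarrow> vec" where
  "hodgek k = [(compl k, fst (srtk (k @ compl k)) * (if I8 \<in> set k then 1 else 3))]"

definition hodge_key :: "ix list \<Rightarrow> bool" where
  "hodge_key k \<longleftrightarrow> sortedk k \<and> sortedk (compl k) \<and> snd (srtk (k @ compl k)) = ixs"

lemma key_scale_sorted: "sortedk k \<Longrightarrow> key_scale k = (if I8 \<in> set k then 1 / sqrt 3 else 1)"
proof (induction k)
  case (Cons i k)
  have "k = []" if "i = I8"
    using sortedk_lt[OF Cons.prems, of "hd k"] that by (cases k) auto
  thus ?case using Cons sortedk_tl[OF Cons.prems] by (auto simp: key_scale_def bv_scale_def)
qed (simp add: key_scale_def)

lemma sortedk_ixs: "sortedk ixs"
  by (simp add: ixs_def)

lemma fb_ixs: "fb ixs = (1 / sqrt 3) *\<^sub>R axis UNIV 1"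
  using fb_sorted[OF sortedk_ixs] key_scale_sorted[OF sortedk_ixs] by (simp add: UNIV_ixs range_idx)

lemma hodge_axis: "hodge (axis I 1) = shuffle_sign I (- I) *\<^sub>R axis (- I) 1"
  by (auto simp: hodge_def vec_eq_iff axis_def double_complement)

lemma hodge_fb:
  assumes "hodge_key k"
  shows "sqrt 3 *\<^sub>R hodge (fb k) = ev fb (hodgek k)"
proof -
  let ?I = "idx ` set k" and ?s = "real_of_int (fst (srtk (k @ compl k)))"
  have k: "sortedk k" "sortedk (compl k)" using assms by (simp_all add: hodge_key_def)
  have "set (compl k) = - set k" by (auto simp: compl_def UNIV_ixs)
  hence c: "idx ` set (compl k) = - ?I"
    using inj_idx range_idx by (simp add: bij_image_Compl_eq bij_def)
  have I8: "I8 \<in> set (compl k) \<longleftrightarrow> I8 \<notin> set k" by (auto simp: compl_def UNIV_ixs)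
  have "fb k \<^bold>\<and> fb (compl k) = (?s / sqrt 3) *\<^sub>R axis UNIV 1"
    using fb_srtk[of "k @ compl k"] assms by (simp add: hodge_key_def fb_append fb_ixs)
  moreover have "fb k \<^bold>\<and> fb (compl k) =
      (key_scale k * key_scale (compl k) * shuffle_sign ?I (- ?I)) *\<^sub>R axis UNIV 1"
    by (simp add: fb_sorted[OF k(1)] fb_sorted[OF k(2)] c wedge_scale_left wedge_scale_right wedge_axis)
  ultimately have "key_scale k * key_scale (compl k) * shuffle_sign ?I (- ?I) = ?s / sqrt 3"
    by (metis (no_types, lifting) axis_eq_0_iff scaleR_right_imp_eq zero_neq_one)
  hence "sqrt 3 * (key_scale k * shuffle_sign ?I (- ?I)) = ?s * (if I8 \<in> set k then 1 else 3) * key_scale (compl k)"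
    by (auto simp: key_scale_sorted[OF k(1)] key_scale_sorted[OF k(2)] I8 field_simps)
  thus ?thesis
    by (simp add: hodgek_def fb_sorted[OF k(1)] fb_sorted[OF k(2)] c linear_scale[OF linear_hodge] hodge_axis)
qed

lemma hodge_ev: "keys_ok hodge_key v \<Longrightarrow> sqrt 3 *\<^sub>R hodge (ev fb v) = ev fb (lin hodgek v)"
proof (induction v)
  case (Cons kc v)
  obtain k c where kc: "kc = (k, c)" by (cases kc)
  have "sqrt 3 *\<^sub>R hodge (ev fb (kc # v)) = of_int c *\<^sub>R (sqrt 3 *\<^sub>R hodge (fb k)) + sqrt 3 *\<^sub>R hodge (ev fb v)"
    by (simp add: kc linear_add[OF linear_hodge] linear_scale[OF linear_hodge] scaleR_right_distrib mult.commute)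
  moreover have "sqrt 3 *\<^sub>R hodge (fb k) = ev fb (hodgek k)" "sqrt 3 *\<^sub>R hodge (ev fb v) = ev fb (lin hodgek v)"
    using Cons by (simp_all add: kc hodge_fb)
  ultimately show ?case by (simp only: kc lin.simps ev_append ev_scl)
qed (simp add: linear_0[OF linear_hodge])

lemma int_v_ev: "int_v (bv j) (ev fb v) = (norm3 j / 3) *\<^sub>R ev fb (lin (intk j) v)"
proof (induction v)
  case (Cons kc v)
  thus ?case
    by (cases kc) (simp add: int_v_lin ev_intk
        scaleR_right_distrib mult.commute)
qed (simp add: linear_0[OF linear_int_v])

text \<open>Three times \<open>sigma_plus\<close>. The two factors \<open>norm3 j / 3\<close> of the
  contractions, divided by the squared length of \<open>bv j\<close>, leave one such factor, and the
  three clears its denominator.\<close>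

definition sigma3 :: "vec \<Rightarrow> vec" where
  "sigma3 v = concat (map (\<lambda>j. scl (norm3 j) (wedgev (lin (intk j) rho_vec) (lin (intk j) v))) ixs)"

lemma sigma_plus_ev: "3 *\<^sub>R sigma_plus (ev fb v) = ev fb (sigma3 v)"
proof -
  have i: "int_e (idx j) \<alpha> = (1 / bv_scale j) *\<^sub>R int_v (bv j) \<alpha>" for j \<alpha>
    using bv_scale_pos[of j] by (simp add: bv_def linear_scale[OF linear_int_v_left])
  have "3 *\<^sub>R (int_e (idx j) rho \<^bold>\<and> int_e (idx j) (ev fb v)) =
      of_int (norm3 j) *\<^sub>R (ev fb (lin (intk j) rho_vec) \<^bold>\<and> ev fb (lin (intk j) v))" for j
  proof -
    have "3 * ((1 / bv_scale j * (norm3 j / 3)) * (1 / bv_scale j * (norm3 j / 3))) = norm3 j"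
      by (simp add: bv_scale_def norm3_def)
    thus ?thesis
      by (simp add: i rho_vec int_v_ev wedge_scale_left wedge_scale_right mult_ac)
  qed
  hence "3 *\<^sub>R sigma_plus (ev fb v) =
      (\<Sum>j\<in>UNIV. of_int (norm3 j) *\<^sub>R (ev fb (lin (intk j) rho_vec) \<^bold>\<and> ev fb (lin (intk j) v)))"
    by (simp add: sigma_plus_def sigma_1_int_v[unfolded One_nat_def] scaleR_right.sum sum_idx[of "\<lambda>i. 3 *\<^sub>R _ i"])
  also have "\<dots> = (\<Sum>j\<leftarrow>ixs. of_int (norm3 j) *\<^sub>R (ev fb (lin (intk j) rho_vec) \<^bold>\<and> ev fb (lin (intk j) v)))"
    by (simp add: UNIV_ix ixs_def)
  also have "\<dots> = ev fb (sigma3 v)"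
    by (simp add: sigma3_def ixs_def)
  finally show ?thesis .
qed

definition top_coef :: "int \<Rightarrow> vec \<Rightarrow> bool" where
  "top_coef c v \<longleftrightarrow> c \<noteq> 0 \<and> vanish srtk (v @ [(ixs, - c)])"

lemma top_coef: "top_coef c v \<Longrightarrow> ev fb v $ UNIV \<noteq> 0"
proof -
  assume c: "top_coef c v"
  hence "ev fb v = of_int c *\<^sub>R fb ixs"
    using vanish_fb[of "v @ [(ixs, - c)]"] by (simp add: top_coef_def)
  thus ?thesis using c by (simp add: fb_ixs top_coef_def axis_def)
qed

fun keys_len :: "nat \<Rightarrow> vec \<Rightarrow> bool" where
  "keys_len n [] \<longleftrightarrow> True"
| "keys_len n ((k, c) # v) \<longleftrightarrow> length k = n \<and> keys_len n v"

lemma ev_Lam: "keys_len n v \<Longrightarrow> ev fb v \<in> Lam n"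
proof (induction n v rule: keys_len.induct)
  case (2 n k c v)
  have "fb k \<in> Lam (length (map (\<lambda>i. form1 (bv i)) k))"
    unfolding fb_def using form1_Lam by (intro wedge_list_Lam) auto
  thus ?case using 2 by (simp add: subspace_add subspace_scale subspace_Lam)
qed (simp add: subspace_0 subspace_Lam)

definition star_rho :: vec where "star_rho = lin hodgek rho_vec"

lemma star_rho: "sqrt 3 *\<^sub>R hodge rho = ev fb star_rho"
proof -
  have "keys_ok hodge_key rho_vec" by code_simp
  thus ?thesis unfolding rho_vec star_rho_def by (rule hodge_ev)
qed

lemma wedge_star_rho_eq_0: "vanish srtk (wedgev v star_rho) \<Longrightarrow> ev fb v \<^bold>\<and> hodge rho = 0"
  using vanish_fb[of "wedgev v star_rho"] by (simp add: wedge_scale_right flip: star_rho)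

lemma Lam2_20_ev: "keys_len 2 v \<Longrightarrow> vanish srtk (wedgev v star_rho) \<Longrightarrow> ev fb v \<in> \<mm>"
  by (simp add: Lam2_20_def ev_Lam wedge_star_rho_eq_0)

lemma Lam3_27_ev:
  "keys_len 3 v \<Longrightarrow> vanish srtk (wedgev v star_rho) \<Longrightarrow> vanish srtk (wedgev v rho_vec) \<Longrightarrow> ev fb v \<in> Lam3_27"
  using vanish_fb[of "wedgev v rho_vec"] by (simp add: Lam3_27_def ev_Lam wedge_star_rho_eq_0 flip: rho_vec)

subsection \<open>Test vectors\<close>

text \<open>
  The first two vectors span the highest weight plane of \<open>\<mm>\<close>, and \<open>cubic_top\<close> lies in that of
  \<open>\<Lambda>\<^sup>3\<^sub>2\<^sub>7\<close>; the other vectors witness that equivariant maps do not vanish.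
\<close>

definition m_top :: vec where "m_top = [([I1,I6],-1),([I2,I5],1)]"
definition m_top' :: vec where "m_top' = [([I1,I5],-1),([I2,I6],-1)]"
definition m_test :: vec where "m_test = [([I5,I8],1)]"
definition cubic_top :: vec where "cubic_top = [([I1,I3,I5],1),([I1,I4,I6],-1),([I2,I3,I6],1),([I2,I4,I5],1)]"
definition cubic_test1 :: vec where "cubic_test1 = [([I1,I5,I7],1),([I1,I5,I8],-3),([I2,I6,I7],1),([I2,I6,I8],-3)]"
definition cubic_test2 :: vec where "cubic_test2 = [([I1,I3,I6],-1),([I1,I4,I5],1),([I2,I3,I5],1),([I2,I4,I6],1)]"
definition quintic_test :: vec where
  "quintic_test = [([I1,I2,I3,I4,I5],2),([I1,I2,I6,I7,I8],-6),([I1,I4,I5,I6,I7],4),([I2,I3,I5,I6,I7],4),([I3,I4,I6,I7,I8],6)]"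

lemma m_members: "ev fb m_top \<in> \<mm>" "ev fb m_top' \<in> \<mm>" "ev fb m_test \<in> \<mm>"
  by (rule Lam2_20_ev; code_simp)+

lemma cubic_members: "ev fb cubic_top \<in> Lam3_27" "ev fb cubic_test1 \<in> Lam3_27" "ev fb cubic_test2 \<in> Lam3_27"
  by (rule Lam3_27_ev; code_simp)+

lemma quintic_test: "sigma_plus (form1 (bv I5)) \<^bold>\<and> rho = ev fb quintic_test"
proof -
  have "vanish srtk (wedgev (lin (intk I5) rho_vec) rho_vec @ scl (-1) quintic_test)" by code_simp
  from vanish_fb[OF this] show ?thesis
    by (simp add: sigma_plus_form1 rho_vec int_v_ev norm3_def)
qed

text \<open>The top coefficients show, in order, that these maps are nonzero: \<open>Theta1\<close>
  on \<open>Lam3_8\<close>, \<open>Lam3_20\<close> and \<open>Lam3_27\<close>, then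
  \<open>Theta2\<close> on the Hodge images of \<open>Lam4_8\<close> and \<open>Lam4_27\<close>,
  then the Hodge image of the product with \<open>rho\<close> on \<open>\<mm>\<close>.\<close>

lemma tests:
  "top_coef (-6) (wedgev quintic_test (cons_key I1 m_top))"
  "top_coef 9 (wedgev (sigma3 m_top) (hodgek [I1,I5,I8]))"
  "top_coef (-3) (wedgev cubic_test1 (hodgek [I1,I5,I8]))"
  "top_coef (-324) (wedgev (sigma3 (lin hodgek quintic_test)) (wedgev (lin (intk I8) rho_vec) m_test))"
  "top_coef 24 (wedgev (sigma3 cubic_test2) (wedgev (lin (intk I5) rho_vec) m_test))"
  "top_coef 3 (wedgev (wedgev m_top rho_vec) [([I1,I6,I7],1)])"
  "keys_ok hodge_key quintic_test" "hodge_key [I1,I5,I8]"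
  "vanish srtk (wedgev rho_vec rho_vec)"
  by code_simp+

section \<open>Decomposition\<close>

lemmas form_image = irreducible_module_image[where G = PSU3 and act' = act_form, OF _ act_form_0]
lemmas tens_image = irreducible_module_image[where G = PSU3 and act' = act_tens, OF _ act_tens_0]

lemma equivariant_sigma_plus: "projectively_equivariant PSU3 act_form act_form sigma_plus"
  by (intro projectively_equivariantI linear_sigma_plus act_sigma_plus)

lemma equivariant_wedge_rho: "projectively_equivariant PSU3 act_form act_form (\<lambda>\<omega>. \<omega> \<^bold>\<and> rho)"
  by (intro projectively_equivariantI linear_wedge_left) (simp add: act_form_wedge PSU3_D)

lemma equivariant_hodge: "projectively_equivariant PSU3 act_form act_form hodge"
  unfolding projectively_equivariant_def
proof (intro conjI ballI linear_hodge)
  fix g assume "g \<in> PSU3"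
  then obtain c where "c * c = 1" "\<And>\<alpha>. act_form g (hodge \<alpha>) = c *\<^sub>R hodge (act_form g \<alpha>)"
    using act_form_hodge PSU3_D(1) by metis
  moreover from this have "c \<noteq> 0" by auto
  ultimately show "\<exists>c. c \<noteq> 0 \<and> (\<forall>v. act_form g (hodge v) = c *\<^sub>R hodge (act_form g v))" by blast
qed

lemma equivariant_Theta1: "projectively_equivariant PSU3 act_form act_tens Theta1"
  by (intro projectively_equivariantI linear_Theta1 act_Theta1)

lemma equivariant_Theta2: "projectively_equivariant PSU3 act_form act_tens Theta2"
  by (intro projectively_equivariantI linear_Theta2 act_Theta2)

lemmas equivariant_hodge_wedge_rho = projectively_equivariant_compose[OF equivariant_wedge_rho equivariant_hodge]

lemma tensor_R8_m: "\<omega> \<in> \<mm> \<Longrightarrow> X \<otimes>\<^sub>t \<omega> \<in> R8_m"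
  unfolding R8_m_def by (intro span_base) auto

text \<open>Turns an inner product with a monomial into a top-degree coefficient, the quantity that
  \<open>top_coef\<close> certifies.\<close>

lemma inner_fb_hodge: "hodge_key k \<Longrightarrow> sqrt 3 * (\<alpha> \<bullet> fb k) = (\<alpha> \<^bold>\<and> ev fb (hodgek k)) $ UNIV"
  unfolding hodge_fb[symmetric] by (simp add: wedge_scale_right wedge_hodge_UNIV)

lemma quintic_nonzero: "(ev fb quintic_test \<^bold>\<and> form1 (bv I1) \<^bold>\<and> ev fb m_top) $ UNIV \<noteq> 0"
  using top_coef[OF tests(1)] by (simp add: ev_cons_key)

text \<open>Pair with a decomposable tensor of \<open>R8_m\<close> and pass to \<open>Phi1\<close>
  by adjointness; what remains is a top coefficient from \<open>tests\<close>. The next nonvanishing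
  statements follow the same route.\<close>

lemma Theta1_Lam3_8: "Theta1 (hodge (ev fb quintic_test)) \<noteq> 0"
proof
  let ?u = "bv I1 \<otimes>\<^sub>t ev fb m_top"
  assume "Theta1 (hodge (ev fb quintic_test)) = 0"
  hence "hodge (ev fb quintic_test) \<bullet> Phi1 ?u = 0"
    using Theta1_adjoint[OF tensor_R8_m[OF m_members(1)], of "hodge (ev fb quintic_test)"] by simp
  thus False using quintic_nonzero by (simp add: Phi1_tensor hodge_inner)
qed

lemma Theta1_Lam3_20: "Theta1 (sigma_plus (ev fb m_top)) \<noteq> 0"
proof
  let ?u = "bv I1 \<otimes>\<^sub>t ev fb m_test"
  assume "Theta1 (sigma_plus (ev fb m_top)) = 0"
  hence "sigma_plus (ev fb m_top) \<bullet> Phi1 ?u = 0"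
    using Theta1_adjoint[OF tensor_R8_m[OF m_members(3)], of "sigma_plus (ev fb m_top)"] by simp
  hence "(3 *\<^sub>R sigma_plus (ev fb m_top)) \<bullet> fb [I1, I5, I8] = 0"
    by (simp add: Phi1_tensor m_test_def)
  hence "(ev fb (sigma3 m_top) \<^bold>\<and> ev fb (hodgek [I1,I5,I8])) $ UNIV = 0"
    unfolding sigma_plus_ev by (simp only: mult_zero_right flip: inner_fb_hodge[OF tests(8)])
  thus False using top_coef[OF tests(2)] by simp
qed

lemma Theta1_Lam3_27: "Theta1 (ev fb cubic_test1) \<noteq> 0"
proof
  let ?u = "bv I1 \<otimes>\<^sub>t ev fb m_test"
  assume "Theta1 (ev fb cubic_test1) = 0"
  hence "ev fb cubic_test1 \<bullet> Phi1 ?u = 0"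
    using Theta1_adjoint[OF tensor_R8_m[OF m_members(3)], of "ev fb cubic_test1"] by simp
  hence "ev fb cubic_test1 \<bullet> fb [I1, I5, I8] = 0"
    by (simp add: Phi1_tensor m_test_def)
  hence "(ev fb cubic_test1 \<^bold>\<and> ev fb (hodgek [I1,I5,I8])) $ UNIV = 0"
    by (simp only: mult_zero_right flip: inner_fb_hodge[OF tests(8)])
  thus False using top_coef[OF tests(3)] by simp
qed

lemma Theta2_inner_tensor:
  assumes "\<omega> \<in> \<mm>"
  shows "Theta2 (hodge \<alpha>) \<bullet> (X \<otimes>\<^sub>t \<omega>) = - ((\<alpha> \<^bold>\<and> int_v X rho \<^bold>\<and> \<omega>) $ UNIV)"
  using Theta2_adjoint[OF tensor_R8_m[OF assms], of "hodge \<alpha>"] by (simp add: Phi2_tensor' hodge_inner)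

text \<open>A nonzero pairing is recorded, not merely a nonzero vector: the test tensor lies in the
  kernel of \<open>Phi1\<close>, and \<open>W1_neq_W4\<close> exploits this.
  \<open>Theta2_Lam4_27\<close> is arranged likewise for \<open>W3_neq_W5\<close>.\<close>

lemma Theta2_Lam4_8:
  "Theta2 (hodge (sigma_plus (hodge (ev fb quintic_test)))) \<bullet> (bv I8 \<otimes>\<^sub>t ev fb m_test) \<noteq> 0"
proof
  let ?\<alpha> = "sigma_plus (hodge (ev fb quintic_test))"
  assume "Theta2 (hodge ?\<alpha>) \<bullet> (bv I8 \<otimes>\<^sub>t ev fb m_test) = 0"
  hence "(?\<alpha> \<^bold>\<and> ev fb (lin (intk I8) rho_vec) \<^bold>\<and> ev fb m_test) $ UNIV = 0"
    by (simp add: Theta2_inner_tensor[OF m_members(3)] rho_vec int_v_ev norm3_def wedge_scale_left wedge_scale_right)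
  hence "(((3 * sqrt 3) *\<^sub>R ?\<alpha>) \<^bold>\<and> ev fb (lin (intk I8) rho_vec) \<^bold>\<and> ev fb m_test) $ UNIV = 0"
    by (simp add: wedge_scale_left)
  moreover have "(3 * sqrt 3) *\<^sub>R ?\<alpha> = ev fb (sigma3 (lin hodgek quintic_test))"
    by (simp add: linear_scale[OF linear_sigma_plus] flip: sigma_plus_ev hodge_ev[OF tests(7)])
  ultimately show False using top_coef[OF tests(4)] by simp
qed

lemma Theta2_Lam4_27:
  "Theta2 (hodge (sigma_plus (ev fb cubic_test2))) \<bullet> (bv I5 \<otimes>\<^sub>t ev fb m_test) \<noteq> 0"
proof
  let ?\<alpha> = "sigma_plus (ev fb cubic_test2)"
  assume "Theta2 (hodge ?\<alpha>) \<bullet> (bv I5 \<otimes>\<^sub>t ev fb m_test) = 0"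
  hence "(?\<alpha> \<^bold>\<and> ev fb (lin (intk I5) rho_vec) \<^bold>\<and> ev fb m_test) $ UNIV = 0"
    by (simp add: Theta2_inner_tensor[OF m_members(3)] rho_vec int_v_ev norm3_def wedge_scale_left wedge_scale_right)
  hence "((3 *\<^sub>R ?\<alpha>) \<^bold>\<and> ev fb (lin (intk I5) rho_vec) \<^bold>\<and> ev fb m_test) $ UNIV = 0"
    by (simp add: wedge_scale_left)
  thus False using top_coef[OF tests(5)] unfolding sigma_plus_ev by simp
qed

section \<open>Irreducibility of the modules of forms\<close>

lemma irreducible_Lam_1: "irreducible_module PSU3 act_form (Lam 1)" "dim (Lam 1) = 8"
proof -
  have a: "ev fb [([I1], 1)] \<in> Lam 1" by (rule ev_Lam) simp
  have d: "dim (Lam 1) \<le> length vector_table"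
    using dim_Lam_le[of 1] by (simp add: vector_table_def)
  show "irreducible_module PSU3 act_form (Lam 1)"
    by (rule F.table_irreducible(1)[OF vector_table_ok vector_table_def invariant_Lam a d])
  show "dim (Lam 1) = 8"
    using F.table_irreducible(2)[OF vector_table_ok vector_table_def invariant_Lam a d]
    by (simp add: vector_table_def)
qed

lemma irreducible_Lam2_8: "irreducible_module PSU3 act_form Lam2_8" "dim Lam2_8 = 8"
proof -
  have nz: "sigma_plus (form1 (bv I5)) \<noteq> 0"
  proof
    assume "sigma_plus (form1 (bv I5)) = 0"
    hence "ev fb quintic_test = 0" unfolding quintic_test[symmetric] by simp
    thus False using quintic_nonzero by simp
  qed
  note im = form_image[OF equivariant_sigma_plus irreducible_Lam_1(1) form1_Lam nz]
  show "irreducible_module PSU3 act_form Lam2_8" "dim Lam2_8 = 8"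
    using im irreducible_Lam_1(2) by (simp_all add: Lam2_8_def)
qed

text \<open>A vanishing product with \<open>hodge rho\<close> implies orthogonality to every
  contraction of \<open>rho\<close>, that is, to \<open>Lam2_8\<close>; this leaves 28 - 8.\<close>

lemma dim_Lam2_20_le: "dim \<mm> \<le> 20"
proof -
  note Lam2_8_subset
  moreover have "subspace Lam2_8"
    using irreducible_Lam2_8(1) by (auto dest!: irreducible_moduleD(1) invariant_subspaceD(1))
  ultimately have "dim {y \<in> Lam 2. \<forall>x\<in>Lam2_8. orthogonal x y} + dim Lam2_8 = dim (Lam 2)"
    by (intro dim_subspace_orthogonal_to_vectors subspace_Lam)
  moreover have "\<mm> \<subseteq> {y \<in> Lam 2. \<forall>x\<in>Lam2_8. orthogonal x y}"
  proof safe
    fix \<omega> \<xi> assume \<omega>: "\<omega> \<in> \<mm>" and "\<xi> \<in> Lam2_8"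
    then obtain X where \<xi>: "\<xi> = int_v X rho" by (auto simp: Lam2_8_eq)
    have "\<xi> \<bullet> \<omega> = ((form1 X \<^bold>\<and> \<omega>) \<^bold>\<and> hodge rho) $ UNIV"
      unfolding wedge_hodge_UNIV \<xi> int_v_adjoint by (rule inner_commute)
    also have "\<dots> = 0" using \<omega> by (simp add: wedge_assoc Lam2_20_def)
    finally show "orthogonal \<xi> \<omega>" by (simp add: orthogonal_def)
  qed (auto simp: Lam2_20_def)
  hence "dim \<mm> \<le> dim {y \<in> Lam 2. \<forall>x\<in>Lam2_8. orthogonal x y}" by (rule dim_subset)
  moreover have "dim (Lam 2) \<le> 28" using dim_Lam_le[of 2] by (simp add: choose_two)
  ultimately show ?thesis using irreducible_Lam2_8(2) by simp
qed

lemma irreducible_Lam2_20: "irreducible_module PSU3 act_form \<mm>" "dim \<mm> = 20"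
proof -
  have inv: "invariant_subspace PSU3 act_form \<mm>"
    by (simp add: invariant_subspace_def subspace_Lam2_20 act_Lam2_20)
  have d: "dim \<mm> \<le> length m_table"
    using dim_Lam2_20_le by (simp add: m_table_def)
  note t = F.table_irreducible[OF m_table_ok m_table_def inv m_members(1)[unfolded m_top_def] d]
  show "irreducible_module PSU3 act_form \<mm>" by (rule t(1))
  show "dim \<mm> = 20" using t(2) by (simp add: m_table_def)
qed

lemma Lam3_8_eq: "Lam3_8 = (\<lambda>\<omega>. hodge (\<omega> \<^bold>\<and> rho)) ` Lam2_8"
  by (auto simp: Lam3_8_def)

lemma irreducible_Lam3_8: "irreducible_module PSU3 act_form Lam3_8" "dim Lam3_8 = 8"
proof -
  have "hodge (sigma_plus (form1 (bv I5)) \<^bold>\<and> rho) \<noteq> 0"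
    using Theta1_Lam3_8 linear_0[OF linear_Theta1] unfolding quintic_test by auto
  moreover have "sigma_plus (form1 (bv I5)) \<in> Lam2_8"
    unfolding Lam2_8_def using form1_Lam by blast
  ultimately show "irreducible_module PSU3 act_form Lam3_8" "dim Lam3_8 = 8"
    using form_image[OF equivariant_hodge_wedge_rho irreducible_Lam2_8(1)] irreducible_Lam2_8(2)
    by (simp_all add: Lam3_8_eq)
qed

lemma quintic_Lam3_8: "hodge (ev fb quintic_test) \<in> Lam3_8"
  unfolding Lam3_8_eq Lam2_8_def quintic_test[symmetric] using form1_Lam by blast

lemma invariant_Lam3_27: "invariant_subspace PSU3 act_form Lam3_27"
  unfolding invariant_subspace_def
proof (intro conjI ballI)
  show "subspace Lam3_27"
    by (auto simp: subspace_def Lam3_27_def Lam_def wedge_lin)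
  fix g T assume g: "g \<in> PSU3" and T: "T \<in> Lam3_27"
  obtain c where "c * c = 1" "act_form g (hodge rho) = c *\<^sub>R hodge (act_form g rho)"
    using act_form_hodge[OF PSU3_D(1)[OF g]] by metis
  moreover have "act_form g (T \<^bold>\<and> hodge rho) = 0" "act_form g (T \<^bold>\<and> rho) = 0"
    using T by (simp_all add: Lam3_27_def)
  ultimately show "act_form g T \<in> Lam3_27"
    using T g by (auto simp: act_form_wedge Lam3_27_def act_form_Lam PSU3_D wedge_scale_right)
qed

text \<open>The two conditions on \<open>T\<close> give orthogonality to \<open>rho\<close> and to
  the Hodge images of all products of a two-form with \<open>rho\<close>. Those images contain
  modules of dimensions 8 and 20, orthogonal to each other by irreducibility and to
  \<open>rho\<close> because \<open>rho\<close> squares to zero. This leaves 56 - 8 - 20 -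
  1.\<close>

lemma dim_Lam3_27_le: "dim Lam3_27 \<le> 27"
proof -
  let ?f = "\<lambda>\<omega>. hodge (\<omega> \<^bold>\<and> rho)"
  have "?f (ev fb m_top) \<noteq> 0"
  proof
    assume "?f (ev fb m_top) = 0"
    hence "?f (ev fb m_top) \<bullet> fb [I1,I6,I7] = 0" by simp
    thus False using top_coef[OF tests(6)] by (simp add: hodge_inner rho_vec)
  qed
  note V20 = form_image[OF equivariant_hodge_wedge_rho irreducible_Lam2_20(1) m_members(1) this]
  let ?V = "?f ` \<mm>"
  let ?A = "[Lam3_8, ?V, span {rho}]"
  have s: "subspace U" if "U \<in> set ?A" for U
    using that irreducible_Lam3_8(1) V20(1) by (auto dest!: irreducible_moduleD(1) invariant_subspaceD(1))
  have rr: "rho \<^bold>\<and> rho = 0" using vanish_fb[OF tests(9)] by (simp add: rho_vec)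
  have rho_orth: "?f \<omega> \<bullet> (c *\<^sub>R rho) = 0" for \<omega> c
    by (simp add: hodge_inner wedge_assoc rr)
  have d: "dim (sum_space ?A) = sum_list (map dim ?A)"
  proof (rule dim_sum_space[OF s])
    fix us assume "list_all2 (\<in>) us ?A" "sum_list us = 0"
    then obtain x y z where us: "us = [x, y, z]" "x \<in> Lam3_8" "y \<in> ?V" "z \<in> span {rho}" "x + y + z = 0"
      by (auto simp: list_all2_Cons2 add.assoc)
    have "x \<bullet> y = 0"
      by (rule F.irreducible_orthogonal[OF irreducible_Lam3_8(1) V20(1) _ us(2,3)])
         (simp add: V20(2) irreducible_Lam3_8(2) irreducible_Lam2_20(2))
    moreover have "x \<bullet> z = 0" "y \<bullet> z = 0"
      using us(2-4) rho_orth by (auto simp: Lam3_8_eq span_singleton)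
    ultimately have "x \<bullet> x = 0" "y \<bullet> y = 0" "z \<bullet> z = 0"
      using arg_cong[OF us(5), of "\<lambda>t. x \<bullet> t"] arg_cong[OF us(5), of "\<lambda>t. y \<bullet> t"]
        arg_cong[OF us(5), of "\<lambda>t. z \<bullet> t"]
      by (simp_all add: inner_add_right inner_commute)
    thus "set us \<subseteq> {0}" by (simp add: us(1))
  qed
  have "rho \<noteq> 0"
    using quintic_nonzero by (auto simp flip: quintic_test)
  hence "dim (span {rho}) = 1" by (simp add: dim_singleton)
  hence d: "dim (sum_space ?A) = 29"
    using d irreducible_Lam3_8(2) V20(2) irreducible_Lam2_20(2) by simp
  have hodge_Lam: "?f \<omega> \<in> Lam 3" if "\<omega> \<in> Lam 2" for \<omega>
  proof -
    have w: "\<omega> \<^bold>\<and> rho \<in> Lam 5" using wedge_Lam[OF that rho_Lam] by simp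
    have "(\<omega> \<^bold>\<and> rho) $ (- K) = 0" if "card K \<noteq> 3" for K
    proof -
      have "card (- K) = 8 - card K" "card K \<le> 8"
        using card_mono[of UNIV K] by (simp_all add: Compl_eq_Diff_UNIV card_Diff_subset)
      hence "card (- K) \<noteq> 5" using that by linarith
      thus ?thesis using w unfolding Lam_def by blast
    qed
    thus ?thesis by (simp add: Lam_def hodge_def)
  qed
  have form: "\<exists>\<omega> c. \<omega> \<in> Lam 2 \<and> x = ?f \<omega> + c *\<^sub>R rho" if x: "x \<in> sum_space ?A" for x
  proof -
    obtain \<omega>1 \<omega>2 c where w: "\<omega>1 \<in> Lam2_8" "\<omega>2 \<in> \<mm>" "x = ?f \<omega>1 + (?f \<omega>2 + c *\<^sub>R rho)"
      using x by (auto simp: sum_space_Cons sum_space_Nil Lam3_8_eq span_singleton)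
    have "\<omega>1 + \<omega>2 \<in> Lam 2" using w(1,2) Lam2_8_subset by (auto simp: Lam2_20_def intro: subspace_add[OF subspace_Lam])
    moreover have "x = ?f (\<omega>1 + \<omega>2) + c *\<^sub>R rho"
      by (simp add: w(3) wedge_add_left linear_add[OF linear_hodge])
    ultimately show ?thesis by blast
  qed
  have "sum_space ?A \<subseteq> Lam 3"
    using form hodge_Lam rho_Lam by (fastforce intro: subspace_add[OF subspace_Lam] subspace_scale[OF subspace_Lam])
  moreover have "subspace (sum_space ?A)" by (rule subspace_sum_space[OF s])
  ultimately have "dim {y \<in> Lam 3. \<forall>x\<in>sum_space ?A. orthogonal x y} + dim (sum_space ?A) = dim (Lam 3)"
    by (intro dim_subspace_orthogonal_to_vectors subspace_Lam)
  moreover have "Lam3_27 \<subseteq> {y \<in> Lam 3. \<forall>x\<in>sum_space ?A. orthogonal x y}"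
  proof safe
    fix T x assume T: "T \<in> Lam3_27" and "x \<in> sum_space ?A"
    then obtain \<omega> c where x: "x = ?f \<omega> + c *\<^sub>R rho" using form by blast
    have "T \<bullet> rho = 0"
      using T wedge_hodge_UNIV[of T rho] by (simp add: Lam3_27_def)
    moreover have "?f \<omega> \<bullet> T = 0"
      using T rho_anticommute[of T] by (simp add: hodge_inner wedge_assoc Lam3_27_def)
    ultimately show "orthogonal x T"
      by (simp add: x orthogonal_def inner_add_left inner_add_right inner_commute)
  qed (auto simp: Lam3_27_def)
  hence "dim Lam3_27 \<le> dim {y \<in> Lam 3. \<forall>x\<in>sum_space ?A. orthogonal x y}" by (rule dim_subset)
  moreover have "(8 :: nat) choose 3 = 56" by code_simp
  hence "dim (Lam 3) \<le> 56" using dim_Lam_le[of 3] by simp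
  ultimately show ?thesis using d by simp
qed

lemma irreducible_Lam3_27: "irreducible_module PSU3 act_form Lam3_27" "dim Lam3_27 = 27"
proof -
  have d: "dim Lam3_27 \<le> length cubic_table"
    using dim_Lam3_27_le by (simp add: cubic_table_def)
  note t = F.table_irreducible[OF cubic_table_ok cubic_table_def invariant_Lam3_27
      cubic_members(1)[unfolded cubic_top_def] d]
  show "irreducible_module PSU3 act_form Lam3_27" by (rule t(1))
  show "dim Lam3_27 = 27" using t(2) by (simp add: cubic_table_def)
qed

section \<open>Irreducibility of \<open>W1\<close> to \<open>W5\<close>\<close>

lemma irreducible_W1: "irreducible_module PSU3 act_tens W1" "dim W1 = 8"
  using tens_image[OF equivariant_Theta1 irreducible_Lam3_8(1) quintic_Lam3_8 Theta1_Lam3_8] irreducible_Lam3_8(2)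
  by (simp_all add: W1_def)

lemma irreducible_W2: "irreducible_module PSU3 act_tens W2" "dim W2 = 20"
  using tens_image[OF projectively_equivariant_compose[OF equivariant_sigma_plus equivariant_Theta1]
      irreducible_Lam2_20(1) m_members(1) Theta1_Lam3_20] irreducible_Lam2_20(2)
  by (simp_all add: W2_def Lam3_20_def image_image)

lemma irreducible_W3: "irreducible_module PSU3 act_tens W3" "dim W3 = 27"
  using tens_image[OF equivariant_Theta1 irreducible_Lam3_27(1) cubic_members(2) Theta1_Lam3_27] irreducible_Lam3_27(2)
  by (simp_all add: W3_def)

lemmas equivariant_Theta2_hodge_sigma_plus =
  projectively_equivariant_compose[OF projectively_equivariant_compose[OF equivariant_sigma_plus equivariant_hodge]
    equivariant_Theta2]

lemma irreducible_W4: "irreducible_module PSU3 act_tens W4" "dim W4 = 8"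
proof -
  have "Theta2 (hodge (sigma_plus (hodge (ev fb quintic_test)))) \<noteq> 0"
    using Theta2_Lam4_8 by auto
  from tens_image[OF equivariant_Theta2_hodge_sigma_plus irreducible_Lam3_8(1) quintic_Lam3_8 this]
  show "irreducible_module PSU3 act_tens W4" "dim W4 = 8"
    using irreducible_Lam3_8(2) by (simp_all add: W4_def Lam4_8_def image_image)
qed

lemma irreducible_W5: "irreducible_module PSU3 act_tens W5" "dim W5 = 27"
proof -
  have "Theta2 (hodge (sigma_plus (ev fb cubic_test2))) \<noteq> 0"
    using Theta2_Lam4_27 by auto
  from tens_image[OF equivariant_Theta2_hodge_sigma_plus irreducible_Lam3_27(1) cubic_members(3) this]
  show "irreducible_module PSU3 act_tens W5" "dim W5 = 27"
    using irreducible_Lam3_27(2) by (simp_all add: W5_def Lam4_27_def image_image)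
qed

section \<open>Separation of the summands and count of dimensions\<close>

lemma Theta1_ker_Phi1: "t \<in> R8_m \<Longrightarrow> Phi1 t = 0 \<Longrightarrow> x \<in> Theta1 ` S \<Longrightarrow> x \<bullet> t = 0"
  by (auto simp: Theta1_adjoint)

lemma Theta2_ker_Phi2: "t \<in> R8_m \<Longrightarrow> Phi2 t = 0 \<Longrightarrow> x \<in> Theta2 ` S \<Longrightarrow> x \<bullet> t = 0"
  by (auto simp: Theta2_adjoint)

text \<open>\<open>W1\<close> is orthogonal to the kernel of \<open>Phi1\<close>. The test tensor
  lies in that kernel because its factor e_8 repeats, yet it pairs nontrivially with a member of
  \<open>W4\<close>. For \<open>W3_neq_W5\<close> the repeated factor is e_5.\<close>

lemma W1_neq_W4: "W1 \<noteq> W4"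
proof
  let ?u = "bv I8 \<otimes>\<^sub>t ev fb m_test"
  assume "W1 = W4"
  moreover have "Theta2 (hodge (sigma_plus (hodge (ev fb quintic_test)))) \<in> W4"
    unfolding W4_def Lam4_8_def using quintic_Lam3_8 by blast
  moreover have "Phi1 ?u = 0"
    using form1_swap[of "bv I8" "bv I5" "form1 (bv I8)"] form1_twice[of "bv I8" "axis {} 1"]
    by (simp add: Phi1_tensor m_test_def)
  ultimately show False
    using Theta1_ker_Phi1[OF tensor_R8_m[OF m_members(3)], of "bv I8"] Theta2_Lam4_8 unfolding W1_def by blast
qed

lemma W3_neq_W5: "W3 \<noteq> W5"
proof
  let ?u = "bv I5 \<otimes>\<^sub>t ev fb m_test"
  assume "W3 = W5"
  moreover have "Theta2 (hodge (sigma_plus (ev fb cubic_test2))) \<in> W5"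
    unfolding W5_def Lam4_27_def using cubic_members(3) by blast
  moreover have "Phi1 ?u = 0"
    by (simp add: Phi1_tensor m_test_def)
  ultimately show False
    using Theta1_ker_Phi1[OF tensor_R8_m[OF m_members(3)], of "bv I5"] Theta2_Lam4_27 unfolding W3_def by blast
qed

lemma dim_R8_m_le: "dim R8_m \<le> 160"
proof -
  obtain B where B: "B \<subseteq> \<mm>" "independent B" "\<mm> \<subseteq> span B" "card B = dim \<mm>"
    using basis_exists by metis
  let ?C = "(\<lambda>(i, \<omega>). axis i 1 \<otimes>\<^sub>t \<omega>) ` (UNIV \<times> B)"
  have fin: "finite B" using B(2) by (rule independent_imp_finite)
  have l: "linear (\<lambda>\<omega>. axis i 1 \<otimes>\<^sub>t \<omega>)" for i :: 8
    by (rule linearI) (simp_all add: tensor_add_right tensor_scale_right)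
  have "axis i 1 \<otimes>\<^sub>t \<omega> \<in> span ?C" if "\<omega> \<in> \<mm>" for i \<omega>
  proof -
    have "axis i 1 \<otimes>\<^sub>t \<omega> \<in> (\<lambda>\<omega>. axis i 1 \<otimes>\<^sub>t \<omega>) ` span B" using that B(3) by blast
    also have "\<dots> = span ((\<lambda>\<omega>. axis i 1 \<otimes>\<^sub>t \<omega>) ` B)" by (rule linear_span_image[OF l, symmetric])
    also have "\<dots> \<subseteq> span ?C" by (intro span_mono) auto
    finally show ?thesis .
  qed
  hence "R8_m \<subseteq> span ?C"
    using tens_expand by (metis (no_types, lifting) R8_m_iff span_sum subsetI)
  hence "dim R8_m \<le> card ?C" using fin by (intro dim_le_card) auto
  also have "\<dots> \<le> card ((UNIV :: 8 set) \<times> B)" using fin by (intro card_image_le) auto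
  also have "\<dots> = 160" using B(4) irreducible_Lam2_20(2) by (simp add: card_cartesian_product)
  finally show ?thesis .
qed

lemma W_subset: "W1 \<subseteq> R8_m" "W2 \<subseteq> R8_m" "W3 \<subseteq> R8_m" "W4 \<subseteq> R8_m" "W5 \<subseteq> R8_m" "W6 \<subseteq> R8_m"
  by (auto simp: W1_def W2_def W3_def W4_def W5_def W6_def Theta1_R8_m Theta2_R8_m)

lemma W6_orthogonal:
  assumes "t \<in> W6" "x \<in> W1 \<or> x \<in> W2 \<or> x \<in> W3 \<or> x \<in> W4 \<or> x \<in> W5"
  shows "x \<bullet> t = 0"
  using assms Theta1_ker_Phi1[of t x] Theta2_ker_Phi2[of t x]
  unfolding W1_def W2_def W3_def W4_def W5_def W6_def by blast

lemmas W_irreducible = irreducible_W1(1) irreducible_W2(1) irreducible_W3(1) irreducible_W4(1) irreducible_W5(1)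
lemmas W_dim = irreducible_W1(2) irreducible_W2(2) irreducible_W3(2) irreducible_W4(2) irreducible_W5(2)

lemma W_independent:
  assumes "list_all2 (\<in>) us [W1, W2, W3, W4, W5, W6]" "sum_list us = 0"
  shows "set us \<subseteq> {0}"
proof -
  obtain u1 u2 u3 u4 u5 u6 where us: "us = [u1, u2, u3, u4, u5, u6]" and
    u: "u1 \<in> W1" "u2 \<in> W2" "u3 \<in> W3" "u4 \<in> W4" "u5 \<in> W5" "u6 \<in> W6"
    using assms(1) by (auto simp: list_all2_Cons2)
  note orth = T.irreducible_orthogonal[OF W_irreducible(1) W_irreducible(2) _ u(1,2)]
    T.irreducible_orthogonal[OF W_irreducible(1) W_irreducible(3) _ u(1,3)]
    T.irreducible_orthogonal[OF W_irreducible(1) W_irreducible(5) _ u(1,5)]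
    T.irreducible_orthogonal[OF W_irreducible(2) W_irreducible(3) _ u(2,3)]
    T.irreducible_orthogonal[OF W_irreducible(4) W_irreducible(2) _ u(4,2)]
    T.irreducible_orthogonal[OF W_irreducible(2) W_irreducible(5) _ u(2,5)]
    T.irreducible_orthogonal[OF W_irreducible(4) W_irreducible(3) _ u(4,3)]
    T.irreducible_orthogonal[OF W_irreducible(4) W_irreducible(5) _ u(4,5)]
  note orth = orth[unfolded W_dim, simplified]
  \<comment> \<open>\<open>W1\<close>, \<open>W4\<close> and likewise \<open>W3\<close>,
    \<open>W5\<close> have equal dimension, so orthogonality is available only between
    \<open>a\<close>, \<open>u2\<close>, \<open>c\<close> and \<open>u6\<close>. Within a pair,
    distinct irreducible modules still meet in zero.\<close>
  define a c where "a = u1 + u4" and "c = u3 + u5"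
  have o: "a \<bullet> u2 = 0" "a \<bullet> c = 0" "u2 \<bullet> c = 0" "a \<bullet> u6 = 0" "u2 \<bullet> u6 = 0" "c \<bullet> u6 = 0"
    using orth u W6_orthogonal[OF u(6)] by (simp_all add: a_def c_def inner_add_left inner_add_right)
  have sum: "a + (u2 + (c + u6)) = 0"
    using assms(2) by (simp add: us a_def c_def algebra_simps)
  have "a \<bullet> a = 0" "u2 \<bullet> u2 = 0" "c \<bullet> c = 0" "u6 \<bullet> u6 = 0"
    using arg_cong[OF sum, of "\<lambda>t. a \<bullet> t"] arg_cong[OF sum, of "\<lambda>t. u2 \<bullet> t"]
      arg_cong[OF sum, of "\<lambda>t. c \<bullet> t"] arg_cong[OF sum, of "\<lambda>t. u6 \<bullet> t"] o
    by (simp_all add: inner_add_right inner_commute)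
  hence 0: "a = 0" "u2 = 0" "c = 0" "u6 = 0" by simp_all
  have sub: "subspace W1" "subspace W3"
    using W_irreducible by (auto dest!: irreducible_moduleD(1) invariant_subspaceD(1))
  have "u4 = - u1" "u5 = - u3" using 0 by (simp_all add: a_def c_def eq_neg_iff_add_eq_0 add.commute)
  hence "u4 \<in> W1 \<inter> W4" "u5 \<in> W3 \<inter> W5" using u sub by (auto simp: subspace_neg)
  hence "u4 = 0" "u5 = 0"
    using irreducible_module_Int[OF W_irreducible(1,4) W1_neq_W4] irreducible_module_Int[OF W_irreducible(3,5) W3_neq_W5]
    by auto
  thus ?thesis using 0 by (simp add: us a_def c_def)
qed

lemma invariant_W6: "invariant_subspace PSU3 act_tens W6"
  unfolding invariant_subspace_def
proof (intro conjI ballI)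
  show "subspace W6"
    using subspace_R8_m unfolding subspace_def W6_def
    by (auto simp: linear_0 linear_add linear_scale linear_Phi1 linear_Phi2)
  show "act_tens g t \<in> W6" if "g \<in> PSU3" "t \<in> W6" for g t
    using that by (auto simp: W6_def act_R8_m simp flip: act_Phi1 act_Phi2)
qed

text \<open>\<open>W6\<close> is orthogonal to the other five summands, which leaves 160 - (8 + 20 +
  27 + 8 + 27).\<close>

lemma dim_W6_le: "dim W6 \<le> 70"
proof -
  let ?A = "[W1, W2, W3, W4, W5]"
  have s: "subspace U" if "U \<in> set ?A" for U
    using that W_irreducible by (auto dest!: irreducible_moduleD(1) invariant_subspaceD(1))
  have "dim (sum_space ?A) = sum_list (map dim ?A)"
  proof (rule dim_sum_space[OF s])
    fix us assume "list_all2 (\<in>) us ?A" "sum_list us = 0"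
    \<comment> \<open>Padding with the zero of \<open>W6\<close> reduces the claim to the
      independence of all six.\<close>
    hence "list_all2 (\<in>) (us @ [0]) (?A @ [W6])" "sum_list (us @ [0]) = 0"
      using subspace_0[OF invariant_subspaceD(1)[OF invariant_W6]] by (auto simp: list_all2_Cons2)
    thus "set us \<subseteq> {0}" using W_independent[of "us @ [0]"] by simp
  qed
  hence d: "dim (sum_space ?A) = 90" by (simp add: W_dim)
  have "sum_space ?A \<subseteq> R8_m"
    using W_subset by (auto simp: sum_space_Cons sum_space_Nil intro!: subspace_add[OF subspace_R8_m])
  hence "dim {y \<in> R8_m. \<forall>x\<in>sum_space ?A. orthogonal x y} + dim (sum_space ?A) = dim R8_m"
    by (intro dim_subspace_orthogonal_to_vectors subspace_R8_m subspace_sum_space[OF s])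
  moreover have "W6 \<subseteq> {y \<in> R8_m. \<forall>x\<in>sum_space ?A. orthogonal x y}"
    using W6_orthogonal W_subset(6)
    by (auto simp: sum_space_Cons sum_space_Nil orthogonal_def inner_add_left)
  hence "dim W6 \<le> dim {y \<in> R8_m. \<forall>x\<in>sum_space ?A. orthogonal x y}" by (rule dim_subset)
  ultimately show ?thesis using d dim_R8_m_le by simp
qed

lemma irreducible_W6: "irreducible_module PSU3 act_tens W6" "dim W6 = 70"
proof -
  \<comment> \<open>The imaginary part of the product of the complex highest weight vectors of the
    two factors, \<open>bv I1\<close> + i \<open>bv I2\<close> and \<open>m_top\<close> + i
    \<open>m_top'\<close>. It is a highest weight vector of the Cartan product, the first row of
    \<open>tensor_table\<close>.\<close>
  let ?v = "cons_key I1 m_top' @ cons_key I2 m_top"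
  have ev: "ev tb ?v = bv I1 \<otimes>\<^sub>t ev fb m_top' + bv I2 \<otimes>\<^sub>t ev fb m_top"
    by (simp add: ev_tb_cons_key)
  have "Phi1 (ev tb ?v) = ev fb ?v"
    unfolding ev by (simp add: linear_add[OF linear_Phi1] Phi1_tensor ev_cons_key)
  also have "\<dots> = 0" by (rule vanish_fb) code_simp
  finally have 1: "Phi1 (ev tb ?v) = 0" .
  have "Phi2 (ev tb ?v) = ev fb (wedgev (lin (intk I1) rho_vec) m_top' @ wedgev (lin (intk I2) rho_vec) m_top)"
    unfolding ev by (simp add: linear_add[OF linear_Phi2] Phi2_tensor' rho_vec int_v_ev norm3_def)
  also have "\<dots> = 0" by (rule vanish_fb) code_simp
  finally have 2: "Phi2 (ev tb ?v) = 0" .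
  have "ev tb ?v \<in> R8_m"
    unfolding ev by (intro subspace_add[OF subspace_R8_m] tensor_R8_m m_members)
  hence "ev tb ?v \<in> W6" using 1 2 by (simp add: W6_def)
  hence a: "ev tb [([I1,I1,I5],-1),([I1,I2,I6],-1),([I2,I1,I6],-1),([I2,I2,I5],1)] \<in> W6"
    by (simp add: m_top_def m_top'_def)
  have d: "dim W6 \<le> length tensor_table"
    using dim_W6_le by (simp add: tensor_table_def)
  note t = T.table_irreducible[OF tensor_table_ok tensor_table_def invariant_W6 a d]
  show "irreducible_module PSU3 act_tens W6" by (rule t(1))
  show "dim W6 = 70" using t(2) by (simp add: tensor_table_def)
qed

theorem theorem2p1:
  shows "is_direct_sum R8_m [W1, W2, W3, W4, W5, W6] \<and>
    (\<forall>W \<in> {W1, W2, W3, W4, W5, W6}. irreducible_module PSU3 act_tens W)"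
proof
  note irr = W_irreducible irreducible_W6(1)
  show "is_direct_sum R8_m [W1, W2, W3, W4, W5, W6]"
  proof (rule is_direct_sumI[OF subspace_R8_m _ _ W_independent])
    show "subspace U" if "U \<in> set [W1, W2, W3, W4, W5, W6]" for U
      using that irr by (auto dest!: irreducible_moduleD(1) invariant_subspaceD(1))
    show "dim R8_m \<le> sum_list (map dim [W1, W2, W3, W4, W5, W6])"
      using dim_R8_m_le by (simp add: W_dim irreducible_W6(2))
  qed (use W_subset in auto)
  show "\<forall>W\<in>{W1, W2, W3, W4, W5, W6}. irreducible_module PSU3 act_tens W"
    using irr by blast
qed

end
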